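(* Let $\omega$ be a concave weight function satisfying $\omega(t)=o(t)$ as $t\to\infty$, and let $U\in\mathscr D(\mathbb R^n)$. Then: (1) $f\in\mathcal B^{\{\omega\}}(U)$ if and only if there exist $F\in C^1_c(\mathbb C^n)$ and $\rho>0$ such that $F|_U=f$ and $$\sup_{z\in\mathbb C^n\setminus\overline U}|\overline\partial F(z)|\exp\big(\rho\,\omega^\star(d(z,\overline U)/\rho)\big)<\infty. \quad ( * )$$ (2) $f\in\mathcal B^{(\omega)}(U)$ if and only if for all $\rho>0$ there exists $F\in C^1_c(\mathbb C^n)$ such that $F|_U=f$ and $( * )$ holds. If $\omega$ is a strong weight function, then the extension $F$ in (2) may be taken independent of $\rho>0$.
   Context: A weight function is a continuous increasing $\omega:[0,\infty)\to[0,\infty)$ with $\omega(0)=0$, $\omega(t)\to\infty$, $\omega(2t)=O(\omega(t))$, $\omega(t)=O(t)$, $\log t=o(\omega(t))$ as $t\to\infty$, and $\varphi(t):=\omega(e^t)$ convex; $\varphi^*(s)=\sup_{t\ge0}(st-\varphi(t))$. $\omega$ is strong if $\int_1^\infty\omega(tu)u^{-2}du\le C\omega(t)+C$ for some $C>0$ and all $t>0$. $\omega^\star(t)=\sup_{s\ge0}(\omega(s)-st)$. $\mathcal B^{\{\omega\}}(U)$ (resp. $\mathcal B^{(\omega)}(U)$) is the set of $f\in C^\infty(U)$ with $\sup_{x\in U,\alpha}|\partial^\alpha f(x)|\exp(-\frac1\rho\varphi^*(\rho|\alpha|))<\infty$ for some (resp. every) $\rho>0$. $d(z,\overline U)=\inf_{x\in\overline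 U}|z-x|$. $\mathscr D(\mathbb R^n)$: non-empty bounded open quasiconvex subsets of $\mathbb R^n$ (any two points joined by a rectifiable path in the set of length $\le C|x-y|$, $C$ fixed). *)

theory Defs
  imports "HOL-Analysis.Analysis" "HOL-Library.Landau_Symbols"
begin

definition weight_function :: "(real \<Rightarrow> real) \<Rightarrow> bool" where
  "weight_function \<omega> \<longleftrightarrow>
     continuous_on {0..} \<omega> \<and> mono_on {0..} \<omega> \<and> \<omega> 0 = 0 \<and>
     (\<forall>t\<ge>0. \<omega> t \<ge> 0) \<and>
     filterlim \<omega> at_top at_top \<and>
     (\<lambda>t. \<omega> (2 * t)) \<in> O[at_top](\<omega>) \<and>
     \<omega> \<in> O[at_top](\<lambda>t. t) \<and>
     ln \<in> o[at_top](\<omega>) \<and>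
     convex_on {0..} (\<lambda>t. \<omega> (exp t))"

definition wphi :: "(real \<Rightarrow> real) \<Rightarrow> real \<Rightarrow> real" where
  "wphi \<omega> t = \<omega> (exp t)"

definition wphi_conj :: "(real \<Rightarrow> real) \<Rightarrow> real \<Rightarrow> real" where
  "wphi_conj \<omega> s = (SUP t\<in>{0..}. s * t - wphi \<omega> t)"

definition wstar :: "(real \<Rightarrow> real) \<Rightarrow> real \<Rightarrow> real" where
  "wstar \<omega> t = (SUP s\<in>{0..}. \<omega> s - s * t)"

definition strong_weight :: "(real \<Rightarrow> real) \<Rightarrow> bool" where
  "strong_weight \<omega> \<longleftrightarrow> weight_function \<omega> \<and>
     (\<exists>C>0. \<forall>t>0. (\<lambda>u. \<omega> (t * u) / u\<^sup>2) integrable_on {1..} \<and>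
                  integral {1..} (\<lambda>u. \<omega> (t * u) / u\<^sup>2) \<le> C * \<omega> t + C)"

definition pderiv_i :: "'n::finite \<Rightarrow> (real^'n \<Rightarrow> complex) \<Rightarrow> real^'n \<Rightarrow> complex" where
  "pderiv_i i f x = (if f differentiable (at x) then frechet_derivative f (at x) (axis i 1) else 0)"

definition pderiv_list :: "'n::finite list \<Rightarrow> (real^'n \<Rightarrow> complex) \<Rightarrow> real^'n \<Rightarrow> complex" where
  "pderiv_list ks f = foldr pderiv_i ks f"

definition pderiv_multi :: "('n::finite \<Rightarrow> nat) \<Rightarrow> (real^'n \<Rightarrow> complex) \<Rightarrow> real^'n \<Rightarrow> complex" where
  "pderiv_multi \<alpha> f = pderiv_list (SOME ks. \<forall>i. count_list ks i = \<alpha> i) f"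

definition mi_abs :: "('n::finite \<Rightarrow> nat) \<Rightarrow> nat" where
  "mi_abs \<alpha> = (\<Sum>i\<in>UNIV. \<alpha> i)"

definition smooth_on :: "(real^'n::finite) set \<Rightarrow> (real^'n \<Rightarrow> complex) \<Rightarrow> bool" where
  "smooth_on U f \<longleftrightarrow> (\<forall>ks. \<forall>x\<in>U. pderiv_list ks f differentiable (at x))"

definition bounded_with :: "(real \<Rightarrow> real) \<Rightarrow> (real^'n::finite) set \<Rightarrow> real \<Rightarrow> (real^'n \<Rightarrow> complex) \<Rightarrow> bool" where
  "bounded_with \<omega> U \<rho> f \<longleftrightarrow>
     (\<exists>C. \<forall>x\<in>U. \<forall>\<alpha>. norm (pderiv_multi \<alpha> f x) * exp (- (1/\<rho>) * wphi_conj \<omega> (\<rho> * real (mi_abs \<alpha>))) \<le> C)"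

definition roumieu_class :: "(real \<Rightarrow> real) \<Rightarrow> (real^'n::finite) set \<Rightarrow> (real^'n \<Rightarrow> complex) set" where
  "roumieu_class \<omega> U = {f. smooth_on U f \<and> (\<exists>\<rho>>0. bounded_with \<omega> U \<rho> f)}"

definition beurling_class :: "(real \<Rightarrow> real) \<Rightarrow> (real^'n::finite) set \<Rightarrow> (real^'n \<Rightarrow> complex) set" where
  "beurling_class \<omega> U = {f. smooth_on U f \<and> (\<forall>\<rho>>0. bounded_with \<omega> U \<rho> f)}"

definition path_length :: "(real \<Rightarrow> 'a::metric_space) \<Rightarrow> ereal" where
  "path_length \<gamma> = (SUP tk \<in> {(t, k). t 0 = 0 \<and> t k = (1::real) \<and> (\<forall>i<k. t i \<le> t (Suc i))}.
        ereal (\<Sum>i<snd tk. dist (\<gamma> (fst tk i)) (\<gamma> (fst tk (Suc i)))))"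

definition quasiconvex_domain :: "(real^'n::finite) set \<Rightarrow> bool" where
  "quasiconvex_domain U \<longleftrightarrow> U \<noteq> {} \<and> bounded U \<and> open U \<and>
     (\<exists>C. \<forall>x\<in>U. \<forall>y\<in>U. \<exists>\<gamma>. path \<gamma> \<and> path_image \<gamma> \<subseteq> U \<and> pathstart \<gamma> = x \<and>
         pathfinish \<gamma> = y \<and> path_length \<gamma> \<le> ereal (C * dist x y))"

definition embed_cn :: "real^'n::finite \<Rightarrow> complex^'n" where
  "embed_cn x = (\<chi> i. complex_of_real (x $ i))"

text \<open>C^1 with compact support (C^n viewed as real vector space R^{2n}).\<close>
definition C1c :: "(complex^'n::finite \<Rightarrow> complex) \<Rightarrow> bool" where
  "C1c F \<longleftrightarrow> (\<exists>F'. (\<forall>z. (F has_derivative blinfun_apply (F' z)) (at z)) \<and> continuous_on UNIV F') \<and>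
             compact (closure {z. F z \<noteq> 0})"

definition dbar :: "(complex^'n::finite \<Rightarrow> complex) \<Rightarrow> complex^'n \<Rightarrow> complex^'n" where
  "dbar F z = (\<chi> j. (frechet_derivative F (at z) (axis j 1)
                     + \<i> * frechet_derivative F (at z) (axis j \<i>)) / 2)"

definition dbar_estimate :: "(real \<Rightarrow> real) \<Rightarrow> (real^'n::finite) set \<Rightarrow> real \<Rightarrow> (complex^'n \<Rightarrow> complex) \<Rightarrow> bool" where
  "dbar_estimate \<omega> U \<rho> F \<longleftrightarrow>
     (\<exists>C. \<forall>z. z \<notin> embed_cn ` closure U \<longrightarrow>
        norm (dbar F z) * exp (\<rho> * wstar \<omega> (infdist z (embed_cn ` closure U) / \<rho>)) \<le> C)"

end

theory Submission
  imports Defs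
begin

text \<open>
  Extension: a function \<open>f\<close> in the class is extended by gluing Taylor polynomials \<open>T\<close>. At the scale
  \<open>4\<^sup>-\<^sup>j\<close> one takes Taylor polynomials of degree \<open>q j + 1\<close> based at a finite net of \<open>U\<close> and combines
  them with a partition of unity; consecutive scales are joined by a telescoping series.
  Quasiconvexity controls the change of the base point, since the derivative of \<open>T\<close> in the
  base point only contains the highest derivatives of \<open>f\<close>. The degree \<open>q j\<close> is an almost optimal
  exponent for the distance \<open>4\<^sup>-\<^sup>j\<close>; it exists because the logarithm of
  \<open>exp (- \<rho> \<omega>\<^sup>\<star> (exp x / \<rho>))\<close> is concave in \<open>x\<close>, which is where the convexity of \<open>\<phi>\<close> enters.
  In the Beurling case one lets the parameter of the weight tend to infinity slowly with \<open>j\<close>, so that a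
  single \<open>F\<close> works for all parameters.

  Converse: by the Bochner--Martinelli formula \<open>f\<close> is on \<open>U\<close> the integral of \<open>dbar F\<close> against a kernel
  homogeneous of degree \<open>1 - 2n\<close>, whose derivatives of order \<open>k\<close> grow like \<open>Q\<^sup>k k! \<bar>w - x\<bar>\<^sup>1\<^sup>-\<^sup>2\<^sup>n\<^sup>-\<^sup>k\<close>.
  These are absorbed by the decay of \<open>dbar F\<close> near \<open>U\<close>, so one may differentiate under the integral.
\<close>

section \<open>Partial derivatives of smooth functions\<close>

text \<open>Why the degree must vary with the scale: the Taylor series of \<open>f\<close> need not
  converge. At distance \<open>d\<close> its term of order \<open>k\<close> has size about
  \<open>M k * d^k / fact k\<close>, where
  \<open>M k = exp (wphi_conj \<omega> (\<rho> * k) / \<rho>)\<close>. Stopping near the smallest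
  term leaves an error of about exp of minus the Young conjugate of \<open>\<omega>\<close> at
  \<open>d\<close>, which is the decay demanded of \<open>dbar F\<close>. Both directions rest on
  this duality between \<open>k\<close> and \<open>d\<close>, mediated by the variable
  \<open>s\<close> of \<open>\<omega>\<close>. Each step loses something: dilations of
  \<open>d\<close>, geometric factors \<open>Q^k\<close>, and powers of \<open>d\<close> from the
  size of the nets and the derivatives of the weights. Concavity of \<open>\<omega>\<close> trades a
  dilation for a change of the parameter, and \<open>ln = o(\<omega>)\<close> lets a larger
  parameter pay for powers of \<open>d\<close>. Thus parameters change by fixed factors only, which
  is harmless because they are quantified over. Since Taylor polynomials are holomorphic in
  \<open>z\<close>, \<open>dbar F\<close> sees only their differences and the derivatives of the
  weights.\<close>

lemma has_derivative_imp_continuous_on: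
  assumes "\<And>z. (f has_derivative f' z) (at z)"
  shows "continuous_on S f"
  using assms by (meson continuous_at_imp_continuous_on has_derivative_continuous)

lemma bounded_of_compact_support:
  fixes f :: "'a::euclidean_space \<Rightarrow> 'b::real_normed_vector"
  assumes "continuous_on UNIV f" "\<And>z. norm z > r \<Longrightarrow> f z = 0"
  obtains B where "B > 0" "\<And>z. norm (f z) \<le> B"
proof -
  have "compact (f ` cball 0 r)"
    using assms(1) by (intro compact_continuous_image) (auto intro: continuous_on_subset)
  then obtain B where B: "B > 0" "\<And>z. z \<in> cball 0 r \<Longrightarrow> norm (f z) \<le> B"
    using compact_imp_bounded[of "f ` cball 0 r"] unfolding bounded_pos by auto
  have "norm (f z) \<le> B" for z
    using B assms(2)[of z] by (cases "norm z \<le> r") auto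
  with B(1) that show thesis
    by blast
qed

lemma pderiv_i_has_derivative:
  assumes "(f has_derivative f') (at x)"
  shows "pderiv_i i f x = f' (axis i 1)"
  using assms unfolding pderiv_i_def
  by (metis differentiableI frechet_derivative_at)

lemma vec_axis_sum: "(h :: real^'n::finite) = (\<Sum>i\<in>UNIV. (h $ i) *\<^sub>R axis i 1)"
  by (simp add: basis_expansion flip: scalar_mult_eq_scaleR)

lemma has_derivative_pderiv_i:
  fixes f :: "real^'n::finite \<Rightarrow> complex"
  assumes "f differentiable (at x)"
  shows "(f has_derivative (\<lambda>h. \<Sum>i\<in>UNIV. (h $ i) *\<^sub>R pderiv_i i f x)) (at x)"
proof -
  let ?D = "frechet_derivative f (at x)"
  have D: "(f has_derivative ?D) (at x)"
    using assms frechet_derivative_works by blast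
  then have lin: "linear ?D"
    by (rule has_derivative_linear)
  have "?D h = (\<Sum>i\<in>UNIV. (h $ i) *\<^sub>R pderiv_i i f x)" for h
  proof -
    have "?D h = ?D (\<Sum>i\<in>UNIV. (h $ i) *\<^sub>R axis i 1)"
      using vec_axis_sum[of h] by simp
    also have "\<dots> = (\<Sum>i\<in>UNIV. (h $ i) *\<^sub>R ?D (axis i 1))"
      by (simp add: linear_sum[OF lin] linear_scale[OF lin])
    finally show ?thesis
      using assms by (simp add: pderiv_i_def)
  qed
  then have "?D = (\<lambda>h. \<Sum>i\<in>UNIV. (h $ i) *\<^sub>R pderiv_i i f x)"
    by blast
  with D show ?thesis
    by simp
qed

text \<open>The second case is needed because \<open>pderiv_i\<close> has the default value 0 where
  the function is not differentiable.\<close>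

lemma pderiv_i_cong:
  assumes "open U" "x \<in> U" "\<And>y. y \<in> U \<Longrightarrow> f y = g y"
  shows "pderiv_i i f x = pderiv_i i g x"
proof (cases "f differentiable (at x)")
  case True
  then have "(f has_derivative frechet_derivative f (at x)) (at x)"
    using frechet_derivative_works by blast
  moreover from this have "(g has_derivative frechet_derivative f (at x)) (at x)"
    by (rule has_derivative_transform_within_open[OF _ assms(1,2)]) (rule assms(3))
  ultimately show ?thesis
    by (simp add: pderiv_i_has_derivative)
next
  case False
  have "\<not> g differentiable (at x)"
  proof
    assume "g differentiable (at x)"
    then obtain g' where "(g has_derivative g') (at x)"
      unfolding differentiable_def by blast
    then have "(f has_derivative g') (at x)"
      by (rule has_derivative_transform_within_open[OF _ assms(1,2)]) (simp add: assms(3))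
    with False show False
      unfolding differentiable_def by blast
  qed
  with False show ?thesis
    by (simp add: pderiv_i_def)
qed

lemma mixed_difference_bound:
  fixes f :: "real^'n::finite \<Rightarrow> complex"
  assumes U: "open U" "x \<in> U" and diff: "\<And>y. y \<in> U \<Longrightarrow> f differentiable (at y)"
    and diff2: "pderiv_i i f differentiable (at x)" and "e > 0"
  shows "\<exists>d>0. \<forall>h. 0 < h \<and> h < d \<longrightarrow>
    norm (f (x + h *\<^sub>R axis i 1 + h *\<^sub>R axis j 1) - f (x + h *\<^sub>R axis i 1)
          - f (x + h *\<^sub>R axis j 1) + f x - (h * h) *\<^sub>R pderiv_i j (pderiv_i i f) x) \<le> e * (h * h)"
proof -
  define L where "L = frechet_derivative (pderiv_i i f) (at x)"
  have L: "(pderiv_i i f has_derivative L) (at x)"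
    using diff2 frechet_derivative_works unfolding L_def by blast
  have linL: "linear L"
    using L by (rule has_derivative_linear)
  have Lj: "pderiv_i j (pderiv_i i f) x = L (axis j 1)"
    by (rule pderiv_i_has_derivative[OF L])
  obtain r where r: "r > 0" "ball x r \<subseteq> U"
    using U open_contains_ball by blast
  obtain d0 where d0: "d0 > 0"
    "\<And>y. norm (y - x) < d0 \<Longrightarrow> norm (pderiv_i i f y - pderiv_i i f x - L (y - x)) \<le> (e/3) * norm (y - x)"
    using L \<open>e > 0\<close> unfolding has_derivative_at_alt by (metis divide_pos_pos zero_less_numeral)
  define d where "d = min r d0 / 2"
  have "d > 0"
    using r d0 by (simp add: d_def)
  moreover have "norm (f (x + h *\<^sub>R axis i 1 + h *\<^sub>R axis j 1) - f (x + h *\<^sub>R axis i 1)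
          - f (x + h *\<^sub>R axis j 1) + f x - (h * h) *\<^sub>R pderiv_i j (pderiv_i i f) x) \<le> e * (h * h)"
    if h: "0 < h" "h < d" for h
  proof -
    let ?ei = "axis i 1 :: real^'n" and ?ej = "axis j 1 :: real^'n"
    \<comment> \<open>With the expected linear term subtracted, the derivative of \<open>g\<close>
      is a difference of two errors of the linear approximation at \<open>x\<close>, at distances at
      most \<open>2 * h\<close> and \<open>h\<close>; hence the tolerance
      \<open>e / 3\<close>.\<close>
    define g where "g s = f (x + s *\<^sub>R ?ei + h *\<^sub>R ?ej) - f (x + s *\<^sub>R ?ei) - (s * h) *\<^sub>R L ?ej" for s
    define g' where "g' s = pderiv_i i f (x + s *\<^sub>R ?ei + h *\<^sub>R ?ej) - pderiv_i i f (x + s *\<^sub>R ?ei) - h *\<^sub>R L ?ej" for s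
    have dist_add: "dist x (x + v) = norm v" for v
      by (simp add: dist_norm)
    have [simp]: "norm ?ei = 1" "norm ?ej = 1"
      by (simp_all add: norm_Basis axis_in_Basis_iff)
    have n1: "norm (s *\<^sub>R ?ei + h *\<^sub>R ?ej) \<le> 2 * h" "norm (s *\<^sub>R ?ei) \<le> h" if "s \<in> {0..h}" for s
      using that norm_triangle_ineq[of "s *\<^sub>R ?ei" "h *\<^sub>R ?ej"] h by auto
    have inU: "x + s *\<^sub>R ?ei + h *\<^sub>R ?ej \<in> U" "x + s *\<^sub>R ?ei \<in> U" if "s \<in> {0..h}" for s
    proof -
      have "x + (s *\<^sub>R ?ei + h *\<^sub>R ?ej) \<in> ball x r" "x + s *\<^sub>R ?ei \<in> ball x r"
        using n1[OF that] h by (simp_all add: d_def dist_add)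
      then show "x + s *\<^sub>R ?ei + h *\<^sub>R ?ej \<in> U" "x + s *\<^sub>R ?ei \<in> U"
        using r by (auto simp: add.assoc)
    qed
    have fder: "((\<lambda>s. f (c + s *\<^sub>R ?ei)) has_vector_derivative pderiv_i i f (c + s *\<^sub>R ?ei)) (at s within S)"
      if "c + s *\<^sub>R ?ei \<in> U" for c s S
    proof -
      have D: "(f has_derivative frechet_derivative f (at (c + s *\<^sub>R ?ei))) (at (c + s *\<^sub>R ?ei))"
        using diff[OF that] frechet_derivative_works by blast
      have lin: "linear (frechet_derivative f (at (c + s *\<^sub>R ?ei)))"
        using D has_derivative_linear by blast
      have "((\<lambda>s. c + s *\<^sub>R ?ei) has_derivative (\<lambda>t. t *\<^sub>R ?ei)) (at s within S)"
        by (auto intro!: derivative_eq_intros)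
      from diff_chain_within[OF this has_derivative_at_withinI[OF D]]
      show ?thesis
        unfolding has_vector_derivative_def o_def
        by (simp add: pderiv_i_has_derivative[OF D] linear_scale[OF lin])
    qed
    have gder: "(g has_derivative (\<lambda>t. t *\<^sub>R g' s)) (at s within {0..h})" if "s \<in> {0..h}" for s
    proof -
      have "((\<lambda>s. f ((x + h *\<^sub>R ?ej) + s *\<^sub>R ?ei)) has_vector_derivative pderiv_i i f ((x + h *\<^sub>R ?ej) + s *\<^sub>R ?ei)) (at s within {0..h})"
        using inU(1)[OF that] by (intro fder) (simp add: ac_simps)
      moreover have "((\<lambda>s. f (x + s *\<^sub>R ?ei)) has_vector_derivative pderiv_i i f (x + s *\<^sub>R ?ei)) (at s within {0..h})"
        using inU(2)[OF that] by (intro fder)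
      moreover have "((\<lambda>s. (s * h) *\<^sub>R L ?ej) has_vector_derivative h *\<^sub>R L ?ej) (at s within {0..h})"
        by (auto intro!: derivative_eq_intros)
      ultimately show ?thesis
        unfolding has_vector_derivative_def[symmetric] g_def[abs_def] g'_def
        by (auto intro!: has_vector_derivative_diff simp: ac_simps)
    qed
    have g'b: "norm (g' s) \<le> e * h" if "s \<in> {0..h}" for s
    proof -
      let ?a = "s *\<^sub>R ?ei + h *\<^sub>R ?ej" and ?b = "s *\<^sub>R ?ei"
      have a: "norm (pderiv_i i f (x + ?a) - pderiv_i i f x - L ?a) \<le> (e/3) * norm ?a"
        using d0(2)[of "x + ?a"] n1[OF that] h by (simp add: d_def)
      have b: "norm (pderiv_i i f (x + ?b) - pderiv_i i f x - L ?b) \<le> (e/3) * norm ?b"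
        using d0(2)[of "x + ?b"] n1[OF that] h by (simp add: d_def)
      have "g' s = (pderiv_i i f (x + ?a) - pderiv_i i f x - L ?a) - (pderiv_i i f (x + ?b) - pderiv_i i f x - L ?b)"
        unfolding g'_def by (simp add: linear_add[OF linL] linear_scale[OF linL] add.assoc)
      then have "norm (g' s) \<le> (e/3) * norm ?a + (e/3) * norm ?b"
        using a b norm_triangle_ineq4 by (smt (verit))
      also have "\<dots> \<le> (e/3) * (2*h) + (e/3) * h"
        using n1[OF that] \<open>e > 0\<close> by (intro add_mono mult_left_mono) auto
      finally show ?thesis by simp
    qed
    have "norm (g h - g 0) \<le> (e * h) * norm (h - 0)"
    proof (rule differentiable_bound[where S = "{0..h}" and f' = "\<lambda>s t. t *\<^sub>R g' s"])
      show "onorm (\<lambda>t. t *\<^sub>R g' s) \<le> e * h" if "s \<in> {0..h}" for s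
        using g'b[OF that] by (intro onorm_le) (simp add: mult.commute mult_left_mono)
    qed (use gder h in auto)
    moreover have "g h - g 0 = f (x + h *\<^sub>R axis i 1 + h *\<^sub>R axis j 1) - f (x + h *\<^sub>R axis i 1)
          - f (x + h *\<^sub>R axis j 1) + f x - (h * h) *\<^sub>R pderiv_i j (pderiv_i i f) x"
      unfolding g_def Lj by simp
    ultimately show ?thesis
      using h by simp
  qed
  ultimately show ?thesis
    by blast
qed

text \<open>The second difference is symmetric in the two directions, and divided by
  \<open>h * h\<close> it tends to both mixed derivatives.\<close>

lemma pderiv_i_commute:
  fixes f :: "real^'n::finite \<Rightarrow> complex"
  assumes U: "open U" "x \<in> U" and diff: "\<And>y. y \<in> U \<Longrightarrow> f differentiable (at y)"
    and d2: "pderiv_i i f differentiable (at x)" "pderiv_i j f differentiable (at x)"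
  shows "pderiv_i j (pderiv_i i f) x = pderiv_i i (pderiv_i j f) x" (is "?A = ?B")
proof (rule ccontr)
  assume ne: "?A \<noteq> ?B"
  define e where "e = norm (?A - ?B) / 3"
  have "e > 0"
    using ne by (simp add: e_def)
  let ?\<Delta> = "\<lambda>i j h. f (x + h *\<^sub>R axis i 1 + h *\<^sub>R axis j 1) - f (x + h *\<^sub>R axis i 1)
          - f (x + h *\<^sub>R axis j 1) + f x"
  obtain d1 where d1: "d1 > 0" "\<And>h. 0 < h \<Longrightarrow> h < d1 \<Longrightarrow> norm (?\<Delta> i j h - (h * h) *\<^sub>R ?A) \<le> e * (h * h)"
    using mixed_difference_bound[OF U diff d2(1) \<open>e > 0\<close>, of j] by blast
  obtain d2 where d2: "d2 > 0" "\<And>h. 0 < h \<Longrightarrow> h < d2 \<Longrightarrow> norm (?\<Delta> j i h - (h * h) *\<^sub>R ?B) \<le> e * (h * h)"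
    using mixed_difference_bound[OF U diff d2(2) \<open>e > 0\<close>, of i] by blast
  define h where "h = min d1 d2 / 2"
  have h: "h > 0" "h < d1" "h < d2"
    using d1 d2 by (auto simp: h_def)
  have eq: "?\<Delta> j i h = ?\<Delta> i j h"
    by (simp add: add.assoc add.commute add.left_commute)
  have "(h * h) * norm (?A - ?B) = norm ((h * h) *\<^sub>R ?A - (h * h) *\<^sub>R ?B)"
    by (simp flip: scaleR_diff_right)
  also have "\<dots> \<le> norm (?\<Delta> i j h - (h * h) *\<^sub>R ?A) + norm (?\<Delta> j i h - (h * h) *\<^sub>R ?B)"
    using norm_triangle_ineq4[of "?\<Delta> j i h - (h * h) *\<^sub>R ?B" "?\<Delta> i j h - (h * h) *\<^sub>R ?A"]
    unfolding eq by (simp add: algebra_simps)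
  also have "\<dots> \<le> 2 * e * (h * h)"
    using d1(2)[OF h(1,2)] d2(2)[OF h(1,3)] by simp
  finally have "norm (?A - ?B) \<le> 2 * e"
    using h(1) by (simp add: mult.commute)
  with \<open>e > 0\<close> show False
    by (simp add: e_def)
qed

lemma pderiv_list_Cons: "pderiv_list (k # ks) f = pderiv_i k (pderiv_list ks f)"
  by (simp add: pderiv_list_def)

lemma pderiv_list_Nil [simp]: "pderiv_list [] f = f"
  by (simp add: pderiv_list_def)

lemma pderiv_list_move:
  assumes "smooth_on U f" "open U" "x \<in> U"
  shows "pderiv_list (ks @ k # ls) f x = pderiv_list (k # ks @ ls) f x"
  using assms(3)
proof (induction ks arbitrary: x)
  case (Cons l ks)
  have "pderiv_list ((l # ks) @ k # ls) f x = pderiv_i l (pderiv_list (k # ks @ ls) f) x"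
    using Cons by (simp add: pderiv_list_Cons) (rule pderiv_i_cong[OF assms(2)], auto simp: pderiv_list_Cons)
  also have "\<dots> = pderiv_i k (pderiv_i l (pderiv_list (ks @ ls) f)) x"
    using assms(1) Cons.prems unfolding pderiv_list_Cons
    by (intro pderiv_i_commute[OF assms(2)]) (auto simp: smooth_on_def simp flip: pderiv_list_Cons)
  finally show ?case
    by (simp add: pderiv_list_Cons)
qed simp

lemma pderiv_list_mset:
  assumes "smooth_on U f" "open U" "x \<in> U" "mset ks = mset ls"
  shows "pderiv_list ks f x = pderiv_list ls f x"
  using assms(3,4)
proof (induction ks arbitrary: ls x)
  case (Cons k ks)
  then obtain l1 l2 where ls: "ls = l1 @ k # l2"
    by (metis list.set_intros(1) set_mset_mset split_list)
  have "mset ks = mset (l1 @ l2)"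
    using Cons.prems(2) unfolding ls by simp
  then have "pderiv_list ks f y = pderiv_list (l1 @ l2) f y" if "y \<in> U" for y
    using Cons.IH that by blast
  then have "pderiv_list (k # ks) f x = pderiv_list (k # l1 @ l2) f x"
    unfolding pderiv_list_Cons using Cons.prems by (intro pderiv_i_cong[OF assms(2)]) auto
  also have "\<dots> = pderiv_list ls f x"
    unfolding ls using pderiv_list_move[OF assms(1,2) Cons.prems(1)] by simp
  finally show ?case .
qed simp

section \<open>Multi-indices as multisets of coordinates\<close>

lemma count_list_mset: "count_list ks i = count (mset ks) i"
  by (induction ks) auto

text \<open>\<open>pderiv_multi\<close> picks some list with the prescribed multiplicities; as the
  partial derivatives commute, the choice is immaterial.\<close>

lemma pderiv_multi_mset:
  assumes "smooth_on U f" "open U" "x \<in> U"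
  shows "pderiv_multi (count (mset ks)) f x = pderiv_list ks f x"
proof -
  let ?ls = "SOME ls. \<forall>i. count_list ls i = count (mset ks) i"
  have "\<forall>i. count_list ?ls i = count (mset ks) i"
    by (rule someI[of _ ks]) (simp add: count_list_mset)
  then have "mset ?ls = mset ks"
    by (intro multiset_eqI) (simp add: count_list_mset)
  then show ?thesis
    unfolding pderiv_multi_def using pderiv_list_mset[OF assms] by blast
qed

lemma mi_abs_count: "mi_abs (count m) = size (m :: 'n::finite multiset)"
  unfolding mi_abs_def size_multiset_overloaded_eq
  by (rule sum.mono_neutral_right) (auto simp: count_eq_zero_iff)

lemma multi_index_mset: 
  fixes \<alpha> :: "'n::finite \<Rightarrow> nat"
  obtains ks where "\<alpha> = count (mset ks)" "mi_abs \<alpha> = length ks"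
proof -
  obtain ks where "mset ks = Abs_multiset \<alpha>"
    using ex_mset by blast
  moreover have "count (Abs_multiset \<alpha>) = \<alpha>"
    by (rule count_Abs_multiset) simp
  ultimately have "\<alpha> = count (mset ks)"
    by simp
  then show ?thesis
    using that mi_abs_count by (metis size_mset)
qed

text \<open>The form in which smoothness enters the extension: it makes the partial derivatives of
  \<open>f\<close> an instance of the locale \<open>jet\<close>.\<close>

lemma pderiv_multi_has_derivative:
  assumes "smooth_on U f" "open U" "x \<in> U"
  shows "(pderiv_multi (count m) f has_derivative
    (\<lambda>h. \<Sum>i\<in>UNIV. (h $ i) *\<^sub>R pderiv_multi (count (add_mset i m)) f x)) (at x)"
proof -
  obtain ks where ks: "mset ks = m"
    using ex_mset by blast
  have "(pderiv_list ks f has_derivative (\<lambda>h. \<Sum>i\<in>UNIV. (h $ i) *\<^sub>R pderiv_list (i # ks) f x)) (at x)"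
    using assms unfolding pderiv_list_Cons smooth_on_def by (intro has_derivative_pderiv_i) blast
  then have "(pderiv_multi (count m) f has_derivative
      (\<lambda>h. \<Sum>i\<in>UNIV. (h $ i) *\<^sub>R pderiv_list (i # ks) f x)) (at x)"
    by (rule has_derivative_transform_within_open[OF _ assms(2,3)])
       (simp add: pderiv_multi_mset[OF assms(1,2)] flip: ks)
  moreover have "pderiv_list (i # ks) f x = pderiv_multi (count (add_mset i m)) f x" for i
    using pderiv_multi_mset[OF assms, of "i # ks"] by (simp add: ks)
  ultimately show ?thesis
    by simp
qed

section \<open>Taylor polynomials of jets\<close>

text \<open>
  Jets are indexed by multisets of coordinates, which builds in that partial derivatives commute:
  \<open>a m\<close> stands for the derivative of \<open>a {#}\<close> by the coordinates in \<open>m\<close>. The homogeneous part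
  \<open>taylor_term a u \<zeta> k m\<close> is \<open>k!\<close> times the part of degree \<open>k\<close> of the Taylor series of \<open>a m\<close> at \<open>u\<close>.
\<close>

primrec taylor_term :: "('n::finite multiset \<Rightarrow> real^'n \<Rightarrow> complex) \<Rightarrow> real^'n \<Rightarrow> complex^'n \<Rightarrow> nat \<Rightarrow> 'n multiset \<Rightarrow> complex" where
  "taylor_term a u \<zeta> 0 m = a m u"
| "taylor_term a u \<zeta> (Suc k) m = (\<Sum>i\<in>UNIV. \<zeta> $ i * taylor_term a u \<zeta> k (add_mset i m))"

text \<open>\<open>p\<close> counts the terms, so the degree is \<open>p - 1\<close>. The base point
  is real and the argument complex: this is the holomorphic extension of the real Taylor
  polynomial.\<close>

definition taylor :: "('n::finite multiset \<Rightarrow> real^'n \<Rightarrow> complex) \<Rightarrow> nat \<Rightarrow> 'n multiset \<Rightarrow> real^'n \<Rightarrow> complex^'n \<Rightarrow> complex" where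
  "taylor a p m u z = (\<Sum>k<p. taylor_term a u (z - embed_cn u) k m / fact k)"

lemma has_derivative_divide_const':
  fixes f :: "'a::real_normed_vector \<Rightarrow> complex"
  assumes "(f has_derivative f') F"
  shows "((\<lambda>x. f x / c) has_derivative (\<lambda>h. f' h / c)) F"
  using bounded_linear.has_derivative[OF bounded_linear_divide assms] .

lemma embed_cn_linear: "bounded_linear embed_cn"
proof -
  have "linear (embed_cn :: real^'n \<Rightarrow> complex^'n)"
    by (rule linearI) (simp_all add: embed_cn_def vec_eq_iff scaleR_complex.simps complex_eq_iff)
  then show ?thesis
    by (simp add: linear_conv_bounded_linear)
qed

lemma norm_embed_cn [simp]: "norm (embed_cn x) = norm x"
  by (simp add: norm_vec_def embed_cn_def L2_set_def)

lemma compact_embed_closure: "bounded U \<Longrightarrow> compact (embed_cn ` closure U)"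
  by (intro compact_continuous_image) (auto simp: embed_cn_linear linear_continuous_on)

lemma infdist_embed_closure_pos:
  assumes "bounded U" "U \<noteq> {}" "z \<notin> embed_cn ` closure U"
  shows "infdist z (embed_cn ` closure U) > 0"
  using assms compact_embed_closure by (intro infdist_pos_not_in_closed compact_imp_closed) auto

lemma embed_cn_diff: "embed_cn (x - y) = embed_cn x - embed_cn y"
  by (simp add: embed_cn_def vec_eq_iff)

lemma dist_embed_cn [simp]: "dist (embed_cn x) (embed_cn y) = dist x y"
  by (simp add: dist_norm flip: embed_cn_diff)

lemma embed_cn_nth [simp]: "embed_cn x $ i = complex_of_real (x $ i)"
  by (simp add: embed_cn_def)

lemma norm_taylor_term_le:
  fixes a :: "'n::finite multiset \<Rightarrow> real^'n \<Rightarrow> complex"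
  assumes "\<And>m'. size m' = size m + k \<Longrightarrow> norm (a m' u) \<le> B"
  shows "norm (taylor_term a u \<zeta> k m) \<le> (real CARD('n) * norm \<zeta>) ^ k * B"
  using assms
proof (induction k arbitrary: m)
  case (Suc k)
  have "norm (taylor_term a u \<zeta> (Suc k) m) \<le> (\<Sum>i::'n\<in>UNIV. norm \<zeta> * ((real CARD('n) * norm \<zeta>) ^ k * B))"
    unfolding taylor_term.simps
  proof (rule order_trans[OF norm_sum sum_mono])
    fix i :: 'n
    have "norm (taylor_term a u \<zeta> k (add_mset i m)) \<le> (real CARD('n) * norm \<zeta>) ^ k * B"
      using Suc by simp
    then show "norm (\<zeta> $ i * taylor_term a u \<zeta> k (add_mset i m)) \<le> norm \<zeta> * ((real CARD('n) * norm \<zeta>) ^ k * B)"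
      unfolding norm_mult by (intro mult_mono) (auto simp: Finite_Cartesian_Product.norm_nth_le)
  qed
  then show ?case
    by (simp add: mult.assoc)
qed simp

text \<open>Keeps only the compatibility of the entries under differentiation; bounds on their size
  enter separately.\<close>

locale jet =
  fixes a :: "'n::finite multiset \<Rightarrow> real^'n \<Rightarrow> complex" and U :: "(real^'n) set"
  assumes jet_derivative: "u \<in> U \<Longrightarrow>
    (a m has_derivative (\<lambda>h. \<Sum>i\<in>UNIV. (h $ i) *\<^sub>R a (add_mset i m) u)) (at u)"
begin

text \<open>The base point occurs in the coefficient and in \<open>z - embed_cn u\<close>. The
  second contribution lowers the degree by one and carries the factor \<open>k\<close>, so the
  truncated \<open>k - 1\<close> does no harm at \<open>k = 0\<close>.\<close>

lemma taylor_term_has_derivative_base: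
  assumes "u \<in> U"
  shows "((\<lambda>u. taylor_term a u (z - embed_cn u) k m) has_derivative
    (\<lambda>h. \<Sum>i\<in>UNIV. (h $ i) *\<^sub>R (taylor_term a u (z - embed_cn u) k (add_mset i m)
            - of_nat k * taylor_term a u (z - embed_cn u) (k - 1) (add_mset i m)))) (at u)"
proof (induction k arbitrary: m)
  case 0
  then show ?case
    using jet_derivative[OF assms] by simp
next
  case (Suc k)
  let ?\<zeta> = "z - embed_cn u"
  let ?t = "taylor_term a u ?\<zeta>"
  have d: "((\<lambda>u. (z - embed_cn u) $ l) has_derivative (\<lambda>h. - complex_of_real (h $ l))) (at u)" for l
    by (auto intro!: derivative_eq_intros bounded_linear_imp_has_derivative bounded_linear_compose[OF bounded_linear_of_real bounded_linear_vec_nth])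
  have "((\<lambda>u. \<Sum>l\<in>UNIV. (z - embed_cn u) $ l * taylor_term a u (z - embed_cn u) k (add_mset l m)) has_derivative
     (\<lambda>h. \<Sum>l\<in>UNIV. ?\<zeta> $ l * (\<Sum>i\<in>UNIV. (h $ i) *\<^sub>R (?t k (add_mset i (add_mset l m)) - of_nat k * ?t (k - 1) (add_mset i (add_mset l m))))
        + - complex_of_real (h $ l) * ?t k (add_mset l m))) (at u)"
    by (intro has_derivative_sum has_derivative_mult d Suc.IH)
  moreover have "(\<Sum>l\<in>UNIV. ?\<zeta> $ l * (\<Sum>i\<in>UNIV. (h $ i) *\<^sub>R (?t k (add_mset i (add_mset l m)) - of_nat k * ?t (k - 1) (add_mset i (add_mset l m))))
        + - complex_of_real (h $ l) * ?t k (add_mset l m)) =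
      (\<Sum>i\<in>UNIV. (h $ i) *\<^sub>R (?t (Suc k) (add_mset i m) - of_nat (Suc k) * ?t (Suc k - 1) (add_mset i m)))" for h :: "real^'n"
  proof -
    have k: "of_nat k * (\<Sum>l\<in>UNIV. ?\<zeta> $ l * ?t (k - 1) (add_mset l (add_mset i m))) = of_nat k * ?t k (add_mset i m)" for i
      by (cases k) auto
    have "(\<Sum>l\<in>UNIV. ?\<zeta> $ l * (\<Sum>i\<in>UNIV. (h $ i) *\<^sub>R (?t k (add_mset i (add_mset l m)) - of_nat k * ?t (k - 1) (add_mset i (add_mset l m)))))
      = (\<Sum>i\<in>UNIV. \<Sum>l\<in>UNIV. ?\<zeta> $ l * ((h $ i) *\<^sub>R (?t k (add_mset i (add_mset l m)) - of_nat k * ?t (k - 1) (add_mset i (add_mset l m)))))"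
      unfolding sum_distrib_left by (rule sum.swap)
    also have "\<dots> = (\<Sum>i\<in>UNIV. (h $ i) *\<^sub>R ((\<Sum>l\<in>UNIV. ?\<zeta> $ l * ?t k (add_mset l (add_mset i m)))
         - of_nat k * (\<Sum>l\<in>UNIV. ?\<zeta> $ l * ?t (k - 1) (add_mset l (add_mset i m)))))"
      unfolding sum_distrib_left scaleR_sum_right sum_subtractf[symmetric]
      by (intro sum.cong refl) (simp add: algebra_simps add_mset_commute scaleR_conv_of_real)
    also have "\<dots> = (\<Sum>i\<in>UNIV. (h $ i) *\<^sub>R (?t (Suc k) (add_mset i m) - of_nat k * ?t k (add_mset i m)))"
      unfolding k by simp
    finally have *: "(\<Sum>l\<in>UNIV. ?\<zeta> $ l * (\<Sum>i\<in>UNIV. (h $ i) *\<^sub>R (?t k (add_mset i (add_mset l m)) - of_nat k * ?t (k - 1) (add_mset i (add_mset l m))))) =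
      (\<Sum>i\<in>UNIV. (h $ i) *\<^sub>R (?t (Suc k) (add_mset i m) - of_nat k * ?t k (add_mset i m)))" .
    have **: "(\<Sum>i\<in>UNIV. (h $ i) *\<^sub>R (P i - of_nat k * Q i)) + (\<Sum>i\<in>UNIV. - complex_of_real (h $ i) * Q i)
      = (\<Sum>i\<in>UNIV. (h $ i) *\<^sub>R (P i - of_nat (Suc k) * Q i))" for P Q
      unfolding sum.distrib[symmetric] by (simp add: algebra_simps scaleR_conv_of_real)
    show ?thesis
      unfolding sum.distrib * ** by simp
  qed
  ultimately show ?case
    by simp
qed

text \<open>After division by the factorials the contributions of consecutive degrees cancel and
  only the highest derivatives survive. This is the integrand of the classical Taylor remainder, and
  the reason why moving the base point costs no more in order than changing the degree.\<close>

lemma taylor_has_derivative_base: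
  assumes "u \<in> U"
  shows "((\<lambda>u. taylor a (Suc q) m u z) has_derivative
    (\<lambda>h. \<Sum>i\<in>UNIV. (h $ i) *\<^sub>R (taylor_term a u (z - embed_cn u) q (add_mset i m) / fact q))) (at u)"
proof (induction q)
  case 0
  then show ?case
    using jet_derivative[OF assms] by (simp add: taylor_def)
next
  case (Suc q)
  let ?t = "\<lambda>k i. taylor_term a u (z - embed_cn u) k (add_mset i m)"
  have "((\<lambda>u. taylor a (Suc q) m u z + taylor_term a u (z - embed_cn u) (Suc q) m / fact (Suc q)) has_derivative
    (\<lambda>h. (\<Sum>i\<in>UNIV. (h $ i) *\<^sub>R (?t q i / fact q)) +
        (\<Sum>i\<in>UNIV. (h $ i) *\<^sub>R (?t (Suc q) i - of_nat (Suc q) * ?t (Suc q - 1) i)) / fact (Suc q))) (at u)"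
    by (intro has_derivative_add Suc.IH has_derivative_divide_const') (rule taylor_term_has_derivative_base[OF assms])
  moreover have "(\<Sum>i\<in>UNIV. (h $ i) *\<^sub>R (?t q i / fact q)) +
        (\<Sum>i\<in>UNIV. (h $ i) *\<^sub>R (?t (Suc q) i - of_nat (Suc q) * ?t (Suc q - 1) i)) / fact (Suc q)
     = (\<Sum>i\<in>UNIV. (h $ i) *\<^sub>R (?t (Suc q) i / fact (Suc q)))" for h :: "real^'n"
  proof -
    have "(h $ i) *\<^sub>R (?t q i / fact q) + (h $ i) *\<^sub>R (?t (Suc q) i - of_nat (Suc q) * ?t (Suc q - 1) i) / fact (Suc q)
       = (h $ i) *\<^sub>R (?t (Suc q) i / fact (Suc q))" for i
    proof -
      have "of_nat (Suc q) * ?t q i / fact (Suc q) = ?t q i / fact q"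
        by (simp del: of_nat_Suc)
      then show ?thesis
        by (simp only: diff_Suc_1 scaleR_conv_of_real times_divide_eq_right[symmetric] distrib_left[symmetric] diff_divide_distrib) simp
    qed
    then show ?thesis
      unfolding sum_divide_distrib sum.distrib[symmetric] by simp
  qed
  moreover have "taylor a (Suc (Suc q)) m u z = taylor a (Suc q) m u z + taylor_term a u (z - embed_cn u) (Suc q) m / fact (Suc q)" for u
    by (simp add: taylor_def)
  ultimately show ?case
    by (simp only:)
qed

end

lemma taylor_term_has_derivative:
  "((\<lambda>z. taylor_term a u (z - v) k m) has_derivative
    (\<lambda>h. of_nat k * (\<Sum>i\<in>UNIV. h $ i * taylor_term a u (z - v) (k - 1) (add_mset i m)))) (at z)"
proof (induction k arbitrary: m)
  case (Suc k)
  let ?t = "taylor_term a u (z - v)"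
  have d: "((\<lambda>z. (z - v) $ l) has_derivative (\<lambda>h. h $ l)) (at z)" for l
    by (auto intro!: derivative_eq_intros bounded_linear_imp_has_derivative bounded_linear_vec_nth)
  have "((\<lambda>z. \<Sum>l\<in>UNIV. (z - v) $ l * taylor_term a u (z - v) k (add_mset l m)) has_derivative
     (\<lambda>h. \<Sum>l\<in>UNIV. (z - v) $ l * (of_nat k * (\<Sum>i\<in>UNIV. h $ i * ?t (k - 1) (add_mset i (add_mset l m)))) + h $ l * ?t k (add_mset l m))) (at z)"
    by (intro has_derivative_sum has_derivative_mult d Suc.IH)
  moreover have "(\<Sum>l\<in>UNIV. (z - v) $ l * (of_nat k * (\<Sum>i\<in>UNIV. h $ i * ?t (k - 1) (add_mset i (add_mset l m)))) + h $ l * ?t k (add_mset l m))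
     = of_nat (Suc k) * (\<Sum>i\<in>UNIV. h $ i * ?t (Suc k - 1) (add_mset i m))" for h
  proof -
    have k: "of_nat k * (\<Sum>l\<in>UNIV. (z - v) $ l * ?t (k - 1) (add_mset l (add_mset i m))) = of_nat k * ?t k (add_mset i m)" for i
      by (cases k) auto
    have "(\<Sum>l\<in>UNIV. (z - v) $ l * (of_nat k * (\<Sum>i\<in>UNIV. h $ i * ?t (k - 1) (add_mset i (add_mset l m)))))
      = (\<Sum>i\<in>UNIV. \<Sum>l\<in>UNIV. (z - v) $ l * (of_nat k * (h $ i * ?t (k - 1) (add_mset i (add_mset l m)))))"
      unfolding sum_distrib_left by (rule sum.swap)
    also have "\<dots> = (\<Sum>i\<in>UNIV. h $ i * (of_nat k * (\<Sum>l\<in>UNIV. (z - v) $ l * ?t (k - 1) (add_mset l (add_mset i m)))))"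
      unfolding sum_distrib_left by (intro sum.cong refl) (simp add: mult_ac add_mset_commute)
    finally show ?thesis
      unfolding k by (simp add: sum.distrib algebra_simps sum_distrib_left)
  qed
  ultimately show ?case
    by simp
qed simp

text \<open>The derivative is complex linear in \<open>h\<close>, so the polynomial is holomorphic;
  it is again a Taylor polynomial, of the shifted jet and with one term less.\<close>

lemma taylor_has_derivative:
  "((taylor a (Suc p) m u) has_derivative (\<lambda>h. \<Sum>i\<in>UNIV. h $ i * taylor a p (add_mset i m) u z)) (at z)"
proof (induction p)
  case 0
  then show ?case
    by (simp add: taylor_def[abs_def])
next
  case (Suc p)
  let ?t = "\<lambda>k i. taylor_term a u (z - embed_cn u) k (add_mset i m)"
  have "((\<lambda>z. taylor a (Suc p) m u z + taylor_term a u (z - embed_cn u) (Suc p) m / fact (Suc p)) has_derivative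
    (\<lambda>h. (\<Sum>i\<in>UNIV. h $ i * taylor a p (add_mset i m) u z)
       + of_nat (Suc p) * (\<Sum>i\<in>UNIV. h $ i * ?t (Suc p - 1) i) / fact (Suc p))) (at z)"
    by (intro has_derivative_add Suc.IH has_derivative_divide_const') (rule taylor_term_has_derivative)
  moreover have "(\<Sum>i\<in>UNIV. h $ i * taylor a p (add_mset i m) u z)
       + of_nat (Suc p) * (\<Sum>i\<in>UNIV. h $ i * ?t (Suc p - 1) i) / fact (Suc p)
     = (\<Sum>i\<in>UNIV. h $ i * taylor a (Suc p) (add_mset i m) u z)" for h
  proof -
    have "of_nat (Suc p) * (\<Sum>i\<in>UNIV. h $ i * ?t (Suc p - 1) i) / fact (Suc p) = (\<Sum>i\<in>UNIV. h $ i * (?t p i / fact p))"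
      by (simp add: sum_divide_distrib del: of_nat_Suc)
    then show ?thesis
      by (simp add: taylor_def distrib_left sum.distrib)
  qed
  moreover have "taylor a (Suc (Suc p)) m u =
      (\<lambda>z. taylor a (Suc p) m u z + taylor_term a u (z - embed_cn u) (Suc p) m / fact (Suc p))"
    by (rule ext) (simp add: taylor_def)
  ultimately show ?case
    by (simp only:)
qed

lemma taylor_at_base: "taylor a (Suc p) m u (embed_cn u) = a m u"
proof -
  have "taylor_term a u 0 k m = 0" if "k > 0" for k
    using that by (cases k) auto
  then show ?thesis
    unfolding taylor_def by (subst sum.lessThan_Suc_shift) simp
qed

text \<open>The factor 2 in the hypothesis leaves \<open>(1/2)^k\<close> for each term, so one
  \<open>\<epsilon>\<close> controls any range of degrees by a geometric series.\<close>

lemma norm_taylor_diff_degree: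
  fixes a :: "'n::finite multiset \<Rightarrow> real^'n \<Rightarrow> complex"
  assumes "p \<le> p'" "\<epsilon> \<ge> 0"
    and "\<And>k m'. p \<le> k \<Longrightarrow> k < p' \<Longrightarrow> size m' = size m + k \<Longrightarrow>
      norm (a m' u) * (2 * real CARD('n) * norm (z - embed_cn u)) ^ k \<le> fact k * \<epsilon>"
  shows "norm (taylor a p' m u z - taylor a p m u z) \<le> 2 * \<epsilon>"
proof -
  let ?\<zeta> = "z - embed_cn u" and ?n = "real CARD('n)"
  have "norm (taylor_term a u ?\<zeta> k m / fact k) \<le> (1/2)^k * \<epsilon>" if k: "p \<le> k" "k < p'" for k
  \<comment> \<open>The bound on the jet is obtained through division by a power of the norm, so the
    base point is treated separately; there all terms of positive degree vanish.\<close>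
  proof (cases "?\<zeta> = 0 \<and> k > 0")
    case True
    then have "taylor_term a u ?\<zeta> k m = 0"
      by (cases k) auto
    with \<open>\<epsilon> \<ge> 0\<close> k show ?thesis
      by simp
  next
    case False
    then have pos: "(2 * ?n * norm ?\<zeta>) ^ k > 0"
      by (cases "k = 0") auto
    have "norm (taylor_term a u ?\<zeta> k m) \<le> (?n * norm ?\<zeta>) ^ k * (fact k * \<epsilon> / (2 * ?n * norm ?\<zeta>) ^ k)"
      using assms(3)[OF k] pos by (intro norm_taylor_term_le) (simp add: pos_le_divide_eq add.commute)
    also have "\<dots> = (1/2) ^ k * \<epsilon> * fact k"
    proof -
      define X where "X = (?n * norm ?\<zeta>) ^ k"
      have "(2 * ?n * norm ?\<zeta>) ^ k = 2 ^ k * X"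
        unfolding X_def by (simp only: mult.assoc power_mult_distrib)
      moreover from this have "X > 0"
        using pos by (simp add: zero_less_mult_iff)
      ultimately show ?thesis
        unfolding X_def[symmetric] by (simp add: power_one_over)
    qed
    finally show ?thesis
      by (simp add: norm_divide pos_divide_le_eq)
  qed
  then have "norm (\<Sum>k\<in>{p..<p'}. taylor_term a u ?\<zeta> k m / fact k) \<le> (\<Sum>k\<in>{p..<p'}. (1/2)^k * \<epsilon>)"
    by (intro order_trans[OF norm_sum] sum_mono) auto
  also have "\<dots> = (\<Sum>k\<in>{p..<p'}. (1/2)^k) * \<epsilon>"
    by (simp add: sum_distrib_right)
  also have "\<dots> \<le> 2 * \<epsilon>"
  proof -
    have "(\<Sum>k\<in>{p..<p'}. (1/2::real)^k) \<le> (\<Sum>k. (1/2)^k)"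
      by (rule sum_le_suminf) auto
    also have "\<dots> = 2"
      by (simp add: suminf_geometric)
    finally show ?thesis
      using \<open>\<epsilon> \<ge> 0\<close> by (rule mult_right_mono)
  qed
  also have "(\<Sum>k\<in>{p..<p'}. taylor_term a u ?\<zeta> k m / fact k) = taylor a p' m u z - taylor a p m u z"
    unfolding taylor_def using assms(1) sum_diff_nat_ivl[of 0 p p' "\<lambda>k. taylor_term a u ?\<zeta> k m / fact k"]
    by (simp add: atLeast0LessThan)
  finally show ?thesis .
qed

section \<open>Change of base point along rectifiable paths\<close>

lemma path_length_ge_sum:
  assumes "t 0 = 0" "t k = 1" "\<And>i. i < k \<Longrightarrow> t i \<le> t (Suc i)" "path_length \<gamma> \<le> ereal L"
  shows "(\<Sum>i<k. dist (\<gamma> (t i)) (\<gamma> (t (Suc i)))) \<le> L"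
proof -
  have "ereal (\<Sum>i<k. dist (\<gamma> (t i)) (\<gamma> (t (Suc i)))) \<le> path_length \<gamma>"
    unfolding path_length_def using assms by (intro SUP_upper2[of "(t, k)"]) auto
  with assms(4) show ?thesis
    by (meson ereal_less_eq(3) order_trans)
qed

lemma path_image_dist_start:
  assumes "path_length \<gamma> \<le> ereal L" "p \<in> path_image \<gamma>"
  shows "dist (pathstart \<gamma>) p \<le> L"
proof -
  obtain s where s: "s \<in> {0..1}" "p = \<gamma> s"
    using assms(2) by (auto simp: path_image_def)
  let ?t = "\<lambda>i::nat. if i = 0 then 0 else if i = 1 then s else 1"
  have "(\<Sum>i<2. dist (\<gamma> (?t i)) (\<gamma> (?t (Suc i)))) \<le> L"
    using s by (intro path_length_ge_sum[OF _ _ _ assms(1)]) auto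
  then have "dist (\<gamma> 0) (\<gamma> s) + dist (\<gamma> s) (\<gamma> 1) \<le> L"
    by (simp add: numeral_2_eq_2)
  then show ?thesis
    using zero_le_dist[of "\<gamma> s" "\<gamma> 1"] unfolding s(2) pathstart_def by linarith
qed

text \<open>A path of finite length need not be differentiable. Its image has positive distance to
  the complement of \<open>V\<close>, so consecutive points of a fine subdivision lie in a ball
  inside \<open>V\<close>, where the mean value inequality applies; the increments add up to at most
  the length.\<close>

lemma norm_diff_le_path_length:
  fixes g :: "'a::euclidean_space \<Rightarrow> 'b::real_normed_vector"
  assumes "path \<gamma>" "path_length \<gamma> \<le> ereal L" "open V" "path_image \<gamma> \<subseteq> V"
    and der: "\<And>u. u \<in> V \<Longrightarrow> (g has_derivative g' u) (at u)"
    and bound: "\<And>u h. u \<in> V \<Longrightarrow> norm (g' u h) \<le> B * norm h" and "B \<ge> 0"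
  shows "norm (g (pathfinish \<gamma>) - g (pathstart \<gamma>)) \<le> B * L"
proof -
  have "compact (path_image \<gamma>)"
    using assms(1) by (rule compact_path_image)
  moreover have "closed (- V)" "path_image \<gamma> \<inter> - V = {}"
    using assms(3,4) by auto
  ultimately have "\<exists>e>0. \<forall>p\<in>path_image \<gamma>. \<forall>q\<in>- V. e \<le> dist p q"
    by (rule separate_compact_closed)
  then obtain e where e: "e > 0" "\<And>p q. p \<in> path_image \<gamma> \<Longrightarrow> q \<in> - V \<Longrightarrow> e \<le> dist p q"
    by blast
  have "uniformly_continuous_on {0..1} \<gamma>"
    using assms(1) by (auto simp: path_def intro: compact_uniformly_continuous)
  then obtain d where d: "d > 0" "\<And>s t. s \<in> {0..1} \<Longrightarrow> t \<in> {0..1} \<Longrightarrow> dist t s < d \<Longrightarrow> dist (\<gamma> t) (\<gamma> s) < e"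
    using e(1) unfolding uniformly_continuous_on_def by metis
  obtain N where N: "N > 0" "1 / real N < d"
    using nat_approx_posE[OF d(1)] zero_less_Suc by blast
  define t where "t i = real i / real N" for i
  have t01: "t i \<in> {0..1}" if "i \<le> N" for i
    using that N by (auto simp: t_def)
  have step: "norm (g (\<gamma> (t (Suc i))) - g (\<gamma> (t i))) \<le> B * dist (\<gamma> (t i)) (\<gamma> (t (Suc i)))" if "i < N" for i
  proof -
    have "dist (t (Suc i)) (t i) < d"
      using N by (simp add: t_def dist_real_def diff_divide_distrib[symmetric])
    then have "dist (\<gamma> (t (Suc i))) (\<gamma> (t i)) < e"
      using d(2) t01 that by simp
    then have near: "\<gamma> (t (Suc i)) \<in> ball (\<gamma> (t i)) e"
      by (simp add: dist_commute)
    have "\<gamma> (t i) \<in> path_image \<gamma>"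
      using t01[of i] that by (simp add: path_image_def)
    then have inV: "u \<in> V" if "u \<in> ball (\<gamma> (t i)) e" for u
      using e(2)[of "\<gamma> (t i)" u] that by force
    have "norm (g (\<gamma> (t (Suc i))) - g (\<gamma> (t i))) \<le> B * norm (\<gamma> (t (Suc i)) - \<gamma> (t i))"
    proof (rule differentiable_bound[where S = "ball (\<gamma> (t i)) e" and f' = g'])
      show "onorm (g' u) \<le> B" if "u \<in> ball (\<gamma> (t i)) e" for u
        using bound[OF inV[OF that]] by (rule onorm_le)
      show "(g has_derivative g' u) (at u within ball (\<gamma> (t i)) e)" if "u \<in> ball (\<gamma> (t i)) e" for u
        by (rule has_derivative_at_withinI[OF der[OF inV[OF that]]])
    qed (rule convex_ball near | use e(1) in simp)+
    then show ?thesis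
      by (simp add: dist_norm norm_minus_commute)
  qed
  have "norm (g (pathfinish \<gamma>) - g (pathstart \<gamma>)) = norm (\<Sum>i<N. g (\<gamma> (t (Suc i))) - g (\<gamma> (t i)))"
    using N by (subst sum_lessThan_telescope) (simp add: t_def pathfinish_def pathstart_def)
  also have "\<dots> \<le> (\<Sum>i<N. B * dist (\<gamma> (t i)) (\<gamma> (t (Suc i))))"
    using step by (intro sum_norm_le) auto
  also have "\<dots> = B * (\<Sum>i<N. dist (\<gamma> (t i)) (\<gamma> (t (Suc i))))"
    by (simp add: sum_distrib_left)
  also have "\<dots> \<le> B * L"
    using N \<open>B \<ge> 0\<close> by (intro mult_left_mono path_length_ge_sum[OF _ _ _ assms(2)]) (auto simp: t_def divide_right_mono)
  finally show ?thesis .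
qed

text \<open>The derivative in the base point is summed along the connecting path. The path stays
  within \<open>2 * c * \<delta>\<close> of \<open>x\<close>, so \<open>z\<close> is within
  \<open>(2 + 2 * c) * \<delta>\<close> of all its points; this explains the constant in the bound
  on the jet.\<close>

lemma norm_taylor_diff_base:
  fixes a :: "'n::finite multiset \<Rightarrow> real^'n \<Rightarrow> complex"
  assumes "jet a U" "open U" "x \<in> U" "y \<in> U" and "c \<ge> 0" "\<delta> > 0"
    and \<gamma>: "path \<gamma>" "path_image \<gamma> \<subseteq> U" "pathstart \<gamma> = x" "pathfinish \<gamma> = y" "path_length \<gamma> \<le> ereal (c * dist x y)"
    and z: "norm (z - embed_cn x) \<le> \<delta>" "norm (z - embed_cn y) \<le> \<delta>"
    and B: "\<And>u m'. u \<in> U \<Longrightarrow> size m' = size m + Suc k \<Longrightarrow> norm (a m' u) * (real CARD('n) * (2 + 2 * c) * \<delta>) ^ k \<le> fact k * \<epsilon>"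
  shows "norm (taylor a (Suc k) m y z - taylor a (Suc k) m x z) \<le> real CARD('n) * 2 * c * \<delta> * \<epsilon>"
proof -
  interpret jet a U by fact
  let ?n = "real CARD('n)"
  let ?D = "?n * (2 + 2 * c) * \<delta>"
  have D: "?D > 0"
    using \<open>c \<ge> 0\<close> \<open>\<delta> > 0\<close> by (simp add: add_pos_nonneg)
  \<comment> \<open>Any jet entry of the right order shows that \<open>\<epsilon>\<close> is
    nonnegative; \<open>undefined\<close> is an arbitrary coordinate.\<close>
  have "0 \<le> norm (a (m + replicate_mset (Suc k) undefined) x) * ?D ^ k"
    using D by (intro mult_nonneg_nonneg) auto
  also have "\<dots> \<le> fact k * \<epsilon>"
    using assms(3) by (intro B) auto
  finally have "\<epsilon> \<ge> 0"
    by (smt (verit) fact_gt_zero mult_pos_neg)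
  have dxy: "dist x y \<le> 2 * \<delta>"
  proof -
    have "dist x y = norm (embed_cn x - embed_cn y)"
      by (metis dist_embed_cn dist_norm)
    also have "\<dots> = norm ((z - embed_cn y) - (z - embed_cn x))"
      by simp
    also have "\<dots> \<le> 2 * \<delta>"
      using norm_triangle_ineq4[of "z - embed_cn y" "z - embed_cn x"] z by linarith
    finally show ?thesis .
  qed
  then have cd: "c * dist x y \<le> 2 * c * \<delta>"
    using \<open>c \<ge> 0\<close> using mult_left_mono[of "dist x y" "2 * \<delta>" c] by (simp add: mult_ac)
  \<comment> \<open>An open set is required, so the radius is slightly larger than the reach of the
    path.\<close>
  define V where "V = U \<inter> ball x ((1 + 2 * c) * \<delta>)"
  have "norm (taylor a (Suc k) m (pathfinish \<gamma>) z - taylor a (Suc k) m (pathstart \<gamma>) z) \<le> (?n * \<epsilon>) * (c * dist x y)"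
  proof (rule norm_diff_le_path_length[OF \<gamma>(1,5)])
    show "open V"
      using assms(2) by (auto simp: V_def)
    show "path_image \<gamma> \<subseteq> V"
    proof
      fix p assume "p \<in> path_image \<gamma>"
      then have "dist x p \<le> 2 * c * \<delta>" 
        using path_image_dist_start[OF \<gamma>(5)] \<gamma>(3) cd by force
      moreover have "2 * c * \<delta> < (1 + 2 * c) * \<delta>"
        using \<open>\<delta> > 0\<close> by (simp add: algebra_simps)
      ultimately show "p \<in> V"
        using \<open>p \<in> path_image \<gamma>\<close> \<gamma>(2) by (auto simp: V_def)
    qed
    show "?n * \<epsilon> \<ge> 0"
      using \<open>\<epsilon> \<ge> 0\<close> by simp
    fix u assume u: "u \<in> V"
    then show "((\<lambda>u. taylor a (Suc k) m u z) has_derivative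
      (\<lambda>h. \<Sum>i\<in>UNIV. (h $ i) *\<^sub>R (taylor_term a u (z - embed_cn u) k (add_mset i m) / fact k))) (at u)"
      by (intro taylor_has_derivative_base) (simp add: V_def)
    fix h :: "real^'n"
    have zu: "norm (z - embed_cn u) \<le> (2 + 2 * c) * \<delta>"
    proof -
      have "norm (z - embed_cn u) \<le> norm (z - embed_cn x) + dist x u"
        using norm_triangle_ineq[of "z - embed_cn x" "embed_cn x - embed_cn u"]
        unfolding dist_embed_cn[symmetric, of x u] unfolding dist_norm by simp
      also have "\<dots> \<le> \<delta> + (1 + 2 * c) * \<delta>"
        using z(1) u by (auto simp: V_def)
      finally show ?thesis
        by (simp add: algebra_simps)
    qed
    have cancel: "P * (w / P) = w" if "P > 0" for P w :: real
      using that by simp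
    have *: "norm (taylor_term a u (z - embed_cn u) k (add_mset i m) / fact k) \<le> \<epsilon>" for i
    proof -
      have "norm (taylor_term a u (z - embed_cn u) k (add_mset i m)) \<le> (?n * norm (z - embed_cn u)) ^ k * (fact k * \<epsilon> / ?D ^ k)"
        using B u D by (intro norm_taylor_term_le) (simp add: V_def pos_le_divide_eq)
      also have "\<dots> \<le> ?D ^ k * (fact k * \<epsilon> / ?D ^ k)"
      proof (intro mult_right_mono power_mono)
        show "?n * norm (z - embed_cn u) \<le> ?D"
          using mult_left_mono[OF zu, of ?n] by (simp only: mult.assoc)
        show "0 \<le> fact k * \<epsilon> / ?D ^ k"
          using zero_less_power[OF D, of k] \<open>\<epsilon> \<ge> 0\<close> by (intro divide_nonneg_nonneg mult_nonneg_nonneg) (simp_all only: fact_ge_zero less_imp_le)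
      qed simp
      also have "\<dots> = fact k * \<epsilon>"
        using cancel[of "?D ^ k"] zero_less_power[OF D, of k] by blast
      finally show ?thesis
        by (simp add: norm_divide pos_divide_le_eq mult.commute)
    qed
    have "norm (\<Sum>i\<in>UNIV. (h $ i) *\<^sub>R (taylor_term a u (z - embed_cn u) k (add_mset i m) / fact k)) \<le> (\<Sum>i::'n\<in>UNIV. norm h * \<epsilon>)"
    proof (intro sum_norm_le)
      fix i :: 'n
      show "norm ((h $ i) *\<^sub>R (taylor_term a u (z - embed_cn u) k (add_mset i m) / fact k)) \<le> norm h * \<epsilon>"
        unfolding norm_scaleR using * by (intro mult_mono) (auto simp: component_le_norm_cart)
    qed
    then show "norm (\<Sum>i\<in>UNIV. (h $ i) *\<^sub>R (taylor_term a u (z - embed_cn u) k (add_mset i m) / fact k)) \<le> ?n * \<epsilon> * norm h"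
      by (simp add: mult_ac)
  qed
  also have "\<dots> \<le> (?n * \<epsilon>) * (2 * c * \<delta>)"
    using cd \<open>\<epsilon> \<ge> 0\<close> by (intro mult_left_mono) auto
  finally show ?thesis
    using \<gamma> by (simp add: mult_ac)
qed

text \<open>One point of \<open>U\<close> is chosen from each cell of a cubic grid that meets
  \<open>U\<close>. The net has to lie in \<open>U\<close>, where the jet lives, and its size may
  grow only polynomially in \<open>N\<close>, because it enters the final estimate.\<close>

lemma unit_scale_net:
  fixes U :: "(real^'n::finite) set"
  assumes "bounded U"
  shows "\<exists>c. \<forall>N>0. \<exists>A. finite A \<and> A \<subseteq> U \<and> real (card A) \<le> (c * real N) ^ CARD('n) \<and> (\<forall>x\<in>U. \<exists>a\<in>A. dist x a \<le> 1 / real N)"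
proof -
  let ?n = "CARD('n)"
  obtain M :: nat where M: "\<And>x. x \<in> U \<Longrightarrow> norm x \<le> real M"
    using assms unfolding bounded_iff by (meson order_trans real_arch_simple)
  have "\<exists>A. finite A \<and> A \<subseteq> U \<and> real (card A) \<le> (real (2 * M * ?n + 1) * real N) ^ ?n \<and> (\<forall>x\<in>U. \<exists>a\<in>A. dist x a \<le> 1 / real N)"
    if "N > 0" for N
  proof -
    \<comment> \<open>The l1 norm bounds the Euclidean one, so cells of side \<open>1 / K\<close>
      have diameter at most \<open>1 / N\<close>.\<close>
    define K where "K = ?n * N"
    have K: "K > 0"
      using that by (simp add: K_def)
    define cell :: "real^'n \<Rightarrow> 'n \<Rightarrow> int" where "cell x = (\<lambda>i. \<lfloor>x $ i * real K\<rfloor>)" for x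
    define R where "R = {- int (M * K)..int (M * K)}"
    have cell_in: "cell ` U \<subseteq> (PiE UNIV (\<lambda>_. R))"
    proof (intro image_subsetI PiE_I)
      fix x i assume "x \<in> U"
      then have "\<bar>x $ i\<bar> \<le> real M"
        using M component_le_norm_cart order_trans by blast
      then have "\<bar>x $ i * real K\<bar> \<le> real (M * K)"
        by (simp add: abs_mult mult_right_mono)
      then show "cell x i \<in> R"
        unfolding cell_def R_def by (simp add: le_floor_iff floor_le_iff abs_le_iff)
    qed auto
    define A where "A = (\<lambda>c. SOME x. x \<in> U \<and> cell x = c) ` (cell ` U)"
    have some: "(SOME y. y \<in> U \<and> cell y = cell x) \<in> U \<and> cell (SOME y. y \<in> U \<and> cell y = cell x) = cell x" if "x \<in> U" for x
      by (rule someI[of _ x]) (use that in simp)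
    have fin: "finite (cell ` U)"
      using cell_in by (rule finite_subset) (auto simp: R_def intro: finite_PiE)
    have "card A \<le> card (cell ` U)"
      unfolding A_def by (rule card_image_le[OF fin])
    also have "\<dots> \<le> card (PiE (UNIV :: 'n set) (\<lambda>_. R))"
      by (rule card_mono[OF _ cell_in]) (auto simp: R_def intro: finite_PiE)
    also have "\<dots> = (2 * M * K + 1) ^ ?n"
      by (simp add: card_PiE R_def nat_add_distrib nat_mult_distrib mult_ac)
    also have "\<dots> \<le> ((2 * M * ?n + 1) * N) ^ ?n"
      using that by (intro power_mono) (simp_all add: K_def)
    finally have "real (card A) \<le> (real (2 * M * ?n + 1) * real N) ^ ?n"
      by (metis of_nat_le_iff of_nat_mult of_nat_power)
    moreover have "\<exists>a\<in>A. dist x a \<le> 1 / real N" if "x \<in> U" for x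
    proof -
      define a where "a = (SOME y. y \<in> U \<and> cell y = cell x)"
      have a: "a \<in> A" "cell a = cell x"
        using some[OF that] that by (auto simp: A_def a_def)
      have "\<bar>(x - a) $ i\<bar> \<le> 1 / real K" for i
      proof -
        have "\<lfloor>a $ i * real K\<rfloor> = \<lfloor>x $ i * real K\<rfloor>"
          using a(2) unfolding cell_def by meson
        then have "\<bar>x $ i * real K - a $ i * real K\<bar> \<le> 1"
          by linarith
        then have "\<bar>(x - a) $ i\<bar> * real K \<le> 1"
          by (simp add: left_diff_distrib[symmetric] abs_mult)
        then show ?thesis
          using K by (simp add: pos_le_divide_eq)
      qed
      then have "norm (x - a) \<le> (\<Sum>i::'n\<in>UNIV. 1 / real K)"
        by (intro order_trans[OF norm_le_l1_cart sum_mono]) auto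
      also have "\<dots> = 1 / real N"
        by (simp add: K_def)
      finally show ?thesis
        using a(1) by (auto simp: dist_norm)
    qed
    moreover have "finite A" "A \<subseteq> U"
      using fin some by (auto simp: A_def)
    ultimately show ?thesis
      by blast
  qed
  then show ?thesis
    by blast
qed

section \<open>Cutoff functions and partitions of unity\<close>

lemma pos_part_sq_DERIV: "((\<lambda>y::real. (max 0 y)\<^sup>2) has_real_derivative 2 * max 0 y) (at y within S)"
proof -
  consider "y > 0" | "y < 0" | "y = 0" by linarith
  then have "((\<lambda>y::real. (max 0 y)\<^sup>2) has_real_derivative 2 * max 0 y) (at y)"
  proof cases
    case 1
    have "((\<lambda>y::real. y\<^sup>2) has_real_derivative 2 * max 0 y) (at y)"
      using 1 by (auto intro!: derivative_eq_intros)
    then show ?thesis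
      by (rule has_field_derivative_transform_within_open[of _ _ _ "{0<..}"]) (use 1 in auto)
  next
    case 2
    have "((\<lambda>y::real. 0) has_real_derivative 2 * max 0 y) (at y)"
      using 2 by auto
    then show ?thesis
      by (rule has_field_derivative_transform_within_open[of _ _ _ "{..<0}"]) (use 2 in auto)
  next
    case 3
    have "((\<lambda>h::real. (max 0 h)\<^sup>2 / h) \<longlongrightarrow> 0) (at 0)"
    proof (rule Lim_null_comparison)
      show "\<forall>\<^sub>F h::real in at 0. norm ((max 0 h)\<^sup>2 / h) \<le> \<bar>h\<bar>"
        by (intro always_eventually allI) (auto simp: max_def power2_eq_square)
      show "((\<lambda>h::real. \<bar>h\<bar>) \<longlongrightarrow> 0) (at 0)"
        by (intro tendsto_rabs_zero tendsto_ident_at)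
    qed
    with 3 show ?thesis
      by (simp add: DERIV_def)
  qed
  then show ?thesis
    by (rule has_field_derivative_at_within)
qed

text \<open>Only class C^1 is required, so squares of positive parts suffice. The value is 1 up to
  1/4 and 0 from 1 on.\<close>

definition cutoff :: "real \<Rightarrow> real" where
  "cutoff s = 1 - (max 0 (1 - 2 * (max 0 (1 - s))\<^sup>2))\<^sup>2"

definition cutoff' :: "real \<Rightarrow> real" where
  "cutoff' s = - 8 * max 0 (1 - 2 * (max 0 (1 - s))\<^sup>2) * max 0 (1 - s)"

lemma cutoff_DERIV: "(cutoff has_real_derivative cutoff' s) (at s)"
proof -
  have "((\<lambda>s. 1 - s) has_real_derivative - 1) (at s)"
    by (auto intro!: derivative_eq_intros)
  from DERIV_diff[OF DERIV_const DERIV_cmult[OF DERIV_chain2[OF pos_part_sq_DERIV this]], of 1 2]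
  have "((\<lambda>s. 1 - 2 * (max 0 (1 - s))\<^sup>2) has_real_derivative 4 * max 0 (1 - s)) (at s)"
    by simp
  from DERIV_diff[OF DERIV_const DERIV_chain2[OF pos_part_sq_DERIV this], of 1]
  show ?thesis
    unfolding cutoff_def[abs_def] cutoff'_def by (simp add: mult_ac)
qed

lemma continuous_cutoff': "continuous_on S cutoff'"
  unfolding cutoff'_def[abs_def] by (intro continuous_intros)

lemma cutoff_bounds: "0 \<le> cutoff s" "cutoff s \<le> 1"
proof -
  have "max 0 (1 - 2 * (max 0 (1 - s))\<^sup>2) \<le> 1"
    by simp
  then have "(max 0 (1 - 2 * (max 0 (1 - s))\<^sup>2))\<^sup>2 \<le> 1"
    by (intro power_le_one) auto
  then show "0 \<le> cutoff s" "cutoff s \<le> 1"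
    by (auto simp: cutoff_def)
qed

lemma cutoff_eq_1:
  assumes "s \<le> 1/4"
  shows "cutoff s = 1"
proof -
  have "(3/4)\<^sup>2 \<le> (max 0 (1 - s))\<^sup>2"
    using assms by (intro power_mono) auto
  then show ?thesis
    by (simp add: cutoff_def power2_eq_square)
qed

lemma cutoff_eq_0: "1 \<le> s \<Longrightarrow> cutoff s = 0" "1 \<le> s \<Longrightarrow> cutoff' s = 0"
  by (simp_all add: cutoff_def cutoff'_def)

lemma cutoff'_bound: 
  assumes "s \<ge> 0"
  shows "\<bar>cutoff' s\<bar> \<le> 8"
proof -
  have "\<bar>max 0 (1 - 2 * (max 0 (1 - s))\<^sup>2) * max 0 (1 - s)\<bar> \<le> 1 * 1"
    unfolding abs_mult using assms by (intro mult_mono) auto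
  then show ?thesis
    by (simp add: cutoff'_def abs_mult)
qed

text \<open>The squared norm keeps the function differentiable at the centre; the thresholds 1/4 and
  1 of \<open>cutoff\<close> become the radii \<open>R / 2\<close> and \<open>R\<close>.\<close>

definition bump :: "'a::euclidean_space \<Rightarrow> real \<Rightarrow> 'a \<Rightarrow> real" where
  "bump c R z = cutoff ((norm (z - c) / R)\<^sup>2)"

definition bump' :: "'a::euclidean_space \<Rightarrow> real \<Rightarrow> 'a \<Rightarrow> 'a \<Rightarrow> real" where
  "bump' c R z h = 2 * ((z - c) \<bullet> h) / R\<^sup>2 * cutoff' ((norm (z - c) / R)\<^sup>2)"

lemma bump_has_derivative:
  assumes "R > 0"
  shows "(bump c R has_derivative bump' c R z) (at z)"
proof -
  have "((\<lambda>z. (z - c) \<bullet> (z - c) / R\<^sup>2) has_derivative (\<lambda>h. 2 * ((z - c) \<bullet> h) / R\<^sup>2)) (at z)"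
  proof -
    have "((\<lambda>z. (z - c) \<bullet> (z - c)) has_derivative (\<lambda>h. 2 * ((z - c) \<bullet> h))) (at z)"
      by (auto intro!: derivative_eq_intros simp: inner_commute)
    from bounded_linear.has_derivative[OF bounded_linear_divide this] show ?thesis .
  qed
  from has_derivative_compose[OF this] cutoff_DERIV[THEN has_field_derivative_imp_has_derivative]
  have "((\<lambda>z. cutoff ((z - c) \<bullet> (z - c) / R\<^sup>2)) has_derivative
      (\<lambda>h. cutoff' ((z - c) \<bullet> (z - c) / R\<^sup>2) * (2 * ((z - c) \<bullet> h) / R\<^sup>2))) (at z)"
    by blast
  then show ?thesis
    by (simp add: bump_def[abs_def] bump'_def[abs_def] power_divide power2_norm_eq_inner mult.commute)
qed

lemma bump'_bound:
  assumes "R > 0"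
  shows "\<bar>bump' c R z h\<bar> \<le> 16 / R * norm h"
proof (cases "norm (z - c) < R")
  case True
  have "\<bar>bump' c R z h\<bar> \<le> (2 * (R * norm h) / R\<^sup>2) * 8"
    unfolding bump'_def abs_mult[of "_ / _"]
  proof (intro mult_mono cutoff'_bound)
    have "\<bar>(z - c) \<bullet> h\<bar> \<le> R * norm h"
      using True by (intro order_trans[OF Cauchy_Schwarz_ineq2] mult_right_mono) auto
    then show "\<bar>2 * ((z - c) \<bullet> h) / R\<^sup>2\<bar> \<le> 2 * (R * norm h) / R\<^sup>2"
      by (simp add: abs_mult divide_right_mono)
  qed (use assms in auto)
  then show ?thesis
    using assms by (simp add: power2_eq_square)
next
  case False
  then have "(norm (z - c) / R)\<^sup>2 \<ge> 1"
    using assms by (simp add: one_le_power)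
  then show ?thesis
    using assms by (simp add: bump'_def cutoff_eq_0)
qed

lemma continuous_on_bump': "R > 0 \<Longrightarrow> continuous_on UNIV (\<lambda>z. bump' c R z h)"
  unfolding bump'_def
  by (intro continuous_intros continuous_on_compose2[OF continuous_cutoff'[of UNIV]]) auto

lemma bump_outside:
  assumes "R > 0" "norm (z - c) \<ge> R"
  shows "bump c R z = 0" "bump' c R z = (\<lambda>h. 0)"
proof -
  have "(norm (z - c) / R)\<^sup>2 \<ge> 1"
    using assms by (simp add: one_le_power)
  then show "bump c R z = 0" "bump' c R z = (\<lambda>h. 0)"
    by (auto simp: bump_def bump'_def cutoff_eq_0)
qed

lemma bump_inside:
  assumes "R > 0" "norm (z - c) \<le> R / 2"
  shows "bump c R z = 1"
proof -
  have "(norm (z - c) / R)\<^sup>2 \<le> (1/2)\<^sup>2"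
    using assms by (intro power_mono) (auto simp: field_simps)
  then show ?thesis
    unfolding bump_def by (intro cutoff_eq_1) (simp add: power2_eq_square)
qed

text \<open>The sum is required to be 1 only within \<open>R / 2\<close> of the centres. The
  cardinality in the derivative bound is crude, but factors polynomial in \<open>1 / R\<close> are
  absorbed later. The map \<open>e\<close> places real net points in complex space.\<close>

definition subpartition ::
  "('i \<Rightarrow> 'a::euclidean_space) \<Rightarrow> 'i set \<Rightarrow> real \<Rightarrow> ('i \<Rightarrow> 'a \<Rightarrow> real) \<Rightarrow> ('i \<Rightarrow> 'a \<Rightarrow> 'a \<Rightarrow> real) \<Rightarrow> bool" where
  "subpartition e A R \<beta> \<beta>' \<longleftrightarrow>
    (\<forall>x\<in>A. \<forall>z. (\<beta> x has_derivative \<beta>' x z) (at z)) \<and>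
    (\<forall>x\<in>A. \<forall>z h. \<bar>\<beta>' x z h\<bar> \<le> 16 * real (card A) / R * norm h) \<and>
    (\<forall>x\<in>A. \<forall>h. continuous_on UNIV (\<lambda>z. \<beta>' x z h)) \<and>
    (\<forall>x\<in>A. \<forall>z. 0 \<le> \<beta> x z) \<and>
    (\<forall>x\<in>A. \<forall>z. R \<le> norm (z - e x) \<longrightarrow> \<beta> x z = 0 \<and> \<beta>' x z = (\<lambda>h. 0)) \<and>
    (\<forall>z. (\<Sum>x\<in>A. \<beta> x z) \<le> 1) \<and>
    (\<forall>z. (\<exists>x\<in>A. norm (z - e x) \<le> R / 2) \<longrightarrow> (\<Sum>x\<in>A. \<beta> x z) = 1)"

text \<open>A new bump \<open>b\<close> is added as it is and the old functions are multiplied by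
  \<open>1 - b\<close>, so 1 minus the sum is the product of all \<open>1 - b\<close>. Each
  insertion adds at most \<open>16 / R\<close> to the derivative bound.\<close>

lemma subpartition_exists:
  assumes "finite A" "R > 0"
  shows "\<exists>\<beta> \<beta>'. subpartition e A R \<beta> \<beta>'"
  using assms(1)
proof induction
  case empty
  then show ?case
    by (simp add: subpartition_def)
next
  case (insert a A)
  then obtain \<beta> \<beta>' where "subpartition e A R \<beta> \<beta>'"
    by blast
  then have *: "\<And>x z. x \<in> A \<Longrightarrow> (\<beta> x has_derivative \<beta>' x z) (at z)"
    "\<And>x z h. x \<in> A \<Longrightarrow> \<bar>\<beta>' x z h\<bar> \<le> 16 * real (card A) / R * norm h"
    "\<And>x h. x \<in> A \<Longrightarrow> continuous_on UNIV (\<lambda>z. \<beta>' x z h)"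
    "\<And>x z. x \<in> A \<Longrightarrow> 0 \<le> \<beta> x z"
    "\<And>x z. x \<in> A \<Longrightarrow> R \<le> norm (z - e x) \<Longrightarrow> \<beta> x z = 0"
    "\<And>x z. x \<in> A \<Longrightarrow> R \<le> norm (z - e x) \<Longrightarrow> \<beta>' x z = (\<lambda>h. 0)"
    "\<And>z. (\<Sum>x\<in>A. \<beta> x z) \<le> 1"
    "\<And>x z. x \<in> A \<Longrightarrow> norm (z - e x) \<le> R / 2 \<Longrightarrow> (\<Sum>x\<in>A. \<beta> x z) = 1"
    unfolding subpartition_def by blast+
  let ?b = "bump (e a) R" and ?b' = "bump' (e a) R"
  define \<eta> where "\<eta> x = (if x = a then ?b else (\<lambda>z. (1 - ?b z) * \<beta> x z))" for x
  define \<eta>' where "\<eta>' x = (if x = a then ?b' else (\<lambda>z h. (1 - ?b z) * \<beta>' x z h + - ?b' z h * \<beta> x z))" for x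
  have nea: "x \<noteq> a" if "x \<in> A" for x
    using insert that by auto
  have b01: "0 \<le> ?b z" "?b z \<le> 1" for z
    unfolding bump_def by (rule cutoff_bounds)+
  have le1: "\<beta> x z \<le> 1" if "x \<in> A" for x z
    using *(7)[of z] member_le_sum[of x A "\<lambda>x. \<beta> x z"] that insert *(4) by fastforce
  have sum: "(\<Sum>x\<in>insert a A. \<eta> x z) = ?b z + (1 - ?b z) * (\<Sum>x\<in>A. \<beta> x z)" for z
  proof -
    have "(\<Sum>x\<in>A. \<eta> x z) = (\<Sum>x\<in>A. (1 - ?b z) * \<beta> x z)"
      using nea by (intro sum.cong) (auto simp: \<eta>_def)
    then show ?thesis
      using insert by (simp add: \<eta>_def sum_distrib_left)
  qed
  have "continuous_on UNIV ?b"
    using bump_has_derivative[OF assms(2)] by (rule has_derivative_imp_continuous_on)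
  moreover have "continuous_on UNIV (\<beta> x)" if "x \<in> A" for x
    using *(1)[OF that] by (rule has_derivative_imp_continuous_on)
  ultimately have cont: "continuous_on UNIV (\<lambda>z. \<eta>' x z h)" if "x \<in> insert a A" for x h
    using that continuous_on_bump'[OF assms(2)] *(3)
    by (cases "x = a") (auto simp: \<eta>'_def intro!: continuous_intros)
  have bound: "\<bar>\<eta>' x z h\<bar> \<le> 16 * real (card (insert a A)) / R * norm h" if "x \<in> insert a A" for x z h
  proof -
    have le: "16 / R * norm h \<le> 16 * real (card (insert a A)) / R * norm h"
      using insert assms(2) by (intro mult_right_mono divide_right_mono) auto
    show ?thesis
    proof (cases "x = a")
      case True
      then show ?thesis
        using bump'_bound[OF assms(2), of "e a" z h] le by (simp add: \<eta>'_def)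
    next
      case False
      then have x: "x \<in> A"
        using that by simp
      have "\<bar>\<eta>' x z h\<bar> \<le> \<bar>1 - ?b z\<bar> * \<bar>\<beta>' x z h\<bar> + \<bar>?b' z h\<bar> * \<bar>\<beta> x z\<bar>"
        using False abs_triangle_ineq[of "(1 - ?b z) * \<beta>' x z h" "- ?b' z h * \<beta> x z"] by (simp add: \<eta>'_def abs_mult)
      also have "\<dots> \<le> 1 * (16 * real (card A) / R * norm h) + (16 / R * norm h) * 1"
        using b01[of z] *(2)[OF x] *(4)[OF x, of z] le1[OF x, of z] bump'_bound[OF assms(2)] assms(2)
        by (intro add_mono mult_mono) auto
      also have "\<dots> = 16 * real (card (insert a A)) / R * norm h"
        using insert by (simp add: field_simps add_divide_distrib)
      finally show ?thesis .
    qed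
  qed
  have "subpartition e (insert a A) R \<eta> \<eta>'"
    unfolding subpartition_def
  proof (intro conjI ballI allI impI)
    fix x z assume x: "x \<in> insert a A"
    show "(\<eta> x has_derivative \<eta>' x z) (at z)"
    proof (cases "x = a")
      case True
      then show ?thesis
        using bump_has_derivative[OF assms(2)] by (simp add: \<eta>_def \<eta>'_def)
    next
      case False
      then have "((\<lambda>z. (1 - ?b z) * \<beta> x z) has_derivative (\<lambda>h. (1 - ?b z) * \<beta>' x z h + - ?b' z h * \<beta> x z)) (at z)"
        using *(1)[of x z] x bump_has_derivative[OF assms(2)]
        by (auto intro!: has_derivative_mult derivative_eq_intros)
      with False show ?thesis
        by (simp add: \<eta>_def \<eta>'_def)
    qed
    show "0 \<le> \<eta> x z"
      using b01[of z] *(4) x by (auto simp: \<eta>_def)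
    assume "R \<le> norm (z - e x)"
    then show "\<eta> x z = 0" "\<eta>' x z = (\<lambda>h. 0)"
      using *(5,6)[of x z] x bump_outside[OF assms(2), of z "e a"]
      by (auto simp: \<eta>_def \<eta>'_def fun_eq_iff)
  next
    fix z
    show "(\<Sum>x\<in>insert a A. \<eta> x z) \<le> 1"
      unfolding sum using b01[of z] *(7)[of z] mult_left_mono[of "\<Sum>x\<in>A. \<beta> x z" 1 "1 - ?b z"] by simp
    assume "\<exists>x\<in>insert a A. norm (z - e x) \<le> R / 2"
    then consider "norm (z - e a) \<le> R / 2" | x where "x \<in> A" "norm (z - e x) \<le> R / 2"
      by blast
    then show "(\<Sum>x\<in>insert a A. \<eta> x z) = 1"
    proof cases
      case 1
      then show ?thesis
        unfolding sum using bump_inside[OF assms(2) 1] by simp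
    next
      case 2
      then show ?thesis
        unfolding sum using *(8) by simp
    qed
  qed (use cont bound in auto)
  then show ?case
    by blast
qed

section \<open>Extension of jets\<close>

text \<open>The distance to the closure is nearly attained at points of \<open>U\<close> itself,
  where jet and net are available.\<close>

lemma infdist_embed_cn_lessE:
  assumes "U \<noteq> {}" "infdist z (embed_cn ` closure U) < r"
  obtains u where "u \<in> U" "dist z (embed_cn u) < r"
proof -
  have "\<exists>k\<in>embed_cn ` closure U. dist z k < r"
  proof (rule ccontr)
    assume "\<not> ?thesis"
    then have "r \<le> infdist z (embed_cn ` closure U)"
      using assms(1) by (subst infdist_notempty) (auto intro!: cINF_greatest simp: not_less)
    with assms(2) show False
      by simp
  qed
  then obtain v where v: "v \<in> closure U" "dist z (embed_cn v) < r"
    by blast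
  then obtain u where u: "u \<in> U" "dist u v < r - dist z (embed_cn v)"
    unfolding closure_approachable by (metis diff_gt_0_iff_gt)
  have "dist z (embed_cn u) \<le> dist z (embed_cn v) + dist v u"
    using dist_triangle[of z "embed_cn u" "embed_cn v"] by simp
  with u v that show ?thesis
    by (simp add: dist_commute)
qed

text \<open>
  At the scale \<open>4\<^sup>-\<^sup>j\<close>: \<open>A j\<close> is a net of \<open>U\<close>, the weights \<open>\<beta> j\<close> are supported near the points of the net
  and sum up to \<open>1\<close> near \<open>U\<close>, and Taylor polynomials have degree \<open>q j + 1\<close>. The error \<open>\<epsilon> j\<close> has to control
  all degrees between \<open>q j\<close> and \<open>q (j + 1)\<close>, because both occur in the passage from one scale to the next.
\<close>

locale jet_extension = jet a U
  for a :: "'n::finite multiset \<Rightarrow> real^'n \<Rightarrow> complex" and U +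
  fixes c cA :: real and q :: "nat \<Rightarrow> nat" and \<epsilon> :: "nat \<Rightarrow> real"
    and A :: "nat \<Rightarrow> (real^'n) set" and \<beta> and \<beta>'
  assumes open_U: "open U" and bounded_U: "bounded U" and U_ne: "U \<noteq> {}"
    and c_nonneg: "c \<ge> 0" and cA_ge_1: "cA \<ge> 1"
    and quasiconvex: "\<And>x y. x \<in> U \<Longrightarrow> y \<in> U \<Longrightarrow> \<exists>\<gamma>. path \<gamma> \<and> path_image \<gamma> \<subseteq> U \<and> pathstart \<gamma> = x \<and>
         pathfinish \<gamma> = y \<and> path_length \<gamma> \<le> ereal (c * dist x y)"
    and jet_bound: "\<And>j k m u. u \<in> U \<Longrightarrow> k \<le> size m \<Longrightarrow> size m \<le> k + 2 \<Longrightarrow>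
        min (q j) (q (Suc j)) \<le> k \<Longrightarrow> k \<le> Suc (max (q j) (q (Suc j))) \<Longrightarrow>
        norm (a m u) * (4 * real CARD('n) * (2 + 2 * c) * (1/4)^j) ^ k \<le> fact k * \<epsilon> j"
    and eps_nonneg: "\<And>j. \<epsilon> j \<ge> 0"
    and net_finite: "\<And>j. finite (A j)" and net_subset: "\<And>j. A j \<subseteq> U"
    and net_card: "\<And>j. real (card (A j)) \<le> (cA * 4^j) ^ CARD('n)"
    and net_dense: "\<And>j x. x \<in> U \<Longrightarrow> \<exists>u\<in>A j. dist x u \<le> (1/4)^j"
    and partition: "\<And>j. subpartition embed_cn (A j) (4 * (1/4)^j) (\<beta> j) (\<beta>' j)"
    and summable_eps: "summable (\<lambda>j. (4 * 4^Suc j * (cA * 4^Suc j) ^ CARD('n)) ^ 3 * \<epsilon> j)"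
begin

abbreviation "K \<equiv> embed_cn ` closure U"

text \<open>Radius of the supports. Its half is twice the mesh of the net, so a point closer than
  \<open>(1/4)^j\<close> to the closure is within \<open>R j / 2\<close> of a net point.\<close>

definition "R j = 4 * (1/4::real)^j"
text \<open>One quantity that bounds both the number of weights and, since
  \<open>16 / R j = 4 * 4^j\<close>, the derivative of each of them.\<close>

definition "G j = 4 * 4^j * (cA * 4^j) ^ CARD('n)"
text \<open>\<open>q j + 2\<close> terms, so that the derivative \<open>T'\<close> still has
  \<open>q j + 1\<close>. Changes of base point then involve the exponents \<open>q j + 1\<close>
  and \<open>q j\<close>, which is why \<open>jet_bound\<close> admits one exponent beyond the
  maximum.\<close>

definition "T j x = taylor a (q j + 2) {#} x"
definition "T' j x z h = (\<Sum>i\<in>UNIV. h $ i * taylor a (q j + 1) {#i#} x z)"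
definition "\<kappa> j z = (\<Sum>x\<in>A j. \<beta> j x z)"
definition "N j z = (\<Sum>x\<in>A j. \<beta> j x z *\<^sub>R T j x z)"
definition "N' j z h = (\<Sum>x\<in>A j. \<beta> j x z *\<^sub>R T' j x z h + \<beta>' j x z h *\<^sub>R T j x z)"
text \<open>Equal to \<open>\<kappa> j z *\<^sub>R N (Suc j) z - \<kappa> (Suc j) z *\<^sub>R N j
  z\<close>, but as a double sum it contains only differences of Taylor polynomials, and these are
  small wherever both weights are nonzero.\<close>

definition "E j z = (\<Sum>x\<in>A (Suc j). \<Sum>y\<in>A j. (\<beta> (Suc j) x z * \<beta> j y z) *\<^sub>R (T (Suc j) x z - T j y z))"
definition "E' j z h = (\<Sum>x\<in>A (Suc j). \<Sum>y\<in>A j.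
    (\<beta> (Suc j) x z * \<beta> j y z) *\<^sub>R (T' (Suc j) x z h - T' j y z h)
    + (\<beta> (Suc j) x z * \<beta>' j y z h + \<beta>' (Suc j) x z h * \<beta> j y z) *\<^sub>R (T (Suc j) x z - T j y z))"
definition "Cd = 2 + 8 * real CARD('n) * c"
definition "F z = N 0 z + (\<Sum>j. E j z)"
definition "F' z h = N' 0 z h + (\<Sum>j. E' j z h)"

section \<open>Sizes of the weights and of the changes between scales\<close>

lemma R_pos: "R j > 0" and R_le: "R j \<le> 4"
  by (auto simp: R_def power_le_one)

lemma R_antimono: "i \<le> j \<Longrightarrow> R j \<le> R i"
  unfolding R_def by (simp add: power_decreasing)

lemma G_ge_1: "G j \<ge> 1"
proof -
  have "1 \<le> cA * 4 ^ j"
    using cA_ge_1 mult_mono[of 1 cA 1 "4^j"] by simp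
  then have "1 \<le> (cA * 4 ^ j) ^ CARD('n)" "(1::real) \<le> 4 * 4 ^ j"
    by (auto intro: one_le_power simp: order_trans[OF _ mult_mono[of 1 4 1 "4^j"]])
  then show ?thesis
    unfolding G_def using mult_mono[of 1 "4 * 4^j" 1 "(cA * 4 ^ j) ^ CARD('n)"] by simp
qed

lemma G_mono: "i \<le> j \<Longrightarrow> G i \<le> G j"
  unfolding G_def using cA_ge_1
  by (intro mult_mono power_mono) auto

lemma card_le_G: "real (card (A j)) \<le> G j"
proof -
  have "(cA * 4 ^ j) ^ CARD('n) \<le> G j"
  proof -
    have "(1::real) \<le> 4 * 4 ^ j"
      using mult_mono[of 1 4 1 "4^j :: real"] by simp
    then have "1 * (cA * 4 ^ j) ^ CARD('n) \<le> (4 * 4 ^ j) * (cA * 4 ^ j) ^ CARD('n)"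
      using cA_ge_1 by (intro mult_right_mono) auto
    then show ?thesis
      by (simp add: G_def)
  qed
  then show ?thesis
    using net_card order_trans by blast
qed

lemma beta:
  assumes "x \<in> A j"
  shows beta_deriv: "(\<beta> j x has_derivative \<beta>' j x z) (at z)"
    and beta'_bound: "\<bar>\<beta>' j x z h\<bar> \<le> G j * norm h"
    and beta'_cont: "continuous_on UNIV (\<lambda>z. \<beta>' j x z h)"
    and beta_nonneg: "0 \<le> \<beta> j x z"
    and beta_outside: "R j \<le> norm (z - embed_cn x) \<Longrightarrow> \<beta> j x z = 0"
      "R j \<le> norm (z - embed_cn x) \<Longrightarrow> \<beta>' j x z = (\<lambda>h. 0)"
proof -
  note p = partition[of j, unfolded subpartition_def, folded R_def]
  show "(\<beta> j x has_derivative \<beta>' j x z) (at z)" "continuous_on UNIV (\<lambda>z. \<beta>' j x z h)" "0 \<le> \<beta> j x z"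
    "R j \<le> norm (z - embed_cn x) \<Longrightarrow> \<beta> j x z = 0" "R j \<le> norm (z - embed_cn x) \<Longrightarrow> \<beta>' j x z = (\<lambda>h. 0)"
    using p assms by blast+
  have "\<bar>\<beta>' j x z h\<bar> \<le> 16 * real (card (A j)) / R j * norm h"
    using p assms by blast
  also have "\<dots> \<le> G j * norm h"
  proof (rule mult_right_mono)
    have "16 * real (card (A j)) / R j = 4 * 4 ^ j * real (card (A j))"
      by (simp add: R_def power_one_over)
    also have "\<dots> \<le> G j"
      unfolding G_def using net_card by (intro mult_left_mono) auto
    finally show "16 * real (card (A j)) / R j \<le> G j" .
  qed simp
  finally show "\<bar>\<beta>' j x z h\<bar> \<le> G j * norm h" .
qed

lemma kappa_le_1: "\<kappa> j z \<le> 1"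
  using partition[of j] unfolding subpartition_def \<kappa>_def by blast

lemma beta_le_1:
  assumes "x \<in> A j"
  shows "\<beta> j x z \<le> 1"
proof -
  have "\<beta> j x z \<le> \<kappa> j z"
    unfolding \<kappa>_def using assms net_finite beta_nonneg by (intro member_le_sum) auto
  then show ?thesis
    using kappa_le_1[of j z] by linarith
qed

lemma near_net_point:
  assumes "infdist z K < (1/4)^j"
  obtains x where "x \<in> A j" "norm (z - embed_cn x) \<le> R j / 2"
proof -
  obtain u where u: "u \<in> U" "dist z (embed_cn u) < (1/4)^j"
    using infdist_embed_cn_lessE[OF U_ne assms] by blast
  then obtain x where x: "x \<in> A j" "dist u x \<le> (1/4)^j"
    using net_dense by blast
  have "dist z (embed_cn x) \<le> dist z (embed_cn u) + dist u x"
    using dist_triangle[of z "embed_cn x" "embed_cn u"] by simp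
  also have "\<dots> \<le> R j / 2"
    using u x by (simp add: R_def)
  finally show ?thesis
    using x that by (simp add: dist_norm)
qed

lemma kappa_eq_1:
  assumes "infdist z K < (1/4)^j"
  shows "\<kappa> j z = 1"
  using near_net_point[OF assms] partition[of j] unfolding subpartition_def \<kappa>_def R_def by metis

lemma far_from_net:
  assumes "R j \<le> infdist z K" "x \<in> A j"
  shows "R j \<le> norm (z - embed_cn x)"
proof -
  have "infdist z K \<le> dist z (embed_cn x)"
    using assms(2) net_subset closure_subset by (intro infdist_le) blast
  with assms show ?thesis
    by (simp add: dist_norm)
qed

text \<open>Combines a change of the base point with a change of the degree. The values 2 and 1 of
  \<open>s\<close> belong to \<open>T\<close> and to its derivative. The orders of the jet entries
  exceed \<open>k\<close> by at most 2, one for the derivative and one for the change of base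
  point.\<close>

lemma taylor_change:
  assumes "x \<in> U" "y \<in> U" "norm (z - embed_cn x) \<le> R j" "norm (z - embed_cn y) \<le> R j"
    and "p = q j \<or> p = q (Suc j)" "p' = q j \<or> p' = q (Suc j)" and "s \<in> {1, 2}" "size m \<le> 1"
  shows "norm (taylor a (p + s) m x z - taylor a (p' + s) m y z) \<le> Cd * \<epsilon> j"
proof -
  let ?L = "4 * real CARD('n) * (2 + 2 * c) * (1/4)^j"
  have L: "?L = real CARD('n) * (2 + 2 * c) * R j"
    by (simp add: R_def)
  obtain k where k: "p' + s = Suc k" "min (q j) (q (Suc j)) \<le> k" "k \<le> Suc (max (q j) (q (Suc j)))"
    using assms(6,7) by (cases "p' + s") auto
  obtain \<gamma> where \<gamma>: "path \<gamma>" "path_image \<gamma> \<subseteq> U" "pathstart \<gamma> = x" "pathfinish \<gamma> = y" "path_length \<gamma> \<le> ereal (c * dist x y)"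
    using quasiconvex[OF assms(1,2)] by blast
  have "norm (taylor a (Suc k) m y z - taylor a (Suc k) m x z) \<le> real CARD('n) * 2 * c * R j * \<epsilon> j"
  proof (rule norm_taylor_diff_base[OF jet_axioms open_U assms(1,2) c_nonneg R_pos \<gamma> assms(3,4)])
    fix u and m' :: "'n multiset" assume "u \<in> U" "size m' = size m + Suc k"
    then show "norm (a m' u) * (real CARD('n) * (2 + 2 * c) * R j) ^ k \<le> fact k * \<epsilon> j"
      using jet_bound[of u k m' j] k assms(8) unfolding L by simp
  qed
  also have "\<dots> \<le> 8 * real CARD('n) * c * \<epsilon> j"
    using mult_right_mono[OF R_le[of j], of "real CARD('n) * 2 * c * \<epsilon> j"] c_nonneg eps_nonneg[of j] by (simp add: mult_ac)
  finally have 1: "norm (taylor a (p' + s) m x z - taylor a (p' + s) m y z) \<le> 8 * real CARD('n) * c * \<epsilon> j"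
    unfolding k(1) by (simp add: norm_minus_commute)
  have deg: "norm (taylor a p2 m x z - taylor a p1 m x z) \<le> 2 * \<epsilon> j"
    if "p1 \<le> p2" "min (q j) (q (Suc j)) \<le> p1" "p2 \<le> max (q j) (q (Suc j)) + 2" for p1 p2
  proof (rule norm_taylor_diff_degree[OF that(1) eps_nonneg])
    fix k and m' :: "'n multiset" assume k: "p1 \<le> k" "k < p2" "size m' = size m + k"
    have "2 * real CARD('n) * norm (z - embed_cn x) \<le> ?L"
    proof -
      have "2 * real CARD('n) * norm (z - embed_cn x) \<le> 2 * real CARD('n) * R j"
        using assms(3) by (intro mult_left_mono) auto
      also have "\<dots> \<le> (real CARD('n) * (2 + 2 * c)) * R j"
        using c_nonneg R_pos[of j] by (intro mult_right_mono) auto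
      finally show ?thesis
        unfolding L .
    qed
    then have "norm (a m' x) * (2 * real CARD('n) * norm (z - embed_cn x)) ^ k \<le> norm (a m' x) * ?L ^ k"
      by (intro mult_left_mono power_mono) auto
    also have "\<dots> \<le> fact k * \<epsilon> j"
      using k that assms(1,8) by (intro jet_bound) auto
    finally show "norm (a m' x) * (2 * real CARD('n) * norm (z - embed_cn x)) ^ k \<le> fact k * \<epsilon> j" .
  qed
  have 2: "norm (taylor a (p + s) m x z - taylor a (p' + s) m x z) \<le> 2 * \<epsilon> j"
  proof (cases "p \<le> p'")
    case True
    then show ?thesis
      using deg[of "p + s" "p' + s"] assms(5,6,7) by (subst norm_minus_commute) auto
  next
    case False
    then show ?thesis
      using deg[of "p' + s" "p + s"] assms(5,6,7) by auto
  qed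
  show ?thesis
    using norm_triangle_ineq[of "taylor a (p + s) m x z - taylor a (p' + s) m x z" "taylor a (p' + s) m x z - taylor a (p' + s) m y z"] 1 2
    by (simp add: Cd_def algebra_simps)
qed

lemma T_change:
  assumes "x \<in> U" "y \<in> U" "norm (z - embed_cn x) \<le> R j" "norm (z - embed_cn y) \<le> R j"
    and "i = j \<or> i = Suc j" "l = j \<or> l = Suc j"
  shows "norm (T i x z - T l y z) \<le> Cd * \<epsilon> j" "norm (T' i x z h - T' l y z h) \<le> real CARD('n) * Cd * \<epsilon> j * norm h"
proof -
  show "norm (T i x z - T l y z) \<le> Cd * \<epsilon> j"
    unfolding T_def using assms(5,6) by (intro taylor_change[OF assms(1-4)]) auto
  have "norm (T' i x z h - T' l y z h) = norm (\<Sum>r\<in>UNIV. h $ r * (taylor a (q i + 1) {#r#} x z - taylor a (q l + 1) {#r#} y z))"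
    by (simp add: T'_def sum_subtractf right_diff_distrib)
  also have "\<dots> \<le> (\<Sum>r::'n\<in>UNIV. norm h * (Cd * \<epsilon> j))"
  proof (intro sum_norm_le)
    fix r :: 'n
    have "norm (taylor a (q i + 1) {#r#} x z - taylor a (q l + 1) {#r#} y z) \<le> Cd * \<epsilon> j"
      using assms(5,6) by (intro taylor_change[OF assms(1-4)]) auto
    then show "norm (h $ r * (taylor a (q i + 1) {#r#} x z - taylor a (q l + 1) {#r#} y z)) \<le> norm h * (Cd * \<epsilon> j)"
      unfolding norm_mult by (intro mult_mono) (auto simp: Finite_Cartesian_Product.norm_nth_le)
  qed
  finally show "norm (T' i x z h - T' l y z h) \<le> real CARD('n) * Cd * \<epsilon> j * norm h"
    by (simp add: mult_ac)
qed

lemma T_deriv: "(T j x has_derivative T' j x z) (at z)"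
  using taylor_has_derivative[of a "q j + 1" "{#}" x z] by (simp add: T_def T'_def[abs_def] T_def[abs_def])

lemma T'_deriv_cont: "continuous_on UNIV (\<lambda>z. T' j x z h)"
proof -
  have "continuous_on UNIV (taylor a (q j + 1) m x)" for m
    unfolding Suc_eq_plus1[symmetric]
    by (intro continuous_at_imp_continuous_on ballI has_derivative_continuous[OF taylor_has_derivative])
  then show ?thesis
    unfolding T'_def by (intro continuous_intros)
qed

lemma T_cont: "continuous_on UNIV (T j x)"
  using T_deriv by (rule has_derivative_imp_continuous_on)

lemma beta_cont: "x \<in> A j \<Longrightarrow> continuous_on UNIV (\<beta> j x)"
  using beta_deriv by (rule has_derivative_imp_continuous_on)

lemma N_deriv: "(N j has_derivative N' j z) (at z)"
  unfolding N_def[abs_def] N'_def[abs_def]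
  by (intro has_derivative_sum has_derivative_scaleR beta_deriv T_deriv)

lemma E_deriv: "(E j has_derivative E' j z) (at z)"
  unfolding E_def[abs_def] E'_def[abs_def]
  by (intro has_derivative_sum has_derivative_scaleR has_derivative_mult has_derivative_diff beta_deriv T_deriv)

lemma N'_cont: "continuous_on UNIV (\<lambda>z. N' j z h)"
  unfolding N'_def by (intro continuous_intros beta_cont beta'_cont T_cont T'_deriv_cont)

lemma E'_cont: "continuous_on UNIV (\<lambda>z. E' j z h)"
  unfolding E'_def by (intro continuous_intros beta_cont beta'_cont T_cont T'_deriv_cont)

text \<open>Common summable bound for \<open>E j\<close> and its derivative: two powers of
  \<open>G\<close> count the summands, the third bounds the derivative of a weight.\<close>

definition "e j = (2 + real CARD('n)) * Cd * (G (Suc j) ^ 3 * \<epsilon> j)"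

lemma Cd_nonneg: "Cd \<ge> 0"
  using c_nonneg by (simp add: Cd_def)

lemma e_nonneg: "e j \<ge> 0"
  using Cd_nonneg eps_nonneg G_ge_1[of "Suc j"] unfolding e_def by (intro mult_nonneg_nonneg) auto

lemma summable_e: "summable e"
  unfolding e_def[abs_def] G_def by (intro summable_mult summable_eps)

text \<open>If one of the two weights vanishes identically to first order, so does the term.
  Otherwise \<open>z\<close> is within \<open>R j\<close> of both base points and
  \<open>T_change\<close> applies.\<close>

lemma E_term_bound:
  assumes "x \<in> A (Suc j)" "y \<in> A j"
  shows "norm ((\<beta> (Suc j) x z * \<beta> j y z) *\<^sub>R (T (Suc j) x z - T j y z)) \<le> Cd * \<epsilon> j" (is ?A)
    and "norm ((\<beta> (Suc j) x z * \<beta> j y z) *\<^sub>R (T' (Suc j) x z h - T' j y z h)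
    + (\<beta> (Suc j) x z * \<beta>' j y z h + \<beta>' (Suc j) x z h * \<beta> j y z) *\<^sub>R (T (Suc j) x z - T j y z))
      \<le> (2 + real CARD('n)) * G (Suc j) * (Cd * \<epsilon> j) * norm h" (is ?B)
proof -
  have Ce: "Cd * \<epsilon> j \<ge> 0"
    using Cd_nonneg eps_nonneg by simp
  show ?A ?B
  proof (atomize (full), cases "R (Suc j) \<le> norm (z - embed_cn x) \<or> R j \<le> norm (z - embed_cn y)")
    case True
    then show "?A \<and> ?B"
      using beta_outside[OF assms(1), of z] beta_outside[OF assms(2), of z] Ce G_ge_1[of "Suc j"] by auto
  next
    case False
    then have "norm (z - embed_cn x) \<le> R j" "norm (z - embed_cn y) \<le> R j"
      using R_antimono[of j "Suc j"] by auto
    moreover have "x \<in> U" "y \<in> U"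
      using assms net_subset by auto
    ultimately have t: "norm (T (Suc j) x z - T j y z) \<le> Cd * \<epsilon> j"
      "norm (T' (Suc j) x z h - T' j y z h) \<le> real CARD('n) * Cd * \<epsilon> j * norm h"
      using T_change[of x y z j "Suc j" j] by auto
    have b: "\<bar>\<beta> (Suc j) x z\<bar> \<le> 1" "\<bar>\<beta> j y z\<bar> \<le> 1"
      using beta_nonneg[OF assms(1), of z] beta_le_1[OF assms(1), of z] beta_nonneg[OF assms(2), of z] beta_le_1[OF assms(2), of z] by auto
    then have bb: "\<bar>\<beta> (Suc j) x z * \<beta> j y z\<bar> \<le> 1"
      using mult_mono[of "\<bar>\<beta> (Suc j) x z\<bar>" 1 "\<bar>\<beta> j y z\<bar>" 1] by (simp add: abs_mult)
    have b': "\<bar>\<beta> (Suc j) x z * \<beta>' j y z h + \<beta>' (Suc j) x z h * \<beta> j y z\<bar> \<le> 2 * G (Suc j) * norm h"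
    proof -
      have "\<bar>\<beta> (Suc j) x z * \<beta>' j y z h\<bar> \<le> 1 * (G (Suc j) * norm h)"
        unfolding abs_mult using b beta'_bound[OF assms(2), of z h] mult_right_mono[OF G_mono[of j "Suc j"], of "norm h"]
        by (intro mult_mono) auto
      moreover have "\<bar>\<beta>' (Suc j) x z h * \<beta> j y z\<bar> \<le> (G (Suc j) * norm h) * 1"
        unfolding abs_mult using b beta'_bound[OF assms(1), of z h] G_ge_1[of "Suc j"]
        by (intro mult_mono) auto
      ultimately show ?thesis
        using abs_triangle_ineq[of "\<beta> (Suc j) x z * \<beta>' j y z h" "\<beta>' (Suc j) x z h * \<beta> j y z"] by simp
    qed
    have ?A
      unfolding norm_scaleR using mult_mono[OF bb t(1)] by simp
    moreover have ?B
    proof -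
      have "norm ((\<beta> (Suc j) x z * \<beta> j y z) *\<^sub>R (T' (Suc j) x z h - T' j y z h)) \<le> 1 * (real CARD('n) * Cd * \<epsilon> j * norm h)"
        unfolding norm_scaleR using bb t by (intro mult_mono) auto
      also have "\<dots> \<le> G (Suc j) * (real CARD('n) * Cd * \<epsilon> j * norm h)"
        using G_ge_1[of "Suc j"] Cd_nonneg eps_nonneg[of j] by (intro mult_right_mono) auto
      finally have 1: "norm ((\<beta> (Suc j) x z * \<beta> j y z) *\<^sub>R (T' (Suc j) x z h - T' j y z h)) \<le> G (Suc j) * (real CARD('n) * Cd * \<epsilon> j * norm h)" .
      have "norm ((\<beta> (Suc j) x z * \<beta>' j y z h + \<beta>' (Suc j) x z h * \<beta> j y z) *\<^sub>R (T (Suc j) x z - T j y z))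
        \<le> (2 * G (Suc j) * norm h) * (Cd * \<epsilon> j)"
        unfolding norm_scaleR using b' t G_ge_1[of "Suc j"] by (intro mult_mono) auto
      from norm_triangle_le[OF add_mono[OF 1 this]] show ?thesis
        by (simp add: algebra_simps)
    qed
    ultimately show "?A \<and> ?B"
      by blast
  qed
qed

lemma E_bound: "norm (E j z) \<le> e j" and E'_bound: "norm (E' j z h) \<le> e j * norm h"
proof -
  let ?G = "G (Suc j)"
  have Ce: "Cd * \<epsilon> j \<ge> 0"
    using Cd_nonneg eps_nonneg by simp
  have cc: "real (card (A (Suc j))) * real (card (A j)) \<le> ?G * ?G"
    using card_le_G[of j] card_le_G[of "Suc j"] G_mono[of j "Suc j"] G_ge_1[of "Suc j"] by (intro mult_mono) auto
  have "norm (E j z) \<le> (\<Sum>x\<in>A (Suc j). \<Sum>y\<in>A j. Cd * \<epsilon> j)"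
    unfolding E_def by (intro sum_norm_le E_term_bound; assumption)
  also have "\<dots> = (real (card (A (Suc j))) * real (card (A j))) * (Cd * \<epsilon> j)"
    by simp
  also have "\<dots> \<le> (?G * ?G) * (Cd * \<epsilon> j)"
    using cc Ce by (rule mult_right_mono)
  also have "\<dots> \<le> ((2 + real CARD('n)) * ?G) * ((?G * ?G) * (Cd * \<epsilon> j))"
    using G_ge_1[of "Suc j"] Ce mult_mono[of 1 "2 + real CARD('n)" 1 ?G]
      mult_right_mono[of 1 "(2 + real CARD('n)) * ?G" "(?G * ?G) * (Cd * \<epsilon> j)"] by simp
  finally show "norm (E j z) \<le> e j"
    by (simp add: e_def power3_eq_cube mult_ac)
  have "norm (E' j z h) \<le> (\<Sum>x\<in>A (Suc j). \<Sum>y\<in>A j. (2 + real CARD('n)) * ?G * (Cd * \<epsilon> j) * norm h)"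
    unfolding E'_def by (intro sum_norm_le E_term_bound; assumption)
  also have "\<dots> = (real (card (A (Suc j))) * real (card (A j))) * ((2 + real CARD('n)) * ?G * (Cd * \<epsilon> j) * norm h)"
    by simp
  also have "\<dots> \<le> (?G * ?G) * ((2 + real CARD('n)) * ?G * (Cd * \<epsilon> j) * norm h)"
    using cc Cd_nonneg eps_nonneg[of j] G_ge_1[of "Suc j"] by (intro mult_right_mono mult_nonneg_nonneg) auto
  finally show "norm (E' j z h) \<le> e j * norm h"
    by (simp add: e_def power3_eq_cube mult_ac)
qed


section \<open>Convergence and regularity of the telescoping series\<close>

lemma summable_E: "summable (\<lambda>j. E j z)"
  by (rule summable_comparison_test'[OF summable_e]) (rule E_bound)

lemma summable_E': "summable (\<lambda>j. E' j z h)"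
  by (rule summable_comparison_test'[OF summable_mult2[OF summable_e]]) (rule E'_bound)

text \<open>Termwise differentiation asks for tails that are small uniformly in \<open>z\<close> and
  relative to \<open>norm h\<close>.\<close>

lemma E'_tail:
  assumes "r > 0"
  shows "\<forall>\<^sub>F n in sequentially. \<forall>z h. norm ((\<Sum>i<n. E' i z h) - (\<Sum>j. E' j z h)) \<le> r * norm h"
proof -
  have "\<forall>\<^sub>F n in sequentially. (\<Sum>i. e (i + n)) < r"
    using order_tendstoD(2)[OF suminf_exist_split2[OF summable_e] assms] .
  then show ?thesis
  proof eventually_elim
    case (elim n)
    show ?case
    proof (intro allI)
      fix z h
      have s: "summable (\<lambda>i. norm (E' (i + n) z h))"
        by (rule summable_comparison_test'[OF summable_mult2[OF summable_e[THEN summable_ignore_initial_segment, of n], where c = "norm h"]])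
           (simp add: E'_bound)
      have "norm ((\<Sum>i<n. E' i z h) - (\<Sum>j. E' j z h)) = norm (\<Sum>i. E' (i + n) z h)"
        by (subst suminf_split_initial_segment[OF summable_E', of _ _ n]) simp
      also have "\<dots> \<le> (\<Sum>i. norm (E' (i + n) z h))"
        by (rule summable_norm[OF s])
      also have "\<dots> \<le> (\<Sum>i. e (i + n) * norm h)"
        by (rule suminf_le[OF _ s]) (use E'_bound summable_mult2[OF summable_e[THEN summable_ignore_initial_segment, of n]] in auto)
      also have "\<dots> = (\<Sum>i. e (i + n)) * norm h"
        by (rule suminf_mult2[symmetric]) (rule summable_e[THEN summable_ignore_initial_segment])
      also have "\<dots> \<le> r * norm h"
        using elim by (intro mult_right_mono) auto
      finally show "norm ((\<Sum>i<n. E' i z h) - (\<Sum>j. E' j z h)) \<le> r * norm h" .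
    qed
  qed
qed

lemma F_deriv: "(F has_derivative F' z) (at z)"
proof -
  have "\<exists>g. \<forall>x\<in>UNIV. (\<lambda>n. E n x) sums (g x) \<and> (g has_derivative (\<lambda>h. \<Sum>j. E' j x h)) (at x within UNIV)"
  proof (rule has_derivative_series)
    show "\<forall>\<^sub>F n in sequentially. \<forall>x\<in>UNIV. \<forall>h. norm ((\<Sum>i<n. E' i x h) - (\<Sum>j. E' j x h)) \<le> r * norm h" if "r > 0" for r
      using E'_tail[OF that] by simp
    show "(\<lambda>n. E n 0) sums (\<Sum>n. E n 0)"
      using summable_E by (rule summable_sums)
  qed (auto intro: E_deriv)
  then obtain g where g: "\<And>x. (\<lambda>n. E n x) sums (g x)" "\<And>x. (g has_derivative (\<lambda>h. \<Sum>j. E' j x h)) (at x)"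
    by auto
  have "F = (\<lambda>z. N 0 z + g z)"
    unfolding F_def[abs_def] using sums_unique[OF g(1)] by (intro ext) simp
  then show ?thesis
    unfolding F'_def[abs_def] using has_derivative_add[OF N_deriv g(2)] by simp
qed

lemma F'_cont: "continuous_on UNIV (\<lambda>z. F' z h)"
proof -
  have "uniform_limit UNIV (\<lambda>n z. \<Sum>i<n. E' i z h) (\<lambda>z. \<Sum>j. E' j z h) sequentially"
    by (rule Weierstrass_m_test[OF _ summable_mult2[OF summable_e]]) (rule E'_bound)
  then have "continuous_on UNIV (\<lambda>z. \<Sum>j. E' j z h)"
    by (rule uniform_limit_theorem[rotated]) (auto intro!: always_eventually continuous_on_sum E'_cont)
  then show ?thesis
    unfolding F'_def by (intro continuous_intros N'_cont)
qed

lemma F_support: 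
  assumes "R 0 \<le> infdist z K"
  shows "F z = 0"
proof -
  have b: "\<beta> j x z = 0" if "x \<in> A j" for j x
    using beta_outside[OF that] far_from_net[OF _ that] assms R_antimono[of 0 j] by force
  have "N 0 z = 0" "E j z = 0" for j
    unfolding N_def E_def by (auto simp: b)
  then show ?thesis
    by (simp add: F_def)
qed

lemma C1c_F: "C1c F"
proof -
  have "bounded_linear (F' z)" for z
    using F_deriv by (rule has_derivative_bounded_linear)
  then have ap: "blinfun_apply (Blinfun (F' z)) = F' z" for z
    by (rule bounded_linear_Blinfun_apply)
  have "(F has_derivative blinfun_apply (Blinfun (F' z))) (at z)" for z
    unfolding ap by (rule F_deriv)
  \<comment> \<open>In finite dimension continuity of all directional derivatives gives continuity
    in the operator norm.\<close>
  moreover have "continuous_on UNIV (\<lambda>z. Blinfun (F' z))"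
    by (rule continuous_on_blinfun_componentwise) (simp add: ap F'_cont)
  moreover have "compact (closure {z. F z \<noteq> 0})"
  proof -
    obtain B where B: "\<And>k. k \<in> K \<Longrightarrow> norm k \<le> B"
      using compact_imp_bounded[OF compact_embed_closure[OF bounded_U]] bounded_iff by metis
    have "norm z \<le> B + R 0" if "F z \<noteq> 0" for z
    proof -
      have "infdist z K < R 0"
        using F_support that by force
      then obtain u where u: "u \<in> U" "dist z (embed_cn u) < R 0"
        using infdist_embed_cn_lessE[OF U_ne] by blast
      then have "norm (embed_cn u) \<le> B"
        using B closure_subset by blast
      then show ?thesis
        using u norm_triangle_ineq2[of z "embed_cn u"] by (simp add: dist_norm)
    qed
    then have "bounded {z. F z \<noteq> 0}"
      unfolding bounded_iff by blast
    then show ?thesis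
      by simp
  qed
  ultimately show ?thesis
    unfolding C1c_def by (intro conjI exI[of _ "\<lambda>z. Blinfun (F' z)"] allI)
qed

text \<open>Since \<open>\<kappa> j = 1\<close> on the support of \<open>\<kappa> (j + 1)\<close>, the partial sums of \<open>F\<close> telescope to \<open>N J\<close> near \<open>U\<close>.\<close>

lemma E_telescope: "E j z = \<kappa> j z *\<^sub>R N (Suc j) z - \<kappa> (Suc j) z *\<^sub>R N j z"
proof -
  have "E j z = (\<Sum>x\<in>A (Suc j). \<Sum>y\<in>A j. \<beta> j y z *\<^sub>R (\<beta> (Suc j) x z *\<^sub>R T (Suc j) x z))
     - (\<Sum>x\<in>A (Suc j). \<Sum>y\<in>A j. \<beta> (Suc j) x z *\<^sub>R (\<beta> j y z *\<^sub>R T j y z))"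
    unfolding E_def sum_subtractf[symmetric] by (intro sum.cong refl) (simp add: scaleR_diff_right mult.commute)
  also have "\<dots> = \<kappa> j z *\<^sub>R N (Suc j) z - \<kappa> (Suc j) z *\<^sub>R N j z"
    unfolding \<kappa>_def N_def scaleR_sum_left[symmetric] scaleR_sum_right[symmetric] by simp
  finally show ?thesis .
qed

lemma partial_sum_eq_N:
  assumes "infdist z K < (1/4)^J"
  shows "N 0 z + (\<Sum>j<J. E j z) = N J z"
  using assms
proof (induction J)
  case (Suc J)
  have "(1/4::real)^Suc J \<le> (1/4)^J"
    by simp
  then have lt: "infdist z K < (1/4)^J"
    using Suc.prems by linarith
  show ?case
    using Suc.IH[OF lt] kappa_eq_1[OF lt] kappa_eq_1[OF Suc.prems] by (simp add: E_telescope algebra_simps)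
qed simp

section \<open>Comparison of the extension with a single Taylor polynomial near the domain\<close>

lemma open_near: "open {z. infdist z K < r}"
  by (intro open_Collect_less continuous_intros)

text \<open>The two functions agree on an open set, and derivatives are unique; the weights need not
  be inspected again.\<close>

lemma N'_near:
  assumes "infdist z K < (1/4)^J"
  shows "N' 0 z h + (\<Sum>j<J. E' j z h) = N' J z h"
proof -
  have "((\<lambda>z. N 0 z + (\<Sum>j<J. E j z)) has_derivative (\<lambda>h. N' 0 z h + (\<Sum>j<J. E' j z h))) (at z)"
    by (intro has_derivative_add N_deriv has_derivative_sum E_deriv)
  then have "(N J has_derivative (\<lambda>h. N' 0 z h + (\<Sum>j<J. E' j z h))) (at z)"
    by (rule has_derivative_transform_within_open[OF _ open_near[of "(1/4)^J"]]) (use assms partial_sum_eq_N in auto)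
  from fun_cong[OF has_derivative_unique[OF this N_deriv], of h] show ?thesis .
qed

lemma sum_beta'_near:
  assumes "infdist z K < (1/4)^J"
  shows "(\<Sum>x\<in>A J. \<beta>' J x z h) = 0"
proof -
  have "((\<lambda>z. \<Sum>x\<in>A J. \<beta> J x z) has_derivative (\<lambda>h. \<Sum>x\<in>A J. \<beta>' J x z h)) (at z)"
    by (intro has_derivative_sum beta_deriv)
  then have "((\<lambda>z. 1) has_derivative (\<lambda>h. \<Sum>x\<in>A J. \<beta>' J x z h)) (at z)"
    by (rule has_derivative_transform_within_open[OF _ open_near[of "(1/4)^J"]])
       (use assms kappa_eq_1 in \<open>auto simp: \<kappa>_def\<close>)
  from fun_cong[OF has_derivative_unique[OF this has_derivative_const], of h] show ?thesis .
qed

text \<open>Near \<open>U\<close> the weights add up to 1 and their derivatives to 0, so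
  \<open>T J y\<close> can be subtracted inside both sums. Only differences of Taylor polynomials at
  the same scale remain.\<close>

lemma N_near_T:
  assumes "infdist z K < (1/4)^J" "y \<in> U" "norm (z - embed_cn y) \<le> R J"
  shows "norm (N J z - T J y z) \<le> Cd * \<epsilon> J" "norm (N' J z h - T' J y z h) \<le> 2 * e J * norm h"
proof -
  have Ce: "Cd * \<epsilon> J \<ge> 0"
    using Cd_nonneg eps_nonneg by simp
  have 1: "(\<Sum>x\<in>A J. \<beta> J x z) = 1"
    using kappa_eq_1[OF assms(1)] by (simp add: \<kappa>_def)
  have close: "norm (T J x z - T J y z) \<le> Cd * \<epsilon> J" "norm (T' J x z h - T' J y z h) \<le> real CARD('n) * Cd * \<epsilon> J * norm h"
    if "x \<in> A J" "norm (z - embed_cn x) < R J" for x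
    using T_change[of x y z J J J] that assms net_subset by auto
  have "N J z - T J y z = (\<Sum>x\<in>A J. \<beta> J x z *\<^sub>R (T J x z - T J y z))"
    unfolding N_def using 1 by (simp add: scaleR_diff_right sum_subtractf flip: scaleR_sum_left)
  also have "norm \<dots> \<le> (\<Sum>x\<in>A J. \<beta> J x z * (Cd * \<epsilon> J))"
  proof (rule sum_norm_le)
    fix x assume x: "x \<in> A J"
    show "norm (\<beta> J x z *\<^sub>R (T J x z - T J y z)) \<le> \<beta> J x z * (Cd * \<epsilon> J)"
    proof (cases "norm (z - embed_cn x) < R J")
      case True
      then show ?thesis
        using close[OF x] beta_nonneg[OF x, of z] by (simp add: mult_left_mono)
    next
      case False
      then show ?thesis
        using beta_outside[OF x] by simp
    qed
  qed
  also have "\<dots> = Cd * \<epsilon> J"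
    using 1 by (simp flip: sum_distrib_right)
  finally show "norm (N J z - T J y z) \<le> Cd * \<epsilon> J" .
  have "N' J z h - T' J y z h = (\<Sum>x\<in>A J. \<beta> J x z *\<^sub>R (T' J x z h - T' J y z h) + \<beta>' J x z h *\<^sub>R (T J x z - T J y z))"
  proof -
    have "(\<Sum>x\<in>A J. \<beta> J x z *\<^sub>R (T' J x z h - T' J y z h) + \<beta>' J x z h *\<^sub>R (T J x z - T J y z))
      = N' J z h - (\<Sum>x\<in>A J. \<beta> J x z) *\<^sub>R T' J y z h - (\<Sum>x\<in>A J. \<beta>' J x z h) *\<^sub>R T J y z"
      by (simp add: N'_def scaleR_diff_right sum_subtractf sum.distrib scaleR_sum_left)
    then show ?thesis
      using 1 sum_beta'_near[OF assms(1)] by simp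
  qed
  also have "norm \<dots> \<le> (\<Sum>x\<in>A J. (1 + real CARD('n)) * G J * (Cd * \<epsilon> J) * norm h)"
  proof (rule sum_norm_le)
    fix x assume x: "x \<in> A J"
    show "norm (\<beta> J x z *\<^sub>R (T' J x z h - T' J y z h) + \<beta>' J x z h *\<^sub>R (T J x z - T J y z)) \<le> (1 + real CARD('n)) * G J * (Cd * \<epsilon> J) * norm h"
    proof (cases "norm (z - embed_cn x) < R J")
      case True
      have "norm (\<beta> J x z *\<^sub>R (T' J x z h - T' J y z h)) \<le> G J * (real CARD('n) * Cd * \<epsilon> J * norm h)"
        unfolding norm_scaleR using close(2)[OF x True] beta_nonneg[OF x, of z] beta_le_1[OF x, of z] G_ge_1[of J]
        by (intro mult_mono) auto
      moreover have "norm (\<beta>' J x z h *\<^sub>R (T J x z - T J y z)) \<le> (G J * norm h) * (Cd * \<epsilon> J)"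
        unfolding norm_scaleR using close(1)[OF x True] beta'_bound[OF x] G_ge_1[of J]
        by (intro mult_mono) auto
      ultimately have "norm (\<beta> J x z *\<^sub>R (T' J x z h - T' J y z h) + \<beta>' J x z h *\<^sub>R (T J x z - T J y z))
          \<le> G J * (real CARD('n) * Cd * \<epsilon> J * norm h) + (G J * norm h) * (Cd * \<epsilon> J)"
        by (intro norm_triangle_le add_mono)
      then show ?thesis
        by (simp add: algebra_simps)
    next
      case False
      then show ?thesis
        using beta_outside[OF x, of z] Ce G_ge_1[of J] by auto
    qed
  qed
  also have "\<dots> = real (card (A J)) * ((1 + real CARD('n)) * G J * (Cd * \<epsilon> J) * norm h)"
    by simp
  also have "\<dots> \<le> G (Suc J) ^ 2 * ((2 + real CARD('n)) * G (Suc J) * (Cd * \<epsilon> J) * norm h)"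
  proof (rule mult_mono)
    have "real (card (A J)) \<le> G (Suc J)"
      using card_le_G[of J] G_mono[of J "Suc J"] by simp
    also have "\<dots> \<le> G (Suc J) ^ 2"
      using G_ge_1[of "Suc J"] by (simp add: power2_eq_square)
    finally show "real (card (A J)) \<le> G (Suc J) ^ 2" .
    show "(1 + real CARD('n)) * G J * (Cd * \<epsilon> J) * norm h \<le> (2 + real CARD('n)) * G (Suc J) * (Cd * \<epsilon> J) * norm h"
      using Ce G_mono[of J "Suc J"] G_ge_1[of J] by (intro mult_right_mono mult_mono) auto
  qed (use Ce G_ge_1[of J] in auto)
  also have "\<dots> = e J * norm h"
    by (simp add: e_def power2_eq_square power3_eq_cube mult_ac)
  also have "\<dots> \<le> 2 * e J * norm h"
    using e_nonneg[of J] by (simp add: mult_right_mono)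
  finally show "norm (N' J z h - T' J y z h) \<le> 2 * e J * norm h" .
qed

lemma infdist_K: "x \<in> U \<Longrightarrow> infdist (embed_cn x) K = 0"
  using closure_subset by (intro infdist_zero) blast

text \<open>At a point of \<open>U\<close> the partial sums equal \<open>N J\<close> for every
  \<open>J\<close>, and \<open>T J x\<close> takes the value \<open>a {#} x\<close> at its own base
  point. The difference is at most \<open>e J\<close>, which tends to 0.\<close>

lemma F_extends:
  assumes "x \<in> U"
  shows "F (embed_cn x) = a {#} x"
proof -
  let ?z = "embed_cn x"
  have d: "infdist ?z K < (1/4)^J" for J
    using infdist_K[OF assms] by simp
  have e0: "e \<longlonglongrightarrow> 0"
    using summable_e by (rule summable_LIMSEQ_zero)
  have Ce: "Cd * \<epsilon> J \<le> e J" for J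
  proof -
    have "1 * (Cd * \<epsilon> J) \<le> ((2 + real CARD('n)) * G (Suc J) ^ 3) * (Cd * \<epsilon> J)"
      using Cd_nonneg eps_nonneg[of J] G_ge_1[of "Suc J"] mult_mono[of 1 "2 + real CARD('n)" 1 "G (Suc J) ^ 3"]
      by (intro mult_right_mono) auto
    then show ?thesis
      by (simp add: e_def mult_ac)
  qed
  have T: "T J x ?z = a {#} x" for J
    using taylor_at_base[of a "q J + 1" "{#}" x] by (simp add: T_def)
  have "norm (N J ?z - a {#} x) \<le> e J" for J
    using N_near_T(1)[OF d assms, of J] R_pos[of J] Ce[of J] by (simp add: T)
  then have "(\<lambda>J. N J ?z - a {#} x) \<longlonglongrightarrow> 0"
    by (intro Lim_null_comparison[OF _ e0] always_eventually allI)
  then have "(\<lambda>J. N J ?z) \<longlonglongrightarrow> a {#} x"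
    by (rule LIM_zero_cancel)
  moreover have "(\<lambda>J. N 0 ?z + (\<Sum>j<J. E j ?z)) \<longlonglongrightarrow> F ?z"
    unfolding F_def by (intro tendsto_intros summable_LIMSEQ summable_E)
  ultimately show ?thesis
    unfolding partial_sum_eq_N[OF d] by (rule LIMSEQ_unique[rotated])
qed

lemma T'_ii: "T' j y z (axis i \<i>) = \<i> * T' j y z (axis i 1)"
  unfolding T'_def sum_distrib_left by (intro sum.cong refl) (simp add: axis_def)

text \<open>In this shell all \<open>E' j\<close> with \<open>j > J\<close> vanish, because their
  supports have radius at most \<open>R (Suc (Suc J)) = (1/4)^Suc J\<close>. Hence \<open>F'\<close>
  is \<open>N' J + E' J\<close>, and the holomorphic \<open>T J y\<close> may be subtracted without
  changing the conjugate derivatives.\<close>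

lemma dbar_F_bound:
  assumes "(1/4)^Suc J \<le> infdist z K" "infdist z K < (1/4)^J"
  shows "norm (dbar F z) \<le> real CARD('n) * (3 * e J)"
proof -
  obtain y where y: "y \<in> A J" "norm (z - embed_cn y) \<le> R J / 2"
    using near_net_point[OF assms(2)] by blast
  have zero: "E' j z h = 0" if "j \<ge> Suc J" for j h
  proof -
    have "\<beta> (Suc j) x z = 0" "\<beta>' (Suc j) x z = (\<lambda>h. 0)" if "x \<in> A (Suc j)" for x
    proof -
      have "R (Suc j) \<le> R (Suc (Suc J))"
        using \<open>j \<ge> Suc J\<close> by (intro R_antimono) simp
      also have "\<dots> \<le> infdist z K"
        using assms(1) by (simp add: R_def)
      finally show "\<beta> (Suc j) x z = 0" "\<beta>' (Suc j) x z = (\<lambda>h. 0)"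
        using beta_outside[OF that] far_from_net[OF _ that] by blast+
    qed
    then show ?thesis
      by (simp add: E'_def)
  qed
  have "norm (F' z h - T' J y z h) \<le> 3 * e J * norm h" for h
  proof -
    have "(\<Sum>j. E' j z h) = (\<Sum>j<Suc J. E' j z h)"
      by (rule suminf_finite) (use zero in auto)
    then have "F' z h = N' J z h + E' J z h"
      unfolding F'_def using N'_near[OF assms(2), of h] by (simp add: add.assoc)
    then have "F' z h - T' J y z h = (N' J z h - T' J y z h) + E' J z h"
      by simp
    moreover have "norm (N' J z h - T' J y z h) \<le> 2 * e J * norm h"
      using N_near_T(2)[OF assms(2)] y net_subset R_pos[of J] by force
    ultimately show ?thesis
      using E'_bound[of J z h] norm_triangle_ineq[of "N' J z h - T' J y z h" "E' J z h"] by (simp add: algebra_simps)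
  qed
  note D = this
  have fd: "frechet_derivative F (at z) = F' z"
    using frechet_derivative_at[OF F_deriv] by simp
  have "norm (dbar F z $ i) \<le> 3 * e J" for i
  proof -
    let ?a = "F' z (axis i 1) - T' J y z (axis i 1)" and ?b = "F' z (axis i \<i>) - T' J y z (axis i \<i>)"
    have "dbar F z $ i = (?a + \<i> * ?b) / 2"
      by (simp add: dbar_def fd T'_ii algebra_simps)
    then have "norm (dbar F z $ i) = norm (?a + \<i> * ?b) / 2"
      by (simp only: norm_divide) simp
    also have "\<dots> \<le> (norm ?a + norm ?b) / 2"
      using norm_triangle_ineq[of ?a "\<i> * ?b"] by (simp add: norm_mult)
    also have "norm (axis i 1 :: complex^'n) = 1" "norm (axis i \<i> :: complex^'n) = 1"
      by (simp_all add: norm_Basis axis_in_Basis_iff Basis_complex_def)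
    then have "(norm ?a + norm ?b) / 2 \<le> 3 * e J"
      using D[of "axis i 1"] D[of "axis i \<i>"] by simp
    finally show ?thesis .
  qed
  then have "norm (dbar F z) \<le> (\<Sum>i::'n\<in>UNIV. 3 * e J)"
    unfolding norm_vec_def by (intro order_trans[OF L2_set_le_sum_abs sum_mono]) auto
  then show ?thesis
    by simp
qed

end

text \<open>\<open>\<Lambda>\<close> depends only on \<open>U\<close> and collects its geometry;
  \<open>4 ^ (3 * CARD('n) + 3)\<close> is the growth rate of the cube of \<open>G\<close>. Jet,
  degrees and errors are left free for the choice according to the weight.\<close>

lemma jet_extension_exists:
  fixes U :: "(real^'n::finite) set"
  assumes "quasiconvex_domain U"
  obtains \<Lambda> :: real where "\<Lambda> \<ge> 1"
    "\<And>a q \<epsilon>. jet a U \<Longrightarrow> (\<And>j. \<epsilon> j \<ge> 0) \<Longrightarrow>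
      (\<And>j k m u. u \<in> U \<Longrightarrow> k \<le> size m \<Longrightarrow> size m \<le> k + 2 \<Longrightarrow>
        min (q j) (q (Suc j)) \<le> k \<Longrightarrow> k \<le> Suc (max (q j) (q (Suc j))) \<Longrightarrow>
        norm (a m u) * (\<Lambda> * (1/4)^j) ^ k \<le> fact k * \<epsilon> j) \<Longrightarrow>
      summable (\<lambda>j. (4 ^ (3 * CARD('n) + 3)) ^ j * \<epsilon> j) \<Longrightarrow>
      \<exists>F C. C1c F \<and> (\<forall>x\<in>U. F (embed_cn x) = a {#} x) \<and> C \<ge> 0 \<and>
        (\<forall>z J. (1/4)^Suc J \<le> infdist z (embed_cn ` closure U) \<longrightarrow> infdist z (embed_cn ` closure U) < (1/4)^J \<longrightarrow>
          norm (dbar F z) \<le> C * ((4 ^ (3 * CARD('n) + 3)) ^ J * \<epsilon> J))"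
proof -
  let ?n = "CARD('n)"
  have U: "U \<noteq> {}" "bounded U" "open U"
    using assms by (auto simp: quasiconvex_domain_def)
  obtain c0 where c0: "\<And>x y. x \<in> U \<Longrightarrow> y \<in> U \<Longrightarrow> \<exists>\<gamma>. path \<gamma> \<and> path_image \<gamma> \<subseteq> U \<and> pathstart \<gamma> = x \<and>
         pathfinish \<gamma> = y \<and> path_length \<gamma> \<le> ereal (c0 * dist x y)"
    using assms unfolding quasiconvex_domain_def by blast
  define c where "c = max c0 0"
  have c: "c \<ge> 0" by (simp add: c_def)
  have quasi: "\<exists>\<gamma>. path \<gamma> \<and> path_image \<gamma> \<subseteq> U \<and> pathstart \<gamma> = x \<and>
         pathfinish \<gamma> = y \<and> path_length \<gamma> \<le> ereal (c * dist x y)" if xy: "x \<in> U" "y \<in> U" for x y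
  proof -
    have "c0 * dist x y \<le> c * dist x y"
      by (intro mult_right_mono) (auto simp: c_def)
    then have "ereal (c0 * dist x y) \<le> ereal (c * dist x y)"
      by simp
    then show ?thesis
      using c0[OF xy] order_trans by blast
  qed
  obtain cA0 where cA0: "\<And>N. N > 0 \<Longrightarrow> \<exists>A. finite A \<and> A \<subseteq> U \<and> real (card A) \<le> (cA0 * real N) ^ ?n \<and> (\<forall>x\<in>U. \<exists>a\<in>A. dist x a \<le> 1 / real N)"
    using unit_scale_net[OF U(2)] by blast
  define cA where "cA = max \<bar>cA0\<bar> 1"
  have "\<exists>A. finite A \<and> A \<subseteq> U \<and> real (card A) \<le> (cA * 4 ^ j) ^ ?n \<and> (\<forall>x\<in>U. \<exists>a\<in>A. dist x a \<le> (1/4)^j)" for j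
  proof -
    obtain A where A: "finite A" "A \<subseteq> U" "real (card A) \<le> (cA0 * real (4 ^ j)) ^ ?n" "\<forall>x\<in>U. \<exists>a\<in>A. dist x a \<le> 1 / real (4 ^ j)"
      using cA0[of "4 ^ j"] by auto
    have "(cA0 * real (4 ^ j)) ^ ?n \<le> \<bar>cA0 * real (4 ^ j)\<bar> ^ ?n"
      unfolding power_abs[symmetric] by (rule abs_ge_self)
    also have "\<dots> \<le> (cA * 4 ^ j) ^ ?n"
      by (intro power_mono) (auto simp: cA_def abs_mult)
    finally show ?thesis
      using A by (intro exI[of _ A]) (auto simp: power_one_over)
  qed
  then obtain A where A: "\<And>j. finite (A j)" "\<And>j. A j \<subseteq> U" "\<And>j. real (card (A j)) \<le> (cA * 4 ^ j) ^ ?n"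
    "\<And>j x. x \<in> U \<Longrightarrow> \<exists>a\<in>A j. dist x a \<le> (1/4)^j"
    by metis
  have "\<exists>\<beta> \<beta>'. subpartition embed_cn (A j) (4 * (1/4)^j) \<beta> \<beta>'" for j
    by (rule subpartition_exists) (auto simp: A)
  then obtain \<beta> \<beta>' where part: "\<And>j. subpartition embed_cn (A j) (4 * (1/4)^j) (\<beta> j) (\<beta>' j)"
    by metis
  define \<Lambda> where "\<Lambda> = 4 * real ?n * (2 + 2 * c)"
  define L where "L = (16 * (4 * cA) ^ ?n) ^ 3"
  have L: "(4 * 4^Suc j * (cA * 4^Suc j) ^ ?n) ^ 3 = L * (4 ^ (3 * ?n + 3)) ^ j" for j
  proof -
    have 1: "(cA * 4^Suc j) ^ ?n = (4 * cA) ^ ?n * (4 ^ ?n) ^ j"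
      by (simp add: power_mult_distrib power_mult[symmetric] mult.commute)
    have "(64::real) ^ j = 4 ^ (j * 3)"
      using power_mult[of "4::real" 3 j] by (simp add: mult.commute)
    then show ?thesis
      unfolding 1 L_def by (simp add: power_mult_distrib power_add power_mult[symmetric] mult_ac)
  qed
  have Lpos: "L \<ge> 0"
    by (simp add: L_def cA_def)
  show thesis
  proof (rule that)
    have "1 * 1 \<le> (4 * real ?n) * (2 + 2 * c)"
    proof (intro mult_mono)
      have "1 \<le> real ?n"
        by (simp add: Suc_leI)
      then show "1 \<le> 4 * real ?n"
        by linarith
    qed (use c in auto)
    then show "\<Lambda> \<ge> 1"
      by (simp add: \<Lambda>_def)
    fix a :: "'n multiset \<Rightarrow> real^'n \<Rightarrow> complex" and q :: "nat \<Rightarrow> nat" and \<epsilon> :: "nat \<Rightarrow> real"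
    assume a: "jet a U" and eps: "\<And>j. \<epsilon> j \<ge> 0"
      and bd: "\<And>j k m u. u \<in> U \<Longrightarrow> k \<le> size m \<Longrightarrow> size m \<le> k + 2 \<Longrightarrow>
        min (q j) (q (Suc j)) \<le> k \<Longrightarrow> k \<le> Suc (max (q j) (q (Suc j))) \<Longrightarrow>
        norm (a m u) * (\<Lambda> * (1/4)^j) ^ k \<le> fact k * \<epsilon> j"
      and sm: "summable (\<lambda>j. (4 ^ (3 * ?n + 3)) ^ j * \<epsilon> j)"
    interpret jet_extension a U c cA q \<epsilon> A \<beta> \<beta>'
    proof (intro jet_extension.intro jet_extension_axioms.intro a)
      show "summable (\<lambda>j. (4 * 4 ^ Suc j * (cA * 4 ^ Suc j) ^ ?n) ^ 3 * \<epsilon> j)"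
        unfolding L using summable_mult[OF sm, of L] by (simp only: mult.assoc)
    qed (use U c quasi bd eps A part in \<open>auto simp: \<Lambda>_def cA_def\<close>)
    have e: "e J = ((2 + real ?n) * Cd * L) * ((4 ^ (3 * ?n + 3)) ^ J * \<epsilon> J)" for J
      unfolding e_def G_def L by simp
    let ?C = "real ?n * (3 * ((2 + real ?n) * Cd * L))"
    show "\<exists>F C. C1c F \<and> (\<forall>x\<in>U. F (embed_cn x) = a {#} x) \<and> C \<ge> 0 \<and>
        (\<forall>z J. (1/4)^Suc J \<le> infdist z (embed_cn ` closure U) \<longrightarrow> infdist z (embed_cn ` closure U) < (1/4)^J \<longrightarrow>
          norm (dbar F z) \<le> C * ((4 ^ (3 * ?n + 3)) ^ J * \<epsilon> J))"
    proof (intro exI conjI)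
      show "C1c F"
        by (rule C1c_F)
      show "\<forall>x\<in>U. F (embed_cn x) = a {#} x"
        using F_extends by blast
      show "?C \<ge> 0"
        using Cd_nonneg Lpos by simp
      show "\<forall>z J. (1/4)^Suc J \<le> infdist z (embed_cn ` closure U) \<longrightarrow> infdist z (embed_cn ` closure U) < (1/4)^J \<longrightarrow>
          norm (dbar F z) \<le> ?C * ((4 ^ (3 * ?n + 3)) ^ J * \<epsilon> J)"
      proof (intro allI impI)
        fix z J
        assume "(1/4)^Suc J \<le> infdist z (embed_cn ` closure U)" "infdist z (embed_cn ` closure U) < (1/4)^J"
        from dbar_F_bound[OF this] show "norm (dbar F z) \<le> ?C * ((4 ^ (3 * ?n + 3)) ^ J * \<epsilon> J)"
          unfolding e by (simp add: mult.assoc)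
      qed
    qed
  qed
qed

section \<open>Young conjugates of weight functions\<close>

text \<open>A single term of the exponential series.\<close>

lemma power_le_fact_exp:
  assumes "x \<ge> (0::real)"
  shows "x ^ k \<le> fact k * exp x"
proof -
  have "(\<Sum>i\<in>{k}. x ^ i /\<^sub>R fact i) \<le> (\<Sum>i. x ^ i /\<^sub>R fact i)"
    using assms by (intro sum_le_suminf summable_exp_generic) auto
  then have "x ^ k / fact k \<le> exp x"
    by (simp add: exp_def divide_inverse mult.commute)
  then show ?thesis
    by (simp add: pos_divide_le_eq mult.commute)
qed

locale concave_weight =
  fixes \<omega> :: "real \<Rightarrow> real"
  assumes weight: "weight_function \<omega>" and concave: "concave_on {0..} \<omega>" and little_o: "\<omega> \<in> o[at_top](\<lambda>t. t)"
begin

text \<open>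
  Up to scaling this is \<open>wstar\<close>, with \<open>\<omega>\<close> made constant on \<open>[0,1]\<close>: the convexity of \<open>\<omega> (exp t)\<close> is only
  assumed for \<open>t \<ge> 0\<close>, and in this way it holds on the whole line.
\<close>

definition young :: "real \<Rightarrow> real \<Rightarrow> real" where
  "young \<sigma> t = (SUP s\<in>{0<..}. \<sigma> * \<omega> (max s 1) - s * t)"

lemma omega_mono: "0 \<le> x \<Longrightarrow> x \<le> y \<Longrightarrow> \<omega> x \<le> \<omega> y"
  using weight unfolding weight_function_def mono_on_def by auto

lemma omega_0: "\<omega> 0 = 0" and omega_nonneg: "t \<ge> 0 \<Longrightarrow> \<omega> t \<ge> 0" and omega_at_top: "filterlim \<omega> at_top at_top"
  and ln_little_o: "ln \<in> o[at_top](\<omega>)" and phi_convex: "convex_on {0..} (\<lambda>t. \<omega> (exp t))"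
  using weight unfolding weight_function_def by auto

text \<open>By concavity and \<open>\<omega> 0 = 0\<close> the quotient
  \<open>\<omega> s / s\<close> is nonincreasing.\<close>

lemma omega_ratio:
  assumes "0 < x" "x \<le> y"
  shows "x * \<omega> y \<le> y * \<omega> x"
proof -
  have "(1 - x / y) * \<omega> 0 + (x / y) * \<omega> y \<le> \<omega> ((1 - x / y) *\<^sub>R 0 + (x / y) *\<^sub>R y)"
    using assms by (intro concave_onD[OF concave]) auto
  then have "(x / y) * \<omega> y \<le> \<omega> x"
    using assms by (simp add: omega_0)
  then show ?thesis
    using assms by (simp add: field_simps)
qed

lemma omega_scale:
  assumes "C \<ge> 1" "s > 0"
  shows "\<omega> (max s 1) \<le> C * \<omega> (max (s / C) 1)"
proof (cases "s / C \<ge> 1")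
  case True
  then have "s \<ge> 1"
    using assms by (simp add: field_simps)
  have "(s / C) * \<omega> s \<le> s * \<omega> (s / C)"
    using assms by (intro omega_ratio) (auto simp: field_simps)
  then have "\<omega> s \<le> C * \<omega> (s / C)"
    using assms by (simp add: field_simps)
  with True \<open>s \<ge> 1\<close> show ?thesis
    by simp
next
  case False
  have "1 * \<omega> (max s 1) \<le> max s 1 * \<omega> 1"
    by (intro omega_ratio) auto
  also have "\<dots> \<le> C * \<omega> 1"
    using False assms omega_nonneg[of 1] by (intro mult_right_mono) (auto simp: field_simps)
  finally show ?thesis
    using False by simp
qed

lemma omega_sublinear:
  assumes "c > 0"
  obtains S where "S \<ge> 1" "\<And>s. s \<ge> S \<Longrightarrow> \<omega> s \<le> c * s"
proof -
  have "eventually (\<lambda>s. norm (\<omega> s) \<le> c * norm s) at_top"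
    using landau_o.smallD[OF little_o assms] .
  then obtain S where S: "\<And>s. s \<ge> S \<Longrightarrow> norm (\<omega> s) \<le> c * norm s"
    unfolding eventually_at_top_linorder by blast
  show thesis
  proof (rule that[of "max S 1"])
    fix s assume "s \<ge> max S 1"
    then show "\<omega> s \<le> c * s"
      using S[of s] by auto
  qed simp
qed

lemma ln_le_omega:
  assumes "c > 0"
  obtains S where "S \<ge> 1" "\<And>s. s \<ge> S \<Longrightarrow> ln s \<le> c * \<omega> s"
proof -
  have "eventually (\<lambda>s. norm (ln s) \<le> c * norm (\<omega> s)) at_top"
    using landau_o.smallD[OF ln_little_o assms] .
  then obtain S where S: "\<And>s. s \<ge> S \<Longrightarrow> norm (ln s) \<le> c * norm (\<omega> s)"
    unfolding eventually_at_top_linorder by blast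
  show thesis
  proof (rule that[of "max S 1"])
    fix s assume "s \<ge> max S 1"
    then show "ln s \<le> c * \<omega> s"
      using S[of s] omega_nonneg[of s] by auto
  qed simp
qed

section \<open>Dependence of the Young conjugate on distance and parameter\<close>

lemma young_bdd:
  assumes "t > 0" "\<sigma> \<ge> 0"
  shows "bdd_above ((\<lambda>s. \<sigma> * \<omega> (max s 1) - s * t) ` {0<..})"
proof -
  obtain S where S: "S \<ge> 1" "\<And>s. s \<ge> S \<Longrightarrow> \<omega> s \<le> (t / (\<sigma> + 1)) * s"
    using omega_sublinear[of "t / (\<sigma> + 1)"] assms by auto
  have "\<sigma> * \<omega> (max s 1) - s * t \<le> \<sigma> * \<omega> S" if "s > 0" for s
  proof (cases "s \<ge> S")
    case True
    have "\<sigma> * \<omega> s \<le> (\<sigma> + 1) * \<omega> s"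
      using True S omega_nonneg[of s] by (intro mult_right_mono) auto
    also have "\<dots> \<le> (\<sigma> + 1) * (t / (\<sigma> + 1) * s)"
      using S(2)[OF True] assms by (intro mult_left_mono) auto
    also have "\<dots> = s * t"
      using assms by simp
    finally show ?thesis
      using True S mult_nonneg_nonneg[OF assms(2) omega_nonneg[of S]] by simp
  next
    case False
    then have "\<omega> (max s 1) \<le> \<omega> S"
      using S that by (intro omega_mono) auto
    then have "\<sigma> * \<omega> (max s 1) \<le> \<sigma> * \<omega> S"
      using assms by (intro mult_left_mono)
    moreover have "s * t \<ge> 0"
      using that assms by simp
    ultimately show ?thesis
      by linarith
  qed
  then show ?thesis
    by (auto intro!: bdd_aboveI2)
qed

lemma young_ge:
  assumes "t > 0" "\<sigma> \<ge> 0" "s > 0"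
  shows "\<sigma> * \<omega> (max s 1) - s * t \<le> young \<sigma> t"
  unfolding young_def using young_bdd[OF assms(1,2)] assms(3) by (intro cSUP_upper) auto

lemma young_le:
  assumes "\<And>s. s > 0 \<Longrightarrow> \<sigma> * \<omega> (max s 1) - s * t \<le> B"
  shows "young \<sigma> t \<le> B"
  unfolding young_def using assms by (intro cSUP_least) auto

lemma young_antimono:
  assumes "0 < t" "t \<le> t'" "\<sigma> \<ge> 0"
  shows "young \<sigma> t' \<le> young \<sigma> t"
proof (rule young_le)
  fix s :: real assume s: "s > 0"
  have "\<sigma> * \<omega> (max s 1) - s * t' \<le> \<sigma> * \<omega> (max s 1) - s * t"
    using s assms by simp
  also have "\<dots> \<le> young \<sigma> t"
    using s assms by (intro young_ge)
  finally show "\<sigma> * \<omega> (max s 1) - s * t' \<le> young \<sigma> t" .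
qed

lemma young_mono:
  assumes "0 < t" "0 \<le> \<sigma>" "\<sigma> \<le> \<sigma>'"
  shows "young \<sigma> t \<le> young \<sigma>' t"
proof (rule young_le)
  fix s :: real assume s: "s > 0"
  have "\<sigma> * \<omega> (max s 1) \<le> \<sigma>' * \<omega> (max s 1)"
    using omega_nonneg[of "max s 1"] assms by (intro mult_right_mono) auto
  then show "\<sigma> * \<omega> (max s 1) - s * t \<le> young \<sigma>' t"
    using young_ge[of t \<sigma>' s] s assms by linarith
qed

lemma young_nonneg:
  assumes "t > 0" "\<sigma> \<ge> 0"
  shows "young \<sigma> t \<ge> 0"
proof (rule field_le_epsilon)
  fix e :: real assume "e > 0"
  then have "\<sigma> * \<omega> (max (e / t) 1) - (e / t) * t \<le> young \<sigma> t"
    using assms by (intro young_ge) auto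
  moreover have "\<sigma> * \<omega> (max (e / t) 1) \<ge> 0"
    using assms omega_nonneg[of "max (e / t) 1"] by simp
  ultimately show "0 \<le> young \<sigma> t + e"
    using assms by simp
qed

text \<open>Substituting \<open>s / C\<close> for \<open>s\<close> trades a dilation of the distance
  for a division of the parameter; in this way concavity pays for the geometric constants.\<close>

lemma young_scale:
  assumes "C \<ge> 1" "t > 0" "\<sigma> \<ge> 0"
  shows "young (\<sigma> / C) t \<le> young \<sigma> (C * t)"
proof (rule young_le)
  fix s :: real assume s: "s > 0"
  have "(\<sigma> / C) * \<omega> (max s 1) \<le> (\<sigma> / C) * (C * \<omega> (max (s / C) 1))"
    using assms s by (intro mult_left_mono omega_scale) auto
  also have "\<dots> = \<sigma> * \<omega> (max (s / C) 1)"
    using assms by simp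
  finally have "(\<sigma> / C) * \<omega> (max s 1) - s * t \<le> \<sigma> * \<omega> (max (s / C) 1) - (s / C) * (C * t)"
    using assms by simp
  also have "\<dots> \<le> young \<sigma> (C * t)"
    using assms s by (intro young_ge) auto
  finally show "(\<sigma> / C) * \<omega> (max s 1) - s * t \<le> young \<sigma> (C * t)" .
qed

text \<open>For \<open>s > 1 / t\<close> the larger parameter gains at least the stated amount at
  the same \<open>s\<close>, by monotonicity. For smaller \<open>s\<close> the competitor
  \<open>1 / t\<close> does the same and costs only \<open>(1 / t) * t = 1\<close>.\<close>

lemma young_gain:
  assumes "t > 0" "0 \<le> \<sigma>'" "\<sigma>' \<le> \<sigma>"
  shows "young \<sigma>' t + (\<sigma> - \<sigma>') * \<omega> (max (1 / t) 1) - 1 \<le> young \<sigma> t"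
proof -
  let ?w = "\<lambda>s. \<omega> (max s 1)"
  have "young \<sigma>' t \<le> young \<sigma> t + 1 - (\<sigma> - \<sigma>') * ?w (1 / t)"
  proof (rule young_le)
    fix s :: real assume s: "s > 0"
    show "\<sigma>' * ?w s - s * t \<le> young \<sigma> t + 1 - (\<sigma> - \<sigma>') * ?w (1 / t)"
    proof (cases "s \<le> 1 / t")
      case True
      have "\<sigma>' * ?w s \<le> \<sigma>' * ?w (1 / t)"
        using True assms by (intro mult_left_mono omega_mono) auto
      moreover have "\<sigma> * ?w (1 / t) - (1 / t) * t \<le> young \<sigma> t"
        using assms by (intro young_ge) auto
      moreover have "s * t \<ge> 0"
        using s assms by simp
      ultimately show ?thesis
        using assms by (simp add: algebra_simps)
    next
      case False
      then have "(\<sigma> - \<sigma>') * ?w (1 / t) \<le> (\<sigma> - \<sigma>') * ?w s"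
        using assms by (intro mult_left_mono omega_mono) auto
      moreover have "\<sigma> * ?w s - s * t \<le> young \<sigma> t"
        using assms s by (intro young_ge) auto
      ultimately show ?thesis
        by (simp add: algebra_simps)
    qed
  qed
  then show ?thesis
    by linarith
qed

text \<open>As \<open>ln\<close> is little o of \<open>\<omega>\<close>, the gain
  \<open>(\<sigma> - \<sigma>') * \<omega> (1 / t)\<close> eventually exceeds any multiple of
  \<open>ln (1 / t)\<close>. A larger parameter therefore pays for any fixed power of the
  distance.\<close>

lemma exp_young_absorb:
  fixes N :: nat
  assumes "0 \<le> \<sigma>'" "\<sigma>' < \<sigma>"
  obtains C where "C \<ge> 0" "\<And>t. t > 0 \<Longrightarrow> exp (- young \<sigma> t) \<le> C * t ^ N * exp (- young \<sigma>' t)"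
proof -
  obtain X where X: "X \<ge> 1" "\<And>s. s \<ge> X \<Longrightarrow> ln s \<le> ((\<sigma> - \<sigma>') / (real N + 1)) * \<omega> s"
    using ln_le_omega[of "(\<sigma> - \<sigma>') / (real N + 1)"] assms by auto
  have "exp (- young \<sigma> t) \<le> (exp 1 + X ^ N) * t ^ N * exp (- young \<sigma>' t)" if "t > 0" for t
  proof (cases "1 / t \<ge> X")
    case True
    have "0 \<le> ln (1 / t)"
      using True X(1) by (intro ln_ge_zero) linarith
    then have "real N * ln (1 / t) \<le> (real N + 1) * ln (1 / t)"
      by (intro mult_right_mono) simp
    also have "\<dots> \<le> (real N + 1) * (((\<sigma> - \<sigma>') / (real N + 1)) * \<omega> (1 / t))"
      using X(2)[OF True] by (intro mult_left_mono) auto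
    also have "\<dots> = (\<sigma> - \<sigma>') * \<omega> (max (1 / t) 1)"
    proof -
      have "max (1 / t) 1 = 1 / t"
        using True X(1) by linarith
      then show ?thesis
        by (simp add: add_nonneg_eq_0_iff)
    qed
    finally have "real N * ln (1 / t) + young \<sigma>' t - 1 \<le> young \<sigma> t"
      using young_gain[OF that assms(1), of \<sigma>] assms by linarith
    then have "exp (- young \<sigma> t) \<le> exp (1 + real N * ln t + - young \<sigma>' t)"
      using that by (simp add: ln_div)
    also have "\<dots> = exp 1 * t ^ N * exp (- young \<sigma>' t)"
      using that by (simp only: exp_add) (simp add: exp_of_nat_mult)
    also have "\<dots> \<le> (exp 1 + X ^ N) * t ^ N * exp (- young \<sigma>' t)"
      using X that by (intro mult_right_mono) auto
    finally show ?thesis .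
  next
    case False
    then have "1 \<le> X * t"
      using that by (simp add: field_simps)
    then have "1 \<le> X ^ N * t ^ N"
      unfolding power_mult_distrib[symmetric] by (rule one_le_power)
    also have "\<dots> \<le> (exp 1 + X ^ N) * t ^ N"
      using that by (intro mult_right_mono) auto
    finally have "1 * exp (- young \<sigma>' t) \<le> (exp 1 + X ^ N) * t ^ N * exp (- young \<sigma>' t)"
      by (intro mult_right_mono) auto
    moreover have "exp (- young \<sigma> t) \<le> exp (- young \<sigma>' t)"
      using young_mono[OF that assms(1), of \<sigma>] assms by simp
    ultimately show ?thesis
      by linarith
  qed
  moreover have "exp 1 + X ^ N \<ge> 0"
    using X by (simp add: add_nonneg_nonneg)
  ultimately show thesis
    using that by blast
qed

section \<open>Convexity in logarithmic coordinates and nearly optimal exponents\<close>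

lemma convex_phi_max:
  assumes "0 \<le> l" "l \<le> 1"
  shows "\<omega> (max (exp ((1 - l) * x + l * y)) 1) \<le> (1 - l) * \<omega> (max (exp x) 1) + l * \<omega> (max (exp y) 1)"
proof -
  have m: "max (exp v) 1 = exp (max v 0)" for v :: real
    by (auto simp: max_def)
  have "max ((1 - l) * x + l * y) 0 \<le> (1 - l) * max x 0 + l * max y 0"
  proof -
    have "(1 - l) * x \<le> (1 - l) * max x 0" "l * y \<le> l * max y 0" "0 \<le> (1 - l) * max x 0" "0 \<le> l * max y 0"
      using assms by (auto intro!: mult_left_mono)
    then show ?thesis
      by linarith
  qed
  then have "\<omega> (exp (max ((1 - l) * x + l * y) 0)) \<le> \<omega> (exp ((1 - l) * max x 0 + l * max y 0))"
    by (intro omega_mono) auto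
  also have "\<dots> \<le> (1 - l) * \<omega> (exp (max x 0)) + l * \<omega> (exp (max y 0))"
    using convex_onD[OF phi_convex, of l "max x 0" "max y 0"] assms by simp
  finally show ?thesis
    unfolding m .
qed

text \<open>With \<open>\<tau> = ln s + x\<close> as the variable of the supremum, the expression
  becomes \<open>\<sigma> * \<omega> (max (exp (\<tau> - x)) 1) - exp \<tau>\<close>. This is convex
  in \<open>x\<close> for fixed \<open>\<tau>\<close>, and suprema of convex functions are
  convex.\<close>

lemma convex_young_exp:
  assumes "\<sigma> \<ge> 0"
  shows "convex_on UNIV (\<lambda>x. young \<sigma> (exp x))"
proof (rule convex_onI)
  fix l x y :: real
  assume l: "0 < l" "l < 1"
  let ?z = "(1 - l) * x + l * y"
  have "young \<sigma> (exp ?z) \<le> (1 - l) * young \<sigma> (exp x) + l * young \<sigma> (exp y)"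
  proof (rule young_le)
    fix s :: real assume s: "s > 0"
    \<comment> \<open>Makes \<open>s * exp ?z\<close>, \<open>exp (\<tau> - x) * exp x\<close> and
      \<open>exp (\<tau> - y) * exp y\<close> all equal to \<open>exp \<tau>\<close>, so the terms
      without \<open>\<omega>\<close> match.\<close>
    define \<tau> where "\<tau> = ln s + ?z"
    have se: "s = exp ((1 - l) * (\<tau> - x) + l * (\<tau> - y))"
    proof -
      have "(1 - l) * (\<tau> - x) + l * (\<tau> - y) = ln s"
        by (simp add: \<tau>_def algebra_simps)
      then show ?thesis
        using s by simp
    qed
    have "\<omega> (max s 1) \<le> (1 - l) * \<omega> (max (exp (\<tau> - x)) 1) + l * \<omega> (max (exp (\<tau> - y)) 1)"
      unfolding se using l by (intro convex_phi_max) auto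
    then have 1: "\<sigma> * \<omega> (max s 1) \<le> \<sigma> * ((1 - l) * \<omega> (max (exp (\<tau> - x)) 1) + l * \<omega> (max (exp (\<tau> - y)) 1))"
      using assms by (intro mult_left_mono)
    have 2: "s * exp ?z = exp \<tau>"
      using s by (simp add: \<tau>_def exp_add)
    have 3: "exp (\<tau> - x) * exp x = exp \<tau>" "exp (\<tau> - y) * exp y = exp \<tau>"
      by (simp_all flip: exp_add)
    have "(1 - l) * (\<sigma> * \<omega> (max (exp (\<tau> - x)) 1) - exp (\<tau> - x) * exp x) \<le> (1 - l) * young \<sigma> (exp x)"
      using l assms by (intro mult_left_mono young_ge) auto
    moreover have "l * (\<sigma> * \<omega> (max (exp (\<tau> - y)) 1) - exp (\<tau> - y) * exp y) \<le> l * young \<sigma> (exp y)"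
      using l assms by (intro mult_left_mono young_ge) auto
    ultimately show "\<sigma> * \<omega> (max s 1) - s * exp ?z \<le> (1 - l) * young \<sigma> (exp x) + l * young \<sigma> (exp y)"
      using 1 unfolding 2 3 by (simp add: algebra_simps)
  qed
  then show "young \<sigma> (exp ((1 - l) *\<^sub>R x + l *\<^sub>R y)) \<le> (1 - l) * young \<sigma> (exp x) + l * young \<sigma> (exp y)"
    by simp
qed simp

text \<open>\<open>q\<close> is the integer part of minus the slope of a supporting line of
  \<open>young \<sigma> (exp x)\<close> at \<open>ln r\<close>. The line gives the bound with the
  real exponent; its fractional part costs \<open>max 1 (t / r)\<close>. So
  \<open>exp (- young \<sigma> t) / t^q\<close> is almost maximal at \<open>t = r\<close>.\<close>

lemma exp_young_power_bound:
  assumes "\<sigma> \<ge> 0" "r > 0"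
  obtains q :: nat where "\<And>t. t > 0 \<Longrightarrow> (r / t) ^ q * exp (- young \<sigma> t) \<le> exp (- young \<sigma> r) * max 1 (t / r)"
proof -
  obtain k where k: "\<And>y. young \<sigma> (exp y) \<ge> young \<sigma> (exp (ln r)) + k * (y - ln r)"
    using convex_le_Inf_differential[OF convex_young_exp[OF assms(1)], of "ln r"] by auto
  define \<kappa> where "\<kappa> = - k"
  have "\<kappa> \<ge> 0"
  proof -
    have "young \<sigma> (exp (ln r + 1)) \<le> young \<sigma> (exp (ln r))"
    proof (rule young_antimono)
      show "exp (ln r) \<le> exp (ln r + 1)"
        by (subst exp_le_cancel_iff) simp
    qed (use assms in simp_all)
    then show ?thesis
      using k[of "ln r + 1"] by (simp add: \<kappa>_def)
  qed
  define q where "q = nat \<lfloor>\<kappa>\<rfloor>"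
  have q: "real q \<le> \<kappa>" "\<kappa> \<le> real q + 1"
    using \<open>\<kappa> \<ge> 0\<close> unfolding q_def by linarith+
  have "(r / t) ^ q * exp (- young \<sigma> t) \<le> exp (- young \<sigma> r) * max 1 (t / r)" if "t > 0" for t
  proof -
    define u where "u = ln t - ln r"
    have rt: "r / t = exp (- u)" "t / r = exp u"
      using that assms by (simp_all add: u_def exp_diff)
    have "- young \<sigma> t \<le> - young \<sigma> r + \<kappa> * u"
      using k[of "ln t"] that assms by (simp add: \<kappa>_def u_def)
    then have "(r / t) ^ q * exp (- young \<sigma> t) \<le> exp (- (real q * u)) * exp (- young \<sigma> r + \<kappa> * u)"
      unfolding rt by (simp flip: exp_of_nat_mult)
    also have "\<dots> = exp (- young \<sigma> r) * exp ((\<kappa> - real q) * u)"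
      by (simp add: algebra_simps flip: exp_add)
    also have "\<dots> \<le> exp (- young \<sigma> r) * max 1 (t / r)"
    proof (rule mult_left_mono)
      have "(\<kappa> - real q) * u \<le> max 0 u"
      proof (cases "u \<ge> 0")
        case True
        then show ?thesis
          using mult_right_mono[of "\<kappa> - real q" 1 u] q by auto
      next
        case False
        then show ?thesis
          using q by (simp add: mult_nonneg_nonpos)
      qed
      then have "exp ((\<kappa> - real q) * u) \<le> exp (max 0 u)"
        by simp
      also have "\<dots> = max 1 (t / r)"
        unfolding rt by (auto simp: max_def)
      finally show "exp ((\<kappa> - real q) * u) \<le> max 1 (t / r)" .
    qed simp
    finally show ?thesis .
  qed
  with that show thesis
    by blast
qed

text \<open>A supporting line of \<open>\<omega>\<close> at \<open>s\<close> with slope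
  \<open>g\<close> makes Young's inequality an equality, up to a constant, at
  \<open>t = \<sigma> * g\<close>. With \<open>(t * s)^k \<le> fact k * exp (t * s)\<close> the
  variable \<open>s\<close> of the weight is exchanged for a distance \<open>t\<close>.\<close>

lemma weight_sequence_le:
  assumes "\<sigma> > 0" "s \<ge> 1"
  obtains t where "0 < t" "t \<le> \<sigma> * \<omega> 1"
    "\<And>k. (t * s) ^ k * exp (- \<sigma> * \<omega> s) \<le> exp (\<sigma> * \<omega> 1) * fact k * exp (- young \<sigma> t)"
proof -
  have "convex_on {0..} (\<lambda>x. - \<omega> x)"
    using concave by (simp add: concave_on_def)
  moreover have "s \<in> interior {0..}"
    using assms(2) by simp
  ultimately obtain g0 where g0: "\<And>y. y \<ge> 0 \<Longrightarrow> - \<omega> y \<ge> - \<omega> s + g0 * (y - s)"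
    using convex_le_Inf_differential by (metis (no_types, lifting) atLeast_iff)
  define g where "g = - g0"
  have g: "\<omega> y \<le> \<omega> s + g * (y - s)" if "y \<ge> 0" for y
    using g0[OF that] by (simp add: g_def)
  \<comment> \<open>A nonpositive slope would bound \<open>\<omega>\<close>, which tends to
    infinity.\<close>
  have "g > 0"
  proof (rule ccontr)
    assume "\<not> g > 0"
    have "\<omega> y \<le> \<omega> s" if "y \<ge> s" for y
    proof -
      have "g * (y - s) \<le> 0"
        using that \<open>\<not> g > 0\<close> by (simp add: mult_nonpos_nonneg)
      with g[of y] that assms show ?thesis by simp
    qed
    moreover obtain y0 where "\<And>y. y \<ge> y0 \<Longrightarrow> \<omega> y \<ge> \<omega> s + 1"
      using omega_at_top unfolding filterlim_at_top eventually_at_top_linorder by blast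
    ultimately show False
      using assms(2) by (metis add_le_same_cancel1 max.cobounded1 max.cobounded2 not_one_le_zero order_trans)
  qed
  have "g * s \<le> \<omega> s"
    using g[of 0] by (simp add: omega_0)
  also have "\<omega> s \<le> s * \<omega> 1"
    using omega_ratio[of 1 s] assms by simp
  finally have "g \<le> \<omega> 1"
    using assms by (simp add: mult.commute)
  define t where "t = \<sigma> * g"
  let ?T = "\<sigma> * \<omega> 1"
  have t: "0 < t" "t \<le> ?T"
    using \<open>g > 0\<close> \<open>g \<le> \<omega> 1\<close> assms by (simp_all add: t_def)
  have gs: "\<sigma> * \<omega> y - y * t \<le> \<sigma> * \<omega> s - t * s" if "y \<ge> 0" for y
  proof -
    have "\<sigma> * \<omega> y \<le> \<sigma> * (\<omega> s + g * (y - s))"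
      using g[OF that] assms by (intro mult_left_mono) auto
    then show ?thesis
      by (simp add: t_def algebra_simps)
  qed
  \<comment> \<open>The additive constant \<open>?T\<close> is the price of the truncation
    \<open>max y 1\<close> in \<open>young\<close>.\<close>
  have "young \<sigma> t \<le> \<sigma> * \<omega> s - t * s + ?T"
  proof (rule young_le)
    fix y :: real assume y: "y > 0"
    show "\<sigma> * \<omega> (max y 1) - y * t \<le> \<sigma> * \<omega> s - t * s + ?T"
    proof (cases "y \<ge> 1")
      case True
      then show ?thesis
        using gs[of y] t by (simp add: max_def)
    next
      case False
      then show ?thesis
        using gs[of 1] t y by (simp add: max_def) (smt (verit) mult_nonneg_nonneg)
    qed
  qed
  then have "exp (- (\<sigma> * \<omega> s)) * exp (t * s) \<le> exp ?T * exp (- young \<sigma> t)"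
    by (simp flip: exp_add)
  then have "fact k * (exp (- (\<sigma> * \<omega> s)) * exp (t * s)) \<le> fact k * (exp ?T * exp (- young \<sigma> t))" for k
    by (intro mult_left_mono) auto
  moreover have "(t * s) ^ k * exp (- \<sigma> * \<omega> s) \<le> (fact k * exp (t * s)) * exp (- \<sigma> * \<omega> s)" for k
    using t assms by (intro mult_right_mono power_le_fact_exp) auto
  ultimately have "(t * s) ^ k * exp (- \<sigma> * \<omega> s) \<le> exp ?T * fact k * exp (- young \<sigma> t)" for k
    by (smt (verit) mult.assoc mult.commute mult_minus_left)
  with t that show thesis
    by blast
qed

section \<open>The conjugate of phi as a weight sequence\<close>

lemma wphi_conj_bdd:
  assumes "\<rho> > 0"
  shows "bdd_above ((\<lambda>t. \<rho> * real k * t - wphi \<omega> t) ` {0..})"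
proof -
  obtain S where S: "S \<ge> 1" "\<And>s. s \<ge> S \<Longrightarrow> ln s \<le> (1 / (\<rho> * real k + 1)) * \<omega> s"
    using ln_le_omega[of "1 / (\<rho> * real k + 1)"] assms by (auto simp: add_nonneg_pos)
  have pos: "\<rho> * real k + 1 > 0"
    using assms by (simp add: add_nonneg_pos)
  have "\<rho> * real k * t - wphi \<omega> t \<le> \<rho> * real k * ln S" if "t \<ge> 0" for t
  proof (cases "exp t \<ge> S")
    case True
    then have "t \<le> (1 / (\<rho> * real k + 1)) * \<omega> (exp t)"
      using S(2)[of "exp t"] by simp
    then have "(\<rho> * real k + 1) * t \<le> \<omega> (exp t)"
      using pos by (simp add: field_simps)
    then have "\<rho> * real k * t - wphi \<omega> t \<le> 0"
      using that by (simp add: wphi_def algebra_simps)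
    also have "0 \<le> \<rho> * real k * ln S"
      using assms S by simp
    finally show ?thesis .
  next
    case False
    then have "t \<le> ln S"
      using S by (simp add: ln_ge_iff)
    then have "\<rho> * real k * t \<le> \<rho> * real k * ln S"
      using assms by (intro mult_left_mono) auto
    then show ?thesis
      using omega_nonneg[of "exp t"] by (simp add: wphi_def)
  qed
  then show ?thesis
    by (auto intro!: bdd_aboveI2)
qed

text \<open>Through \<open>s = exp t\<close>, this and \<open>exp_conj_le\<close> identify
  \<open>exp ((1 / \<rho>) * wphi_conj \<omega> (\<rho> * real k))\<close> with the supremum of
  \<open>s^k * exp (- \<omega> s / \<rho>)\<close> over \<open>s \<ge> 1\<close>. Afterwards only
  this description is used.\<close>

lemma power_exp_le_conj:
  assumes "\<rho> > 0" "s \<ge> 1"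
  shows "s ^ k * exp (- \<omega> s / \<rho>) \<le> exp ((1 / \<rho>) * wphi_conj \<omega> (\<rho> * real k))"
proof -
  have "\<rho> * real k * ln s - wphi \<omega> (ln s) \<le> wphi_conj \<omega> (\<rho> * real k)"
    unfolding wphi_conj_def using wphi_conj_bdd[OF assms(1)] assms(2) by (intro cSUP_upper) auto
  then have "\<rho> * real k * ln s - \<omega> s \<le> wphi_conj \<omega> (\<rho> * real k)"
    using assms by (simp add: wphi_def)
  then have "(1 / \<rho>) * (\<rho> * real k * ln s - \<omega> s) \<le> (1 / \<rho>) * wphi_conj \<omega> (\<rho> * real k)"
    using assms by (intro mult_left_mono) auto
  then have "real k * ln s + - \<omega> s / \<rho> \<le> (1 / \<rho>) * wphi_conj \<omega> (\<rho> * real k)"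
    using assms by (simp add: field_simps)
  then have "exp (real k * ln s) * exp (- \<omega> s / \<rho>) \<le> exp ((1 / \<rho>) * wphi_conj \<omega> (\<rho> * real k))"
    unfolding exp_add[symmetric] by simp
  then show ?thesis
    using assms by (simp add: exp_of_nat_mult)
qed

lemma exp_conj_le:
  assumes "\<rho> > 0" "\<And>s. s \<ge> 1 \<Longrightarrow> s ^ k * exp (- \<omega> s / \<rho>) \<le> B"
  shows "exp ((1 / \<rho>) * wphi_conj \<omega> (\<rho> * real k)) \<le> B"
proof -
  have "B > 0"
    using assms(2)[of 1] less_le_trans[OF exp_gt_zero] by simp
  have "wphi_conj \<omega> (\<rho> * real k) \<le> \<rho> * ln B"
    unfolding wphi_conj_def
  proof (intro cSUP_least)
    fix t :: real assume t: "t \<in> {0..}"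
    then have "exp t ^ k * exp (- \<omega> (exp t) / \<rho>) \<le> exp (ln B)"
      using assms(2)[of "exp t"] \<open>B > 0\<close> by simp
    then have "real k * t - \<omega> (exp t) / \<rho> \<le> ln B"
      unfolding exp_of_nat_mult[symmetric] exp_add[symmetric] by simp
    then show "\<rho> * real k * t - wphi \<omega> t \<le> \<rho> * ln B"
      using assms(1) by (simp add: wphi_def field_simps)
  qed simp
  then have "(1 / \<rho>) * wphi_conj \<omega> (\<rho> * real k) \<le> ln B"
    using assms(1) by (simp add: field_simps)
  then show ?thesis
    using \<open>B > 0\<close> by (simp add: ln_ge_iff)
qed

end

section \<open>Almost analytic extensions\<close>

lemma C1cE:
  assumes "C1c F"
  obtains F' r where "\<And>z. (F has_derivative blinfun_apply (F' z)) (at z)" "continuous_on UNIV F'"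
    "r > 0" "\<And>z. norm z > r \<Longrightarrow> F z = 0" "\<And>z. norm z > r \<Longrightarrow> F' z = 0"
    "\<And>z j. dbar F z $ j = (F' z (axis j 1) + \<i> * F' z (axis j \<i>)) / 2"
proof -
  obtain F' where F': "\<And>z. (F has_derivative blinfun_apply (F' z)) (at z)" "continuous_on UNIV F'"
    using assms unfolding C1c_def by blast
  have "bounded {z. F z \<noteq> 0}"
    using assms unfolding C1c_def by simp
  then obtain r where r: "r > 0" "\<And>z. F z \<noteq> 0 \<Longrightarrow> norm z \<le> r"
    unfolding bounded_pos by auto
  have 0: "F z = 0" if "norm z > r" for z
    using r(2)[of z] that by fastforce
  have 1: "F' z = 0" if "norm z > r" for z
  proof -
    have "((\<lambda>z. 0) has_derivative blinfun_apply (F' z)) (at z)"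
    proof (rule has_derivative_transform_within_open[OF F'(1)])
      show "open {z :: complex^'a. norm z > r}"
        by (intro open_Collect_less continuous_intros)
    qed (use 0 that in auto)
    then have "blinfun_apply (F' z) = (\<lambda>h. 0)"
      by (rule has_derivative_unique) (rule has_derivative_const)
    then show ?thesis
      by (intro blinfun_eqI) simp
  qed
  have "frechet_derivative F (at z) = blinfun_apply (F' z)" for z
    using frechet_derivative_at[OF F'(1)] by simp
  then show thesis
    using that[OF F' r(1) 0 1] by (simp add: dbar_def)
qed

lemma continuous_dbar:
  assumes "C1c F"
  shows "continuous_on UNIV (dbar F)"
proof -
  obtain F' r where F': "continuous_on UNIV F'"
    "\<And>z j. dbar F z $ j = (blinfun_apply (F' z) (axis j 1) + \<i> * blinfun_apply (F' z) (axis j \<i>)) / 2"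
    using C1cE[OF assms] by metis
  have "dbar F = (\<lambda>z. \<chi> j. (F' z (axis j 1) + \<i> * F' z (axis j \<i>)) / 2)"
    using F'(2) by (auto simp: fun_eq_iff vec_eq_iff)
  then show ?thesis
    by (simp only:) (intro continuous_intros F'(1), simp)
qed

lemma dbar_support:
  assumes "C1c F"
  obtains r where "r > 0" "\<And>z. norm z > r \<Longrightarrow> dbar F z = 0"
proof -
  obtain F' r where F': "r > 0" "\<And>z. norm z > r \<Longrightarrow> F' z = 0"
    "\<And>z j. dbar F z $ j = (blinfun_apply (F' z) (axis j 1) + \<i> * blinfun_apply (F' z) (axis j \<i>)) / 2"
    using C1cE[OF assms] by metis
  show thesis
    by (rule that[OF F'(1)]) (simp add: vec_eq_iff F'(2,3))
qed

lemma dbar_bounded: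
  assumes "C1c F"
  obtains B where "B > 0" "\<And>z. norm (dbar F z) \<le> B"
  using dbar_support[OF assms] bounded_of_compact_support[OF continuous_dbar[OF assms]] that by metis

text \<open>Jet entries of order up to \<open>k + 2\<close> meet the power \<open>k\<close> of the
  radius; halving the radius absorbs the excess of the factorial.\<close>

lemma fact_add_le:
  assumes "k \<le> l" "l \<le> k + 2"
  shows "fact l \<le> (8 * 2 ^ k * fact k :: real)"
proof -
  have "(real k + 2) * (real k + 1) \<le> 8 * 2 ^ k"
  proof (induction k)
    case (Suc k)
    have "(real (Suc k) + 2) * (real (Suc k) + 1) \<le> 8 * 2 ^ Suc k"
    proof (cases "k = 0")
      case False
      then have "(real k + 3) * (real k + 2) \<le> (2 * (real k + 1)) * (real k + 2)"
        by (intro mult_right_mono) auto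
      then show ?thesis
        using Suc by (simp add: algebra_simps)
    qed simp
    then show ?case .
  qed simp
  then have "((real k + 2) * (real k + 1)) * fact k \<le> (8 * 2 ^ k) * (fact k :: real)"
    by (intro mult_right_mono) auto
  moreover have "(fact (k + 2) :: real) = ((real k + 2) * (real k + 1)) * fact k"
    by (simp add: numeral_2_eq_2 algebra_simps)
  moreover have "(fact l :: real) \<le> fact (k + 2)"
    using assms by (intro fact_mono) simp
  ultimately show ?thesis
    by linarith
qed

text \<open>\<open>i j\<close> is the largest index up to \<open>j\<close> whose constant is still
  below a multiple of \<open>4^j\<close>. It tends to infinity however fast \<open>D\<close> grows,
  so infinitely many estimates can be combined at the cost of one factor \<open>4^j\<close>.\<close>

lemma slow_index_sequence:
  fixes D :: "nat \<Rightarrow> real"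
  obtains i :: "nat \<Rightarrow> nat" and C where "mono i" "\<And>n. \<exists>j0. \<forall>j\<ge>j0. n \<le> i j" "C \<ge> 0" "\<And>j. D (i j) \<le> C * 4 ^ j"
proof -
  define D' where "D' n = (\<Sum>k\<le>n. \<bar>D k\<bar>)" for n
  define S where "S j = {n. n \<le> j \<and> D' n \<le> (1 + D' 0) * 4 ^ j}" for j
  define i where "i j = Max (S j)" for j
  have D'0: "D' 0 \<ge> 0"
    by (simp add: D'_def)
  have fin: "finite (S j)" for j
    by (rule finite_subset[of _ "{..j}"]) (auto simp: S_def)
  have "D' 0 \<le> (1 + D' 0) * 4 ^ j" for j
    using D'0 mult_mono[of "D' 0" "1 + D' 0" 1 "4 ^ j"] by simp
  then have ne: "S j \<noteq> {}" for j
    by (auto simp: S_def)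
  have mem: "i j \<in> S j" for j
    unfolding i_def by (rule Max_in[OF fin ne])
  show thesis
  proof (rule that[of i "1 + D' 0"])
    show "mono i"
    proof (rule monoI)
      fix j j' :: nat assume j: "j \<le> j'"
      have "(1 + D' 0) * 4 ^ j \<le> (1 + D' 0) * 4 ^ j'"
        using j D'0 by (intro mult_left_mono power_increasing) auto
      then have "S j \<subseteq> S j'"
        using j unfolding S_def by auto
      then show "i j \<le> i j'"
        unfolding i_def by (rule Max_mono[OF _ ne fin])
    qed
    show "\<exists>j0. \<forall>j\<ge>j0. n \<le> i j" for n
    proof -
      obtain j1 where j1: "D' n < 4 ^ j1"
        using real_arch_pow[of 4 "D' n"] by auto
      have "n \<le> i j" if "j \<ge> max n j1" for j
      proof -
        have "D' n \<le> 4 ^ j1"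
          using j1 by simp
        also have "(4::real) ^ j1 \<le> 4 ^ j"
          using that by (intro power_increasing) auto
        also have "\<dots> \<le> (1 + D' 0) * 4 ^ j"
          using D'0 by simp
        finally have "n \<in> S j"
          using that by (simp add: S_def)
        then show ?thesis
          unfolding i_def using fin by simp
      qed
      then show ?thesis
        by blast
    qed
    show "D (i j) \<le> (1 + D' 0) * 4 ^ j" for j
    proof -
      have "D (i j) \<le> \<bar>D (i j)\<bar>"
        by simp
      also have "\<dots> \<le> D' (i j)"
        unfolding D'_def by (rule member_le_sum) auto
      finally show ?thesis
        using mem[of j] by (simp add: S_def)
    qed
  qed (use D'0 in simp)
qed

section \<open>Weighted jets and the choice of the degrees\<close>

context concave_weight
begin

lemma omega_1_pos: "\<omega> 1 > 0"
proof (rule ccontr)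
  assume "\<not> ?thesis"
  then have 0: "\<omega> 1 = 0"
    using omega_nonneg[of 1] by simp
  obtain y0 where y0: "\<And>y. y \<ge> y0 \<Longrightarrow> \<omega> y \<ge> 1"
    using omega_at_top unfolding filterlim_at_top eventually_at_top_linorder by blast
  have "1 * \<omega> (max y0 1) \<le> max y0 1 * \<omega> 1"
    by (intro omega_ratio) auto
  with y0[of "max y0 1"] 0 show False
    by simp
qed

text \<open>The hypothesis bounds the jet by a supremum over \<open>s\<close>, expressed through
  arbitrary upper bounds \<open>B\<close>. Exchanging \<open>s\<close> for \<open>t\<close> with
  \<open>weight_sequence_le\<close> leaves a maximisation of
  \<open>(r / t)^k * exp (- young \<tau> t) * t\<close> in \<open>t\<close> alone.\<close>

lemma jet_bound_from_weight:
  fixes a :: "'n::finite multiset \<Rightarrow> real^'n \<Rightarrow> complex"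
  assumes "\<tau> > 0" "C0 \<ge> 0"
    and jets: "\<And>u m B. u \<in> U \<Longrightarrow> (\<And>s. s \<ge> 1 \<Longrightarrow> s ^ size m * exp (- (2 * \<tau>) * \<omega> s) \<le> B) \<Longrightarrow> norm (a m u) \<le> C0 * B"
  obtains D where "D \<ge> 0" 
    "\<And>u k m r X. u \<in> U \<Longrightarrow> k \<le> size m \<Longrightarrow> size m \<le> k + 2 \<Longrightarrow> r > 0 \<Longrightarrow>
      (\<And>t. 0 < t \<Longrightarrow> t \<le> 2 * \<tau> * \<omega> 1 \<Longrightarrow> (r / t) ^ k * exp (- young \<tau> t) * t \<le> X) \<Longrightarrow>
      norm (a m u) * (r / 2) ^ k \<le> fact k * (D * X)"
proof -
  let ?T = "2 * \<tau> * \<omega> 1"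
  have T: "?T > 0"
    using assms(1) omega_1_pos by simp
  \<comment> \<open>Halving the parameter yields \<open>t^3\<close>: up to two powers for the excess
    of \<open>size m\<close> over \<open>k\<close>, and one that is kept in the hypothesis on
    \<open>X\<close>.\<close>
  obtain C' where C': "C' \<ge> 0" "\<And>t. t > 0 \<Longrightarrow> exp (- young (2 * \<tau>) t) \<le> C' * t ^ 3 * exp (- young \<tau> t)"
    using exp_young_absorb[of \<tau> "2 * \<tau>" 3] assms(1) by auto
  define P where "P = exp ?T * C' * (1 + ?T)\<^sup>2"
  have P: "P \<ge> 0"
    using C' by (simp add: P_def)
  show thesis
  proof (rule that[of "8 * C0 * P"])
    show "8 * C0 * P \<ge> 0"
      using P assms(2) by simp
    fix u k r X and m :: "'n multiset"
    assume u: "u \<in> U" and m: "k \<le> size m" "size m \<le> k + 2" and r: "r > 0"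
      and X: "\<And>t. 0 < t \<Longrightarrow> t \<le> ?T \<Longrightarrow> (r / t) ^ k * exp (- young \<tau> t) * t \<le> X"
    let ?l = "size m"
    have "0 < (r / ?T) ^ k * exp (- young \<tau> ?T) * ?T"
      using r T by simp
    also have "\<dots> \<le> X"
      using T by (intro X) auto
    finally have Xpos: "X > 0" .
    obtain e where e: "?l = k + e" "e \<le> 2"
      using m by (metis add_le_cancel_left le_iff_add)
    have "norm (a m u) \<le> C0 * (P * fact ?l * X / r ^ k)"
    proof (rule jets[OF u])
      fix s :: real assume s: "s \<ge> 1"
      obtain t where t: "0 < t" "t \<le> ?T"
        and le: "(t * s) ^ ?l * exp (- (2 * \<tau>) * \<omega> s) \<le> exp ?T * fact ?l * exp (- young (2 * \<tau>) t)"
        using weight_sequence_le[of "2 * \<tau>" s] s assms(1) by (metis mult_pos_pos zero_less_numeral)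
      let ?S = "s ^ ?l * exp (- (2 * \<tau>) * \<omega> s)" and ?Y = "exp (- young \<tau> t)"
      have "t ^ e * (t ^ k * ?S) = (t * s) ^ ?l * exp (- (2 * \<tau>) * \<omega> s)"
        by (simp add: e power_add power_mult_distrib mult_ac)
      also have "\<dots> \<le> exp ?T * fact ?l * (C' * t ^ 3 * ?Y)"
        using le C'(2)[OF t(1)] by (meson exp_ge_zero fact_ge_zero mult_left_mono mult_nonneg_nonneg order_trans)
      also have "\<dots> = t ^ e * (exp ?T * fact ?l * C' * (t ^ (2 - e) * (t * ?Y)))"
      proof -
        have "t ^ 3 = t ^ e * t ^ (2 - e) * t"
          using e(2) by (simp add: power3_eq_cube power2_eq_square flip: power_add)
        then show ?thesis
          by (simp add: mult_ac)
      qed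
      finally have "t ^ k * ?S \<le> exp ?T * fact ?l * C' * (t ^ (2 - e) * (t * ?Y))"
        using t by (simp add: mult_le_cancel_left_pos)
      also have "\<dots> \<le> exp ?T * fact ?l * C' * ((1 + ?T)\<^sup>2 * (t * ?Y))"
      proof (intro mult_left_mono mult_right_mono)
        have "t ^ (2 - e) \<le> (1 + ?T) ^ (2 - e)"
          using t by (intro power_mono) auto
        also have "\<dots> \<le> (1 + ?T)\<^sup>2"
          using T by (intro power_increasing) auto
        finally show "t ^ (2 - e) \<le> (1 + ?T)\<^sup>2" .
      qed (use t C' in auto)
      finally have "r ^ k * (t ^ k * ?S) \<le> r ^ k * (exp ?T * fact ?l * C' * ((1 + ?T)\<^sup>2 * (t * ?Y)))"
        using r by (intro mult_left_mono) auto
      also have "\<dots> = P * fact ?l * t ^ k * ((r / t) ^ k * ?Y * t)"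
        using t by (simp add: P_def power_divide mult_ac)
      also have "\<dots> \<le> P * fact ?l * t ^ k * X"
        using X[OF t] t P by (intro mult_left_mono) auto
      finally have "t ^ k * (?S * r ^ k) \<le> t ^ k * (P * fact ?l * X)"
        by (simp add: mult_ac)
      then have "?S * r ^ k \<le> P * fact ?l * X"
        using t by (simp add: mult_le_cancel_left_pos)
      then show "?S \<le> P * fact ?l * X / r ^ k"
        using r by (simp add: pos_le_divide_eq)
    qed
    then have "norm (a m u) * (r / 2) ^ k \<le> C0 * (P * fact ?l * X / r ^ k) * (r / 2) ^ k"
      using r by (intro mult_right_mono) auto
    also have "\<dots> = C0 * P * X / 2 ^ k * fact ?l"
      using r by (simp add: power_divide)
    also have "\<dots> \<le> C0 * P * X / 2 ^ k * (8 * 2 ^ k * fact k)"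
      using fact_add_le[OF m] assms(2) P Xpos by (intro mult_left_mono) auto
    also have "\<dots> = fact k * (8 * C0 * P * X)"
      by simp
    finally show "norm (a m u) * (r / 2) ^ k \<le> fact k * (8 * C0 * P * X)" .
  qed
qed

text \<open>\<open>\<rho> * wstar \<omega> (d / \<rho>)\<close> is the supremum of
  \<open>\<rho> * \<omega> s - s * d\<close>, which \<open>young \<rho> d\<close> dominates.\<close>

lemma dbar_estimateI:
  fixes F :: "complex^'n::finite \<Rightarrow> complex"
  assumes "\<rho> > 0" "U \<noteq> {}" "bounded U"
    and bd: "\<And>z. z \<notin> embed_cn ` closure U \<Longrightarrow> norm (dbar F z) \<le> C * exp (- young \<rho> (infdist z (embed_cn ` closure U)))"
  shows "dbar_estimate \<omega> U \<rho> F"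
  unfolding dbar_estimate_def
proof (intro exI[of _ C] allI impI)
  fix z :: "complex^'n"
  let ?K = "embed_cn ` closure U" and ?d = "infdist z (embed_cn ` closure U)"
  assume z: "z \<notin> ?K"
  have d: "?d > 0"
    by (rule infdist_embed_closure_pos[OF assms(3,2) z])
  have "wstar \<omega> (?d / \<rho>) \<le> young \<rho> ?d / \<rho>"
    unfolding wstar_def
  proof (intro cSUP_least)
    fix s :: real assume "s \<in> {0..}"
    then have s: "s \<ge> 0" by simp
    have "\<rho> * \<omega> s - s * ?d \<le> young \<rho> ?d"
    proof (cases "s = 0")
      case True
      then show ?thesis
        using young_nonneg[OF d, of \<rho>] assms(1) by (simp add: omega_0)
    next
      case False
      have "\<rho> * \<omega> s \<le> \<rho> * \<omega> (max s 1)"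
        using s assms(1) by (intro mult_left_mono omega_mono) auto
      moreover have "\<rho> * \<omega> (max s 1) - s * ?d \<le> young \<rho> ?d"
        using s False assms(1) by (intro young_ge[OF d]) auto
      ultimately show ?thesis
        by linarith
    qed
    then have "(\<rho> * \<omega> s - s * ?d) / \<rho> \<le> young \<rho> ?d / \<rho>"
      using assms(1) by (intro divide_right_mono) auto
    then show "\<omega> s - s * (?d / \<rho>) \<le> young \<rho> ?d / \<rho>"
      using assms(1) by (simp add: diff_divide_distrib)
  qed simp
  then have "\<rho> * wstar \<omega> (?d / \<rho>) \<le> young \<rho> ?d"
    using assms(1) by (simp add: field_simps)
  then have "norm (dbar F z) * exp (\<rho> * wstar \<omega> (?d / \<rho>)) \<le> (C * exp (- young \<rho> ?d)) * exp (young \<rho> ?d)"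
    using bd[OF z] order_trans[OF norm_ge_zero bd[OF z]] by (intro mult_mono) auto
  also have "\<dots> = C"
    by (simp add: mult.assoc flip: exp_add)
  finally show "norm (dbar F z) * exp (\<rho> * wstar \<omega> (?d / \<rho>)) \<le> C" .
qed

text \<open>Stated for a sequence of parameters so that a constant sequence serves the Roumieu class
  and an unbounded one the Beurling class.\<close>

lemma almost_analytic_extension:
  fixes U :: "(real^'n::finite) set"
  assumes "quasiconvex_domain U"
  obtains c where "c > 0"
    "\<And>a \<tau>. jet a U \<Longrightarrow> (\<And>i::nat. \<tau> i > 0) \<Longrightarrow> mono \<tau> \<Longrightarrow>
      (\<And>i. \<exists>C\<ge>0. \<forall>u\<in>U. \<forall>m B. (\<forall>s\<ge>1. s ^ size m * exp (- (2 * \<tau> i) * \<omega> s) \<le> B) \<longrightarrow> norm (a m u) \<le> C * B) \<Longrightarrow>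
      \<exists>F. C1c F \<and> (\<forall>x\<in>U. F (embed_cn x) = a {#} x) \<and> (\<forall>i \<rho>. 0 < \<rho> \<longrightarrow> \<rho> \<le> \<tau> i / c \<longrightarrow> dbar_estimate \<omega> U \<rho> F)"
proof -
  let ?K = "embed_cn ` closure U"
  define b :: nat where "b = 3 * CARD('n) + 3"
  have U: "U \<noteq> {}" "bounded U" "open U"
    using assms by (auto simp: quasiconvex_domain_def)
  note dpos = infdist_embed_closure_pos[OF U(2,1)]
  obtain \<Lambda> :: real where \<Lambda>: "\<Lambda> \<ge> 1" and ext:
    "\<And>a q \<epsilon>. jet a U \<Longrightarrow> (\<And>j. \<epsilon> j \<ge> 0) \<Longrightarrow>
      (\<And>j k m u. u \<in> U \<Longrightarrow> k \<le> size m \<Longrightarrow> size m \<le> k + 2 \<Longrightarrow>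
        min (q j) (q (Suc j)) \<le> k \<Longrightarrow> k \<le> Suc (max (q j) (q (Suc j))) \<Longrightarrow>
        norm (a m u) * (\<Lambda> * (1/4)^j) ^ k \<le> fact k * \<epsilon> j) \<Longrightarrow>
      summable (\<lambda>j. (4 ^ b) ^ j * \<epsilon> j) \<Longrightarrow>
      \<exists>F C. C1c F \<and> (\<forall>x\<in>U. F (embed_cn x) = a {#} x) \<and> C \<ge> 0 \<and>
        (\<forall>z J. (1/4)^Suc J \<le> infdist z ?K \<longrightarrow> infdist z ?K < (1/4)^J \<longrightarrow>
          norm (dbar F z) \<le> C * ((4 ^ b) ^ J * \<epsilon> J))"
    using jet_extension_exists[OF assms] unfolding b_def by blast
  show thesis
  \<comment> \<open>In the shell of index \<open>J\<close> one has
    \<open>r J \<le> 32 * \<Lambda> * d\<close>; another factor 2 leaves room to absorb powers of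
    \<open>d\<close>.\<close>
  proof (rule that[of "64 * \<Lambda>"])
    show "64 * \<Lambda> > 0"
      using \<Lambda> by simp
    fix a :: "'n multiset \<Rightarrow> real^'n \<Rightarrow> complex" and \<tau> :: "nat \<Rightarrow> real"
    assume a: "jet a U" and \<tau>: "\<And>i. \<tau> i > 0" "mono \<tau>"
      and jets: "\<And>i. \<exists>C\<ge>0. \<forall>u\<in>U. \<forall>m B. (\<forall>s\<ge>1. s ^ size m * exp (- (2 * \<tau> i) * \<omega> s) \<le> B) \<longrightarrow> norm (a m u) \<le> C * B"
    have "\<exists>D\<ge>0. \<forall>u\<in>U. \<forall>k m r X. k \<le> size m \<longrightarrow> size m \<le> k + 2 \<longrightarrow> r > 0 \<longrightarrow>
      (\<forall>t. 0 < t \<longrightarrow> t \<le> 2 * \<tau> i * \<omega> 1 \<longrightarrow> (r / t) ^ k * exp (- young (\<tau> i) t) * t \<le> X) \<longrightarrow>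
      norm (a m u) * (r / 2) ^ k \<le> fact k * (D * X)" for i
    proof -
      obtain C where C: "C \<ge> 0" "\<And>u m B. u \<in> U \<Longrightarrow> (\<And>s. s \<ge> 1 \<Longrightarrow> s ^ size m * exp (- (2 * \<tau> i) * \<omega> s) \<le> B) \<Longrightarrow> norm (a m u) \<le> C * B"
        using jets[of i] by blast
      show ?thesis
      proof (rule jet_bound_from_weight[where U = U and a = a, OF \<tau>(1)[of i] C(1)])
        show "norm (a m u) \<le> C * B" if "u \<in> U" "\<And>s. s \<ge> 1 \<Longrightarrow> s ^ size m * exp (- (2 * \<tau> i) * \<omega> s) \<le> B" for u m B
          using C(2) that by blast
      qed blast
    qed
    then obtain D where D: "\<And>i. D i \<ge> 0"
      "\<And>i u k m r X. u \<in> U \<Longrightarrow> k \<le> size m \<Longrightarrow> size m \<le> k + 2 \<Longrightarrow> r > 0 \<Longrightarrow>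
      (\<And>t. 0 < t \<Longrightarrow> t \<le> 2 * \<tau> i * \<omega> 1 \<Longrightarrow> (r / t) ^ k * exp (- young (\<tau> i) t) * t \<le> X) \<Longrightarrow>
      norm (a m u) * (r / 2) ^ k \<le> fact k * (D i * X)"
      by metis
    define T where "T i = 2 * \<tau> i * \<omega> 1" for i
    have T: "T i > 0" for i
      using \<tau>(1)[of i] omega_1_pos by (simp add: T_def)
    \<comment> \<open>Collects all factors of the estimate that depend on the parameter, so that the
      slow sequence controls them at once.\<close>
    define D' where "D' i = D i * ((T i + 2 * \<Lambda>) * 2 * (1 + T i / (2 * \<Lambda>)))" for i
    have D': "D' i \<ge> 0" for i
      using D(1)[of i] T[of i] \<Lambda> by (simp add: D'_def)
    obtain i :: "nat \<Rightarrow> nat" and C0 where i: "mono i" "\<And>n. \<exists>j0. \<forall>j\<ge>j0. n \<le> i j" "C0 \<ge> 0" "\<And>j. D' (i j) \<le> C0 * 4 ^ j"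
      using slow_index_sequence[of D'] by blast
    define \<sigma> where "\<sigma> j = \<tau> (i j)" for j
    have \<sigma>: "\<sigma> j > 0" for j
      by (simp add: \<sigma>_def \<tau>)
    have \<sigma>_mono: "\<sigma> j \<le> \<sigma> j'" if "j \<le> j'" for j j'
      using that i(1) \<tau>(2) by (simp add: \<sigma>_def monoD)
    \<comment> \<open>Chosen so that \<open>r (Suc j) / 2 = \<Lambda> * (1/4)^j\<close>, the radius
      required by the gluing.\<close>
    define r where "r j = 8 * \<Lambda> * (1/4)^j" for j
    have r: "r j > 0" for j
      using \<Lambda> by (simp add: r_def)
    have "\<exists>q::nat. \<forall>t>0. (r j / t) ^ q * exp (- young (\<sigma> j) t) \<le> exp (- young (\<sigma> j) (r j)) * max 1 (t / r j)" for j
      using exp_young_power_bound[of "\<sigma> j" "r j"] \<sigma>[of j] r[of j] by (metis less_imp_le)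
    then obtain q :: "nat \<Rightarrow> nat" where q: "\<And>j t. t > 0 \<Longrightarrow> (r j / t) ^ q j * exp (- young (\<sigma> j) t) \<le> exp (- young (\<sigma> j) (r j)) * max 1 (t / r j)"
      by metis
    \<comment> \<open>One factor \<open>4^j\<close> pays for \<open>D'\<close> at
      \<open>i (Suc j)\<close>, the other for the quotient of \<open>T\<close> by
      \<open>r (Suc j)\<close>.\<close>
    define \<epsilon> where "\<epsilon> j = 4 * C0 * 16 ^ j * exp (- young (\<sigma> j) (r j))" for j
    have eps: "\<epsilon> j \<ge> 0" for j
      using i(3) by (simp add: \<epsilon>_def)
    have bound: "norm (a m u) * (\<Lambda> * (1/4)^j) ^ k \<le> fact k * \<epsilon> j"
      if u: "u \<in> U" and m: "k \<le> size m" "size m \<le> k + 2"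
        and k: "min (q j) (q (Suc j)) \<le> k" "k \<le> Suc (max (q j) (q (Suc j)))" for j k m u
    proof -
      \<comment> \<open>Parameter and radius of index \<open>Suc j\<close> serve both exponents
        \<open>q j\<close> and \<open>q (Suc j)\<close>, because \<open>\<sigma>\<close> increases
        and \<open>r\<close> decreases with \<open>j\<close>.\<close>
      let ?i = "i (Suc j)" and ?Y = "exp (- young (\<sigma> j) (r j))" and ?r = "r (Suc j)"
      let ?T = "T ?i"
      define X where "X = (?T + 2 * \<Lambda>) * (2 * (?Y * (1 + ?T / ?r)))"
      have r_eq: "?r = 2 * (\<Lambda> * (1/4)^j)" "?r \<le> r j" "?r \<le> 2 * \<Lambda>"
        using \<Lambda> by (auto simp: r_def power_le_one)
      have "norm (a m u) * (?r / 2) ^ k \<le> fact k * (D ?i * X)"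
      proof (rule D(2)[OF u m r])
        fix t assume t: "0 < t" "t \<le> 2 * \<tau> ?i * \<omega> 1"
        then have tT: "t \<le> ?T"
          by (simp add: T_def)
        let ?y = "exp (- young (\<sigma> (Suc j)) t)"
        have frac: "max 1 (t / r l) \<le> 1 + ?T / ?r" if "l = j \<or> l = Suc j" for l
        proof -
          have "t / r l \<le> ?T / ?r"
            using that t tT r_eq r[of l] r[of "Suc j"] by (intro frac_le) auto
          moreover have "?T / ?r \<ge> 0"
            using T[of ?i] r[of "Suc j"] by simp
          ultimately show ?thesis
            by simp
        qed
        have 1: "(?r / t) ^ q j * ?y \<le> ?Y * (1 + ?T / ?r)"
        proof -
          have "(?r / t) ^ q j * ?y \<le> (r j / t) ^ q j * exp (- young (\<sigma> j) t)"
            using t r_eq r[of j] r[of "Suc j"] young_mono[of t "\<sigma> j" "\<sigma> (Suc j)"] \<sigma>[of j] \<sigma>_mono[of j "Suc j"]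
            by (intro mult_mono power_mono divide_right_mono) auto
          also have "\<dots> \<le> ?Y * max 1 (t / r j)"
            using t by (intro q)
          also have "\<dots> \<le> ?Y * (1 + ?T / ?r)"
            using frac by (intro mult_left_mono) auto
          finally show ?thesis .
        qed
        have 2: "(?r / t) ^ q (Suc j) * ?y \<le> ?Y * (1 + ?T / ?r)"
        proof -
          have "(?r / t) ^ q (Suc j) * ?y \<le> exp (- young (\<sigma> (Suc j)) ?r) * max 1 (t / ?r)"
            using t by (intro q)
          also have "\<dots> \<le> ?Y * (1 + ?T / ?r)"
          proof (intro mult_mono)
            have "young (\<sigma> j) (r j) \<le> young (\<sigma> j) ?r"
              using \<sigma>[of j] by (intro young_antimono[OF r r_eq(2)]) simp
            also have "\<dots> \<le> young (\<sigma> (Suc j)) ?r"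
              using r \<sigma>[of j] \<sigma>_mono[of j "Suc j"] by (intro young_mono) auto
            finally show "exp (- young (\<sigma> (Suc j)) ?r) \<le> ?Y"
              by simp
          qed (use frac in auto)
          finally show ?thesis .
        qed
        \<comment> \<open>A power with an intermediate exponent is at most the sum of the two outer
          ones, whether the base is above or below 1.\<close>
        have pw: "(?r / t) ^ l \<le> (?r / t) ^ q j + (?r / t) ^ q (Suc j)"
          if l: "min (q j) (q (Suc j)) \<le> l" "l \<le> max (q j) (q (Suc j))" for l
        proof -
          have nn: "(?r / t) ^ l' \<ge> 0" for l'
            using r[of "Suc j"] t by simp
          show ?thesis
          proof (cases "?r / t \<ge> 1")
            case True
            then have "(?r / t) ^ l \<le> (?r / t) ^ max (q j) (q (Suc j))"
              using l by (intro power_increasing)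
            then show ?thesis
              using nn[of "q j"] nn[of "q (Suc j)"] by (auto simp: max_def split: if_splits)
          next
            case False
            then have "(?r / t) ^ l \<le> (?r / t) ^ min (q j) (q (Suc j))"
              using l r[of "Suc j"] t by (intro power_decreasing) auto
            then show ?thesis
              using nn[of "q j"] nn[of "q (Suc j)"] by (auto simp: min_def split: if_splits)
          qed
        qed
        have "(?r / t) ^ k * t \<le> (?T + 2 * \<Lambda>) * ((?r / t) ^ q j + (?r / t) ^ q (Suc j))"
        proof (cases "k \<le> max (q j) (q (Suc j))")
          case True
          have "t * (?r / t) ^ k \<le> (?T + 2 * \<Lambda>) * ((?r / t) ^ q j + (?r / t) ^ q (Suc j))"
            using pw[OF k(1) True] tT t \<Lambda> r[of "Suc j"] by (intro mult_mono) auto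
          then show ?thesis
            by (simp add: mult.commute)
        next
          case False
          \<comment> \<open>The one exponent beyond the maximum: its additional factor
            \<open>r (Suc j) / t\<close> is cancelled by the \<open>t\<close> kept for this
            purpose.\<close>
          then have kk: "k = Suc (max (q j) (q (Suc j)))"
            using k by simp
          have "?r * (?r / t) ^ max (q j) (q (Suc j)) \<le> (?T + 2 * \<Lambda>) * ((?r / t) ^ q j + (?r / t) ^ q (Suc j))"
          proof (intro mult_mono pw)
            show "?r \<le> ?T + 2 * \<Lambda>" "0 \<le> ?T + 2 * \<Lambda>"
              using r_eq(3) T[of ?i] \<Lambda> by linarith+
          qed (use r[of "Suc j"] t in auto)
          then show ?thesis
            using t by (simp add: kk)
        qed
        then have "((?r / t) ^ k * t) * ?y \<le> ((?T + 2 * \<Lambda>) * ((?r / t) ^ q j + (?r / t) ^ q (Suc j))) * ?y"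
          by (intro mult_right_mono) auto
        also have "\<dots> = (?T + 2 * \<Lambda>) * ((?r / t) ^ q j * ?y + (?r / t) ^ q (Suc j) * ?y)"
          by (simp add: algebra_simps)
        also have "\<dots> \<le> X"
          unfolding X_def using 1 2 T[of ?i] \<Lambda> by (intro mult_left_mono) auto
        finally show "(?r / t) ^ k * exp (- young (\<tau> ?i) t) * t \<le> X"
          by (simp add: \<sigma>_def mult_ac)
      qed
      also have "fact k * (D ?i * X) \<le> fact k * \<epsilon> j"
      proof (rule mult_left_mono)
        have "1 + ?T / ?r \<le> (1 + ?T / (2 * \<Lambda>)) * 4 ^ j"
        proof -
          have "?T / ?r = ?T / (2 * \<Lambda>) * 4 ^ j"
            by (simp add: r_def power_one_over)
          then show ?thesis
            by (simp add: distrib_right)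
        qed
        then have "X \<le> (?T + 2 * \<Lambda>) * (2 * (?Y * ((1 + ?T / (2 * \<Lambda>)) * 4 ^ j)))"
          unfolding X_def using T[of ?i] \<Lambda> by (intro mult_left_mono) auto
        then have "D ?i * X \<le> D ?i * ((?T + 2 * \<Lambda>) * (2 * (?Y * ((1 + ?T / (2 * \<Lambda>)) * 4 ^ j))))"
          using D(1) by (intro mult_left_mono)
        also have "\<dots> = D' ?i * 4 ^ j * ?Y"
          unfolding D'_def by (simp only: mult_ac)
        also have "\<dots> \<le> (C0 * 4 ^ Suc j) * 4 ^ j * ?Y"
          using i(4)[of "Suc j"] by (intro mult_right_mono) auto
        also have "\<dots> = \<epsilon> j"
          unfolding \<epsilon>_def by (simp flip: power_mult_distrib)
        finally show "D ?i * X \<le> \<epsilon> j" .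
      qed simp
      finally show ?thesis
        by (simp add: r_eq(1))
    qed
    have sm: "summable (\<lambda>j. (4 ^ b) ^ j * \<epsilon> j)"
    proof -
      \<comment> \<open>Of the \<open>b + 3\<close> powers, \<open>b\<close> offset the growth from
        the gluing, two offset \<open>16^j\<close>, and one makes the series converge.\<close>
      obtain C where C: "C \<ge> 0" "\<And>t. t > 0 \<Longrightarrow> exp (- young (\<sigma> 0) t) \<le> C * t ^ (b + 3) * exp (- young (\<sigma> 0 / 2) t)"
        using exp_young_absorb[of "\<sigma> 0 / 2" "\<sigma> 0" "b + 3"] \<sigma>[of 0] by auto
      have "norm ((4 ^ b) ^ j * \<epsilon> j) \<le> (4 * C0 * C * (8 * \<Lambda>) ^ (b + 3)) * (1/4) ^ j" for j
      proof -
        have "exp (- young (\<sigma> j) (r j)) \<le> exp (- young (\<sigma> 0) (r j))"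
          using young_mono[OF r[of j], of "\<sigma> 0" "\<sigma> j"] \<sigma>[of 0] \<sigma>_mono[of 0 j] by simp
        also have "\<dots> \<le> C * r j ^ (b + 3) * exp (- young (\<sigma> 0 / 2) (r j))"
          by (rule C(2)[OF r])
        also have "\<dots> \<le> C * r j ^ (b + 3) * 1"
          using C(1) r[of j] young_nonneg[OF r[of j], of "\<sigma> 0 / 2"] \<sigma>[of 0] by (intro mult_left_mono) auto
        finally have le: "exp (- young (\<sigma> j) (r j)) \<le> C * r j ^ (b + 3)"
          by simp
        have "(4 ^ b) ^ j * \<epsilon> j \<le> (4 ^ b) ^ j * (4 * C0 * 16 ^ j * (C * r j ^ (b + 3)))"
          unfolding \<epsilon>_def using le i(3) by (intro mult_left_mono) auto
        also have "\<dots> = (4 * C0 * C * (8 * \<Lambda>) ^ (b + 3)) * ((4 ^ b) ^ j * 16 ^ j * ((1/4)^j) ^ (b + 3))"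
          by (simp add: r_def power_mult_distrib)
        also have "(4 ^ b) ^ j * 16 ^ j * ((1/4)^j) ^ (b + 3) = (1/4 :: real) ^ j"
        proof -
          have "((1/4::real)^j) ^ (b + 3) = ((1/4) ^ (b + 3)) ^ j"
            by (metis power_mult mult.commute)
          then have "(4 ^ b) ^ j * 16 ^ j * ((1/4::real)^j) ^ (b + 3) = (4 ^ b * 16 * (1/4) ^ (b + 3)) ^ j"
            by (simp only: power_mult_distrib)
          also have "4 ^ b * 16 * (1/4) ^ (b + 3) = (1/4 :: real)"
            by (simp add: power_add power_one_over)
          finally show ?thesis .
        qed
        finally show ?thesis
          using eps[of j] by simp
      qed
      then show ?thesis
        by (intro summable_comparison_test'[OF summable_mult[OF summable_geometric]]) auto
    qed
    obtain F C1 where F: "C1c F" "\<forall>x\<in>U. F (embed_cn x) = a {#} x" "C1 \<ge> 0"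
      and dF: "\<And>z J. (1/4)^Suc J \<le> infdist z ?K \<Longrightarrow> infdist z ?K < (1/4)^J \<Longrightarrow> norm (dbar F z) \<le> C1 * ((4 ^ b) ^ J * \<epsilon> J)"
      using ext[OF a eps bound sm] by blast
    obtain B where B: "B > 0" "\<And>z. norm (dbar F z) \<le> B"
      using dbar_bounded[OF F(1)] by blast
    have est: "\<exists>C. \<forall>z. z \<notin> ?K \<longrightarrow> norm (dbar F z) \<le> C * exp (- young (\<tau> l / (64 * \<Lambda>)) (infdist z ?K))" for l
    proof -
      let ?\<rho> = "\<tau> l / (64 * \<Lambda>)"
      have \<rho>: "?\<rho> > 0"
        using \<tau>(1) \<Lambda> by simp
      obtain j0 where j0: "\<And>j. j \<ge> j0 \<Longrightarrow> l \<le> i j"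
        using i(2) by blast
      have half: "?\<rho> < \<tau> l / (32 * \<Lambda>)"
        using \<tau>(1)[of l] \<Lambda> by (simp add: field_simps)
      obtain C where C: "C \<ge> 0" "\<And>t. t > 0 \<Longrightarrow> exp (- young (\<tau> l / (32 * \<Lambda>)) t) \<le> C * t ^ (b + 2) * exp (- young ?\<rho> t)"
        using exp_young_absorb[OF _ half, of "b + 2"] \<rho> by (metis less_imp_le)
      \<comment> \<open>Only from index \<open>j0\<close> on does the slow sequence reach
        \<open>l\<close>; farther away from \<open>U\<close> the boundedness of
        \<open>dbar F\<close> suffices.\<close>
      define d0 where "d0 = (1/4::real) ^ j0"
      have d0: "d0 > 0"
        by (simp add: d0_def)
      define M where "M = max (C1 * (4 * C0 * C)) (B * exp (young ?\<rho> d0))"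
      have "norm (dbar F z) \<le> M * exp (- young ?\<rho> (infdist z ?K))" if z: "z \<notin> ?K" for z
      proof (cases "infdist z ?K < d0")
        case True
        let ?d = "infdist z ?K"
        note d = dpos[OF z]
        obtain n where n: "(1/4::real) ^ n < ?d"
          using real_arch_pow_inv[OF d, of "1/4"] by auto
        define J where "J = (LEAST n. (1/4::real) ^ n \<le> ?d) - 1"
        let ?m = "LEAST n. (1/4::real) ^ n \<le> ?d"
        have m: "(1/4::real) ^ ?m \<le> ?d"
          by (rule LeastI[of _ n]) (use n in simp)
        have "?m > j0"
        proof (rule ccontr)
          assume "\<not> ?m > j0"
          then have "d0 \<le> (1/4::real) ^ ?m"
            unfolding d0_def by (intro power_decreasing) auto
          with m True show False
            by linarith
        qed
        then have J: "?m = Suc J" "J \<ge> j0"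
          by (auto simp: J_def)
        have lo: "(1/4)^Suc J \<le> ?d"
          using m unfolding J(1) .
        have hi: "?d < (1/4)^J"
          using not_less_Least[of J "\<lambda>n. (1/4::real) ^ n \<le> ?d"] J(1) by simp
        have pow: "(4 ^ b) ^ J * 16 ^ J * ?d ^ (b + 2) \<le> 1"
        proof -
          have "4 ^ J * ?d \<le> 4 ^ J * (1/4) ^ J"
            using hi by (intro mult_left_mono) auto
          then have "(4 ^ J * ?d) ^ (b + 2) \<le> 1"
            using d by (intro power_le_one) (auto simp: power_one_over)
          moreover have "(4 ^ b) ^ J * 16 ^ J = ((4::real) ^ J) ^ (b + 2)"
            by (simp add: power_add power_mult[symmetric] mult.commute power2_eq_square flip: power_mult_distrib)
          ultimately show ?thesis
            by (simp only: power_mult_distrib)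
        qed
        have "exp (- young (\<sigma> J) (r J)) \<le> exp (- young (\<tau> l / (32 * \<Lambda>)) ?d)"
        proof -
          have "r J \<le> 32 * \<Lambda> * ?d"
            using lo \<Lambda> by (simp add: r_def)
          then have "young (\<sigma> J) (32 * \<Lambda> * ?d) \<le> young (\<sigma> J) (r J)"
            using r \<sigma>[of J] by (intro young_antimono) auto
          moreover have "young (\<tau> l) (32 * \<Lambda> * ?d) \<le> young (\<sigma> J) (32 * \<Lambda> * ?d)"
            using j0[OF J(2)] \<tau> \<Lambda> d by (intro young_mono) (auto simp: \<sigma>_def monoD less_imp_le)
          moreover have "young (\<tau> l / (32 * \<Lambda>)) ?d \<le> young (\<tau> l) (32 * \<Lambda> * ?d)"
            using \<tau>(1)[of l] \<Lambda> d by (intro young_scale) auto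
          ultimately show ?thesis
            by simp
        qed
        also have "\<dots> \<le> C * ?d ^ (b + 2) * exp (- young ?\<rho> ?d)"
          by (rule C(2)[OF d])
        finally have "\<epsilon> J \<le> 4 * C0 * 16 ^ J * (C * ?d ^ (b + 2) * exp (- young ?\<rho> ?d))"
          unfolding \<epsilon>_def using i(3) by (intro mult_left_mono) auto
        then have "C1 * ((4 ^ b) ^ J * \<epsilon> J) \<le> C1 * ((4 ^ b) ^ J * (4 * C0 * 16 ^ J * (C * ?d ^ (b + 2) * exp (- young ?\<rho> ?d))))"
          using F(3) by (intro mult_left_mono) auto
        also have "\<dots> = C1 * (4 * C0 * C) * (((4 ^ b) ^ J * 16 ^ J * ?d ^ (b + 2)) * exp (- young ?\<rho> ?d))"
          by (simp add: mult_ac)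
        also have "\<dots> \<le> C1 * (4 * C0 * C) * (1 * exp (- young ?\<rho> ?d))"
          using pow F(3) i(3) C(1) by (intro mult_left_mono mult_right_mono) auto
        also have "\<dots> \<le> M * (1 * exp (- young ?\<rho> ?d))"
          by (intro mult_right_mono) (auto simp: M_def)
        finally show ?thesis
          using dF[OF lo hi] by simp
      next
        case False
        then have "young ?\<rho> (infdist z ?K) \<le> young ?\<rho> d0"
          using d0 \<rho> by (intro young_antimono) auto
        then have "1 \<le> exp (young ?\<rho> d0) * exp (- young ?\<rho> (infdist z ?K))"
          by (simp flip: exp_add)
        then have "B * 1 \<le> B * (exp (young ?\<rho> d0) * exp (- young ?\<rho> (infdist z ?K)))"
          using B(1) by (intro mult_left_mono) auto
        also have "\<dots> \<le> M * exp (- young ?\<rho> (infdist z ?K))"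
          unfolding mult.assoc[symmetric] by (intro mult_right_mono) (auto simp: M_def)
        finally show ?thesis
          using B(2)[of z] by simp
      qed
      then show ?thesis
        by blast
    qed
    have "dbar_estimate \<omega> U \<rho> F" if \<rho>: "0 < \<rho>" "\<rho> \<le> \<tau> l / (64 * \<Lambda>)" for l \<rho>
    proof -
      obtain C where C: "\<And>z. z \<notin> ?K \<Longrightarrow> norm (dbar F z) \<le> C * exp (- young (\<tau> l / (64 * \<Lambda>)) (infdist z ?K))"
        using est by blast
      show ?thesis
      proof (rule dbar_estimateI[OF \<rho>(1) U(1,2)])
        fix z assume z: "z \<notin> ?K"
        have "0 \<le> C * exp (- young (\<tau> l / (64 * \<Lambda>)) (infdist z ?K))"
          using order_trans[OF norm_ge_zero C[OF z]] .
        then have "C \<ge> 0"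
          by (simp add: zero_le_mult_iff)
        moreover have "young \<rho> (infdist z ?K) \<le> young (\<tau> l / (64 * \<Lambda>)) (infdist z ?K)"
          using dpos[OF z] \<rho> by (intro young_mono) auto
        ultimately have "C * exp (- young (\<tau> l / (64 * \<Lambda>)) (infdist z ?K)) \<le> C * exp (- young \<rho> (infdist z ?K))"
          by (intro mult_left_mono) auto
        with C[OF z] show "norm (dbar F z) \<le> C * exp (- young \<rho> (infdist z ?K))"
          by linarith
      qed
    qed
    with F(1,2) show "\<exists>F. C1c F \<and> (\<forall>x\<in>U. F (embed_cn x) = a {#} x) \<and> (\<forall>i \<rho>. 0 < \<rho> \<longrightarrow> \<rho> \<le> \<tau> i / (64 * \<Lambda>) \<longrightarrow> dbar_estimate \<omega> U \<rho> F)"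
      by blast
  qed
qed

end

section \<open>The Bochner--Martinelli formula\<close>

lemma integrable_bounded_support:
  fixes f :: "'a::euclidean_space \<Rightarrow> 'b::{banach, second_countable_topology}"
  assumes "f \<in> borel_measurable borel" "\<And>x. norm (f x) \<le> B" "\<And>x. norm x > r \<Longrightarrow> f x = 0"
  shows "integrable lborel f" "norm (integral\<^sup>L lborel f) \<le> B * measure lborel (cball (0::'a) r)"
proof -
  have i: "integrable lborel (\<lambda>x::'a. indicator (cball 0 r) x *\<^sub>R B)"
    by (intro integrable_scaleR_left integrable_real_indicator) (auto simp: emeasure_lborel_cball_finite[simplified])
  have le: "norm (f x) \<le> indicator (cball 0 r) x *\<^sub>R B" for x
    using assms(2)[of x] assms(3)[of x] by (auto simp: indicator_def)
  have B: "B \<ge> 0"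
    using order_trans[OF norm_ge_zero assms(2)] .
  show int: "integrable lborel f"
    by (rule Bochner_Integration.integrable_bound[OF i]) (use assms(1) le B in \<open>auto intro!: AE_I2 order_trans[OF le]\<close>)
  have "norm (integral\<^sup>L lborel f) \<le> integral\<^sup>L lborel (\<lambda>x. norm (f x))"
    by (rule integral_norm_bound)
  also have "\<dots> \<le> integral\<^sup>L lborel (\<lambda>x::'a. indicator (cball 0 r) x *\<^sub>R B)"
    using int i le by (intro integral_mono) auto
  also have "\<dots> = B * measure lborel (cball (0::'a) r)"
    by simp
  finally show "norm (integral\<^sup>L lborel f) \<le> B * measure lborel (cball (0::'a) r)" .
qed

lemma lborel_integral_translate:
  fixes f :: "'a::euclidean_space \<Rightarrow> 'b::{banach, second_countable_topology}"
  assumes "f \<in> borel_measurable borel"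
  shows "integral\<^sup>L lborel (\<lambda>x. f (c + x)) = integral\<^sup>L lborel f"
proof -
  have "integral\<^sup>L (distr lborel borel ((+) c)) f = integral\<^sup>L lborel (\<lambda>x. f (c + x))"
    using assms by (intro integral_distr) auto
  then show ?thesis
    by (simp add: lborel_distr_plus)
qed

lemma lborel_integral_scale:
  fixes f :: "'a::euclidean_space \<Rightarrow> 'b::{banach, second_countable_topology}"
  assumes [measurable]: "f \<in> borel_measurable borel" and "c \<noteq> 0"
  shows "integral\<^sup>L lborel f = integral\<^sup>L lborel (\<lambda>x. (\<bar>c\<bar> ^ DIM('a)) *\<^sub>R f (t + c *\<^sub>R x))"
proof -
  have "integral\<^sup>L lborel f = integral\<^sup>L (density (distr lborel borel (\<lambda>x. t + c *\<^sub>R x)) (\<lambda>_. ennreal (\<bar>c\<bar> ^ DIM('a)))) f"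
    using lborel_affine[OF assms(2), of t] by simp
  also have "\<dots> = integral\<^sup>L (distr lborel borel (\<lambda>x. t + c *\<^sub>R x)) (\<lambda>x. (\<bar>c\<bar> ^ DIM('a)) *\<^sub>R f x)"
    by (rule integral_density) auto
  also have "\<dots> = integral\<^sup>L lborel (\<lambda>x. (\<bar>c\<bar> ^ DIM('a)) *\<^sub>R f (t + c *\<^sub>R x))"
    by (rule integral_distr) auto
  finally show ?thesis .
qed

text \<open>Difference quotients have integral 0 by translation invariance, and compact support lets
  them converge dominatedly. This takes the role of Stokes' theorem.\<close>

lemma integral_directional_derivative_eq_0:
  fixes G :: "'a::euclidean_space \<Rightarrow> complex"
  assumes der: "\<And>z. (G has_derivative G' z) (at z)" and cont: "continuous_on UNIV (\<lambda>z. G' z v)"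
    and supp: "\<And>z. norm z > r \<Longrightarrow> G z = 0"
  shows "integral\<^sup>L lborel (\<lambda>z. G' z v) = 0"
proof -
  have contG: "continuous_on UNIV G"
    using der by (rule has_derivative_imp_continuous_on)
  then have [measurable]: "G \<in> borel_measurable borel"
    by (rule borel_measurable_continuous_onI)
  have [measurable]: "(\<lambda>z. G' z v) \<in> borel_measurable borel"
    using cont by (rule borel_measurable_continuous_onI)
  have G'0: "G' z v = 0" if "norm z > r" for z
  proof -
    have "((\<lambda>z. 0) has_derivative G' z) (at z)"
    proof (rule has_derivative_transform_within_open[OF der])
      show "open {z :: 'a. norm z > r}"
        by (intro open_Collect_less continuous_intros)
    qed (use supp that in auto)
    from fun_cong[OF has_derivative_unique[OF this has_derivative_const], of v] show ?thesis .
  qed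
  obtain B0 where B0: "B0 > 0" and B: "\<And>z. norm (G' z v) \<le> B0"
    using bounded_of_compact_support[OF cont G'0] by metis
  define t where "t m = 1 / (real m + 1)" for m :: nat
  have t: "0 < t m" "t m \<le> 1" for m
    by (auto simp: t_def)
  define Q where "Q m z = (1 / t m) *\<^sub>R (G (t m *\<^sub>R v + z) - G z)" for m z
  have bound: "norm (Q m z) \<le> indicator (cball 0 (r + norm v)) z *\<^sub>R B0" for m z
  proof (cases "norm z \<le> r + norm v")
    case True
    have "norm (G (z + t m *\<^sub>R v) - G (z + 0 *\<^sub>R v)) \<le> B0 * norm (t m - 0)"
    proof (rule differentiable_bound[where S = "{0..t m}" and f = "\<lambda>s. G (z + s *\<^sub>R v)" and f' = "\<lambda>s h. h *\<^sub>R G' (z + s *\<^sub>R v) v"])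
      fix s assume "s \<in> {0..t m}"
      have "((\<lambda>s. z + s *\<^sub>R v) has_derivative (\<lambda>h. h *\<^sub>R v)) (at s within {0..t m})"
        by (auto intro!: derivative_eq_intros)
      from has_derivative_compose[OF this der]
      show "((\<lambda>s. G (z + s *\<^sub>R v)) has_derivative (\<lambda>h. h *\<^sub>R G' (z + s *\<^sub>R v) v)) (at s within {0..t m})"
        using has_derivative_linear[OF der] by (simp add: linear_scale)
      show "onorm (\<lambda>h. h *\<^sub>R G' (z + s *\<^sub>R v) v) \<le> B0"
      proof (rule onorm_le)
        show "norm (h *\<^sub>R G' (z + s *\<^sub>R v) v) \<le> B0 * norm h" for h
          using mult_right_mono[OF B[of "z + s *\<^sub>R v"], of "norm h"] by (simp add: mult.commute)
      qed
    qed (use t[of m] in auto)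
    then have "norm (Q m z) \<le> B0"
      using t[of m] by (simp add: Q_def add.commute pos_divide_le_eq)
    with True show ?thesis
      by simp
  next
    case False
    have "norm z - norm (t m *\<^sub>R v) \<le> norm (t m *\<^sub>R v + z)"
      using norm_triangle_ineq2[of z "- (t m *\<^sub>R v)"] by (simp add: add.commute)
    moreover have "norm (t m *\<^sub>R v) \<le> norm v"
      using t[of m] by (simp add: mult_left_le_one_le)
    ultimately have "norm (t m *\<^sub>R v + z) > r" "norm z > r"
      using False norm_ge_zero[of v] by linarith+
    then show ?thesis
      using supp False by (simp add: Q_def)
  qed
  have lim: "(\<lambda>m. Q m z) \<longlonglongrightarrow> G' z v" for z
  proof -
    have "((\<lambda>s. G (z + s *\<^sub>R v)) has_vector_derivative G' z v) (at 0)"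
    proof -
      have "((\<lambda>s. z + s *\<^sub>R v) has_derivative (\<lambda>h. h *\<^sub>R v)) (at 0)"
        by (auto intro!: derivative_eq_intros)
      from has_derivative_compose[OF this, of G "G' z"] der[of z]
      show ?thesis
        using has_derivative_linear[OF der, of z] by (simp add: linear_scale has_vector_derivative_def)
    qed
    then have "((\<lambda>h. norm (G (z + h *\<^sub>R v) - G z - h *\<^sub>R G' z v) / norm h) \<longlongrightarrow> 0) (at 0)"
      by (simp add: has_vector_derivative_def has_derivative_at)
    moreover have "filterlim t (at 0) sequentially"
      unfolding filterlim_at t_def using LIMSEQ_inverse_real_of_nat
      by (auto simp: inverse_eq_divide add.commute intro!: always_eventually)
    ultimately have "(\<lambda>m. norm (G (z + t m *\<^sub>R v) - G z - t m *\<^sub>R G' z v) / norm (t m)) \<longlonglongrightarrow> 0"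
      by (rule filterlim_compose)
    moreover have "norm (G (z + t m *\<^sub>R v) - G z - t m *\<^sub>R G' z v) / norm (t m) = norm (Q m z - G' z v)" for m
    proof -
      have "Q m z - G' z v = (1 / t m) *\<^sub>R (G (z + t m *\<^sub>R v) - G z - t m *\<^sub>R G' z v)"
        using t[of m] by (simp add: Q_def add.commute scaleR_diff_right)
      then show ?thesis
        using t[of m] by (simp add: divide_inverse mult.commute)
    qed
    ultimately show ?thesis
      by (simp add: tendsto_norm_zero_iff LIM_zero_iff)
  qed
  obtain B1 where B1: "\<And>z. norm (G z) \<le> B1"
    using bounded_of_compact_support[OF contG supp] by metis
  have int: "integrable lborel G"
    by (rule integrable_bounded_support(1)[OF _ B1 supp]) simp_all
  have "integral\<^sup>L lborel (Q m) = 0" for m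
  proof -
    have "integrable (distr lborel borel ((+) (t m *\<^sub>R v))) G"
      using int by (simp add: lborel_distr_plus)
    then have "integrable lborel (\<lambda>z. G (t m *\<^sub>R v + z))"
      by (subst (asm) integrable_distr_eq) auto
    then have "integral\<^sup>L lborel (Q m) = (1 / t m) *\<^sub>R (integral\<^sup>L lborel (\<lambda>z. G (t m *\<^sub>R v + z)) - integral\<^sup>L lborel G)"
      unfolding Q_def using int by simp
    then show ?thesis
      by (simp add: lborel_integral_translate)
  qed
  moreover have "(\<lambda>m. integral\<^sup>L lborel (Q m)) \<longlonglongrightarrow> integral\<^sup>L lborel (\<lambda>z. G' z v)"
  proof (rule integral_dominated_convergence)
    show "integrable lborel (\<lambda>x::'a. indicator (cball 0 (r + norm v)) x *\<^sub>R B0)"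
      by (intro integrable_scaleR_left integrable_real_indicator) (auto simp: emeasure_lborel_cball_finite[simplified])
    show "Q m \<in> borel_measurable lborel" for m
      unfolding Q_def by measurable
  qed (use lim bound in auto)
  ultimately show ?thesis
    by (simp add: LIMSEQ_const_iff)
qed

text \<open>Dyadic decomposition: at radius about \<open>2^k\<close> the function is of size
  \<open>4^(- k * (n + 1))\<close>, while the ball has volume proportional to
  \<open>4^(k * n)\<close>, so the sum is geometric.\<close>

lemma integrable_bm_profile:
  fixes n :: nat
  assumes "DIM('a::euclidean_space) = 2 * n"
  shows "integrable lborel (\<lambda>u::'a. inverse ((norm u)\<^sup>2 + 1) ^ Suc n)"
proof -
  let ?P = "\<lambda>u::'a. inverse ((norm u)\<^sup>2 + 1) ^ Suc n"
  let ?f = "\<lambda>k u::'a. ennreal (4 ^ Suc n * (1/4) ^ (k * Suc n)) * indicator (ball 0 (2 ^ k)) u"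
  let ?V = "measure lborel (ball (0::'a) 1)"
  have le: "ennreal (norm (?P u)) \<le> (\<Sum>k. ?f k u)" for u
  proof -
    obtain k0 where k0: "norm u < 2 ^ k0"
      using real_arch_pow[of 2 "norm u"] by auto
    define k where "k = (LEAST k. norm u < 2 ^ k)"
    have k: "norm u < 2 ^ k"
      unfolding k_def using k0 by (rule LeastI)
    have "4 ^ k \<le> 4 * ((norm u)\<^sup>2 + 1)"
    proof (cases k)
      case (Suc l)
      then have "\<not> norm u < 2 ^ l"
        using not_less_Least[of l "\<lambda>k. norm u < 2 ^ k"] by (simp add: k_def)
      then have "(2 ^ l)\<^sup>2 \<le> (norm u)\<^sup>2"
        by (intro power_mono) auto
      moreover have "(2 ^ l)\<^sup>2 = (4::real) ^ l"
        by (simp add: power_mult[symmetric] power2_eq_square flip: power_mult_distrib)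
      ultimately show ?thesis
        using Suc by simp
    qed simp
    then have "inverse ((norm u)\<^sup>2 + 1) \<le> 4 * (1/4) ^ k"
      by (simp add: field_simps add_pos_nonneg add_nonneg_pos power_one_over)
    then have "?P u \<le> (4 * (1/4) ^ k) ^ Suc n"
      by (intro power_mono) auto
    also have "\<dots> = 4 ^ Suc n * (1/4) ^ (k * Suc n)"
      by (simp only: power_mult_distrib power_mult)
    finally have "ennreal (norm (?P u)) \<le> ?f k u"
      using k by (simp add: ennreal_leI)
    also have "\<dots> \<le> (\<Sum>k. ?f k u)"
    proof -
      have "g k \<le> (\<Sum>k. g k)" for g :: "nat \<Rightarrow> ennreal"
        using sum_le_suminf[of g "{k}"] by simp
      then show ?thesis .
    qed
    finally show ?thesis .
  qed
  have "(\<integral>\<^sup>+u. ennreal (norm (?P u)) \<partial>lborel) \<le> (\<integral>\<^sup>+u. (\<Sum>k. ?f k u) \<partial>lborel)"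
    using le by (intro nn_integral_mono)
  also have "\<dots> = (\<Sum>k. \<integral>\<^sup>+u. ?f k u \<partial>lborel)"
    by (rule nn_integral_suminf, intro borel_measurable_times_ennreal borel_measurable_const borel_measurable_indicator) simp
  also have "\<dots> = (\<Sum>k. ennreal ((4 ^ Suc n * ?V) * (1/4) ^ k))"
  proof (rule suminf_cong)
    fix k
    have "(\<integral>\<^sup>+u. ?f k u \<partial>lborel) = ennreal (4 ^ Suc n * (1/4) ^ (k * Suc n)) * emeasure lborel (ball (0::'a) (2 ^ k))"
      by (simp add: nn_integral_cmult_indicator)
    also have "emeasure lborel (ball (0::'a) (2 ^ k)) = ennreal ((2 ^ k) ^ DIM('a) * ?V)"
      using emeasure_lborel_ball_finite[of "0::'a" "2 ^ k"] content_ball_conv_unit_ball[of "2 ^ k" "0::'a"]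
      by (subst emeasure_eq_ennreal_measure) auto
    also have "ennreal (4 ^ Suc n * (1/4) ^ (k * Suc n)) * \<dots> = ennreal ((4 ^ Suc n * (1/4) ^ (k * Suc n)) * ((2 ^ k) ^ DIM('a) * ?V))"
      by (rule ennreal_mult[symmetric]) auto
    also have "(4 ^ Suc n * (1/4) ^ (k * Suc n)) * ((2 ^ k) ^ DIM('a) * ?V) = (4 ^ Suc n * ?V) * (1/4) ^ k"
    proof -
      have "((2::real) ^ k)\<^sup>2 = 4 ^ k"
        by (simp add: power2_eq_square flip: power_mult_distrib)
      then have "(2 ^ k) ^ DIM('a) = (4::real) ^ (k * n)"
        unfolding assms power_mult by simp
      then show ?thesis
        by (simp add: power_add power_one_over field_simps)
    qed
    finally show "(\<integral>\<^sup>+u. ?f k u \<partial>lborel) = ennreal ((4 ^ Suc n * ?V) * (1/4) ^ k)" .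
  qed
  also have "\<dots> < \<infinity>"
  proof -
    have "summable (\<lambda>k. (4 ^ Suc n * ?V) * (1/4::real) ^ k)"
      by (intro summable_mult summable_geometric) auto
    then have "(\<Sum>k. ennreal ((4 ^ Suc n * ?V) * (1/4) ^ k)) = ennreal (\<Sum>k. (4 ^ Suc n * ?V) * (1/4) ^ k)"
      by (intro suminf_ennreal2) auto
    then show ?thesis
      by simp
  qed
  finally show ?thesis
    by (intro integrableI_bounded) auto
qed

text \<open>
  For \<open>\<epsilon> = 0\<close> this is, up to a constant, the Bochner--Martinelli kernel (with value \<open>0\<close> at the singularity).
  For \<open>\<epsilon> \<noteq> 0\<close> its divergence is \<open>n \<epsilon>\<^sup>2 / (\<bar>u\<bar>\<^sup>2 + \<epsilon>\<^sup>2)\<^sup>n\<^sup>+\<^sup>1\<close>, an approximate identity.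
\<close>

definition bm_kernel :: "real \<Rightarrow> 'n::finite \<Rightarrow> complex^'n \<Rightarrow> complex" where
  "bm_kernel \<epsilon> j u = cnj (u $ j) * of_real (inverse ((norm u)\<^sup>2 + \<epsilon>\<^sup>2) ^ CARD('n))"

definition bm_kernel' :: "real \<Rightarrow> 'n::finite \<Rightarrow> complex^'n \<Rightarrow> complex^'n \<Rightarrow> complex" where
  "bm_kernel' \<epsilon> j u h = cnj (u $ j) * of_real (- (2 * real CARD('n) * (u \<bullet> h)) * inverse ((norm u)\<^sup>2 + \<epsilon>\<^sup>2) ^ Suc CARD('n))
     + cnj (h $ j) * of_real (inverse ((norm u)\<^sup>2 + \<epsilon>\<^sup>2) ^ CARD('n))"

lemma norm_sq_inverse_power_derivative:
  fixes u :: "'a::real_inner"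
  assumes "(norm u)\<^sup>2 + c \<noteq> 0"
  shows "((\<lambda>u. inverse ((norm u)\<^sup>2 + c) ^ n) has_derivative
     (\<lambda>h. - (2 * real n * (u \<bullet> h)) * inverse ((norm u)\<^sup>2 + c) ^ Suc n)) (at u)"
proof -
  have "((\<lambda>u. (norm u)\<^sup>2 + c) has_derivative (\<lambda>h. 2 * (u \<bullet> h))) (at u)"
    unfolding power2_norm_eq_inner by (auto intro!: derivative_eq_intros simp: inner_commute)
  moreover have "((\<lambda>s. inverse s ^ n) has_real_derivative - (real n * inverse ((norm u)\<^sup>2 + c) ^ Suc n)) (at ((norm u)\<^sup>2 + c))"
  proof (cases n)
    case (Suc l)
    then show ?thesis
      using DERIV_power[OF DERIV_inverse[OF assms], of n] by (simp add: power2_eq_square mult_ac)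
  qed simp
  ultimately have "((\<lambda>u. inverse ((norm u)\<^sup>2 + c) ^ n) has_derivative
     (\<lambda>h. - (real n * inverse ((norm u)\<^sup>2 + c) ^ Suc n) * (2 * (u \<bullet> h)))) (at u)"
    using has_derivative_compose[of "\<lambda>u. (norm u)\<^sup>2 + c" "\<lambda>h. 2 * (u \<bullet> h)" u UNIV] unfolding has_field_derivative_def by blast
  then show ?thesis
    by (simp add: mult_ac)
qed

lemma bm_kernel_has_derivative:
  assumes "\<epsilon> \<noteq> 0"
  shows "(bm_kernel \<epsilon> j has_derivative bm_kernel' \<epsilon> j u) (at u)"
proof -
  have "(norm u)\<^sup>2 + \<epsilon>\<^sup>2 \<noteq> 0"
    using assms by (simp add: add_nonneg_eq_0_iff)
  note d = norm_sq_inverse_power_derivative[OF this, of "CARD('a)"]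
  have "((\<lambda>u. cnj (u $ j)) has_derivative (\<lambda>h. cnj (h $ j))) (at u)"
    by (intro bounded_linear_imp_has_derivative bounded_linear_compose[OF bounded_linear_cnj bounded_linear_vec_nth])
  from has_derivative_mult[OF this bounded_linear.has_derivative[OF bounded_linear_of_real d]]
  show ?thesis
    unfolding bm_kernel_def[abs_def] bm_kernel'_def[abs_def] by simp
qed

text \<open>The directions \<open>1\<close> and \<open>\<i>\<close> combine to twice the derivative
  in the conjugate variable. Summing the squares of the components gives
  \<open>(norm u)\<^sup>2\<close>, which cancels the main term up to
  \<open>\<epsilon>\<^sup>2\<close>.\<close>

lemma bm_kernel'_sum:
  fixes u :: "complex^'n::finite"
  assumes "\<epsilon> \<noteq> 0"
  shows "(\<Sum>j\<in>UNIV. bm_kernel' \<epsilon> j u (axis j 1) + \<i> * bm_kernel' \<epsilon> j u (axis j \<i>))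
    = of_real (2 * (real CARD('n) * \<epsilon>\<^sup>2 * inverse ((norm u)\<^sup>2 + \<epsilon>\<^sup>2) ^ Suc CARD('n)))"
proof -
  let ?n = "real CARD('n)" and ?s = "(norm u)\<^sup>2 + \<epsilon>\<^sup>2"
  have s: "?s \<noteq> 0"
    using assms by (simp add: add_nonneg_eq_0_iff)
  have "bm_kernel' \<epsilon> j u (axis j 1) + \<i> * bm_kernel' \<epsilon> j u (axis j \<i>)
      = of_real (2 * inverse ?s ^ CARD('n) - 2 * ?n * (norm (u $ j))\<^sup>2 * inverse ?s ^ Suc CARD('n))" for j
  proof -
    have i: "u \<bullet> axis j 1 = Re (u $ j)" "u \<bullet> axis j \<i> = Im (u $ j)"
      by (simp_all add: inner_axis inner_complex_def)
    have "cnj (u $ j) * of_real (Re (u $ j)) + \<i> * (cnj (u $ j) * of_real (Im (u $ j))) = cnj (u $ j) * (u $ j)"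
      by (subst (4) complex_eq) (simp add: algebra_simps)
    also have "\<dots> = of_real ((norm (u $ j))\<^sup>2)"
      by (metis complex_norm_square mult.commute)
    finally have c: "cnj (u $ j) * of_real (Re (u $ j)) + \<i> * (cnj (u $ j) * of_real (Im (u $ j))) = of_real ((norm (u $ j))\<^sup>2)" .
    have "bm_kernel' \<epsilon> j u (axis j 1) + \<i> * bm_kernel' \<epsilon> j u (axis j \<i>) =
       - (2 * of_real ?n * of_real (inverse ?s ^ Suc CARD('n))) * (cnj (u $ j) * of_real (Re (u $ j)) + \<i> * (cnj (u $ j) * of_real (Im (u $ j))))
       + 2 * of_real (inverse ?s ^ CARD('n))"
      unfolding bm_kernel'_def i by (simp add: algebra_simps del: power_Suc)
    then show ?thesis
      unfolding c by (simp del: power_Suc)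
  qed
  then have "(\<Sum>j\<in>UNIV. bm_kernel' \<epsilon> j u (axis j 1) + \<i> * bm_kernel' \<epsilon> j u (axis j \<i>))
     = of_real (\<Sum>j::'n\<in>UNIV. 2 * inverse ?s ^ CARD('n) - 2 * ?n * (norm (u $ j))\<^sup>2 * inverse ?s ^ Suc CARD('n))"
    by (simp del: power_Suc)
  also have "(\<Sum>j::'n\<in>UNIV. 2 * inverse ?s ^ CARD('n) - 2 * ?n * (norm (u $ j))\<^sup>2 * inverse ?s ^ Suc CARD('n))
     = ?n * (2 * inverse ?s ^ CARD('n)) - 2 * ?n * (norm u)\<^sup>2 * inverse ?s ^ Suc CARD('n)"
    by (simp add: sum_subtractf norm_vec_def L2_set_def sum_nonneg flip: sum_distrib_left sum_distrib_right)
  also have "inverse ?s ^ CARD('n) = ?s * inverse ?s ^ Suc CARD('n)"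
    using s by simp
  finally show ?thesis
    by (simp add: algebra_simps del: power_Suc)
qed

lemma continuous_bm_kernel: "\<epsilon> \<noteq> 0 \<Longrightarrow> continuous_on S (bm_kernel \<epsilon> j)"
  using bm_kernel_has_derivative by (rule has_derivative_imp_continuous_on)

text \<open>The conjugate derivatives of \<open>F\<close> times the kernel have integral 0, and the
  product rule separates the two sides. With \<open>\<epsilon> \<noteq> 0\<close> there is no
  singularity to cut out.\<close>

lemma bochner_martinelli_regularised:
  fixes F :: "complex^'n::finite \<Rightarrow> complex"
  assumes "C1c F" "\<epsilon> \<noteq> 0"
  shows "integral\<^sup>L lborel (\<lambda>w. \<Sum>j\<in>UNIV. dbar F w $ j * bm_kernel \<epsilon> j (w - p))
     = - integral\<^sup>L lborel (\<lambda>w. F w * of_real (real CARD('n) * \<epsilon>\<^sup>2 * inverse ((norm (w - p))\<^sup>2 + \<epsilon>\<^sup>2) ^ Suc CARD('n)))"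
proof -
  obtain F' r where F': "\<And>z. (F has_derivative blinfun_apply (F' z)) (at z)" "continuous_on UNIV F'" "r > 0"
    "\<And>z. norm z > r \<Longrightarrow> F z = 0" "\<And>z. norm z > r \<Longrightarrow> F' z = 0"
    "\<And>z j. dbar F z $ j = (F' z (axis j 1) + \<i> * F' z (axis j \<i>)) / 2"
    using C1cE[OF assms(1)] by metis
  have contF: "continuous_on UNIV F"
    using F'(1) by (rule has_derivative_imp_continuous_on)
  have contF': "continuous_on UNIV (\<lambda>z. F' z v)" for v
    using F'(2) by (intro continuous_intros)
  define H where "H j z h = F z * bm_kernel' \<epsilon> j (z - p) h + F' z h * bm_kernel \<epsilon> j (z - p)" for j z h
  have Hder: "((\<lambda>z. F z * bm_kernel \<epsilon> j (z - p)) has_derivative H j z) (at z)" for j z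
  proof -
    have "((\<lambda>z. z - p) has_derivative (\<lambda>h. h)) (at z)"
      by (auto intro!: derivative_eq_intros)
    from has_derivative_compose[OF this bm_kernel_has_derivative[OF assms(2)]]
    show ?thesis
      unfolding H_def[abs_def] by (intro has_derivative_mult F'(1))
  qed
  have contK': "continuous_on UNIV (\<lambda>z. bm_kernel' \<epsilon> j (z - p) h)" for j h
    unfolding bm_kernel'_def using assms(2) by (intro continuous_intros) (auto simp: add_nonneg_eq_0_iff)
  have contK: "continuous_on UNIV (\<lambda>z. bm_kernel \<epsilon> j (z - p))" for j
    using continuous_bm_kernel[OF assms(2)] by (rule continuous_on_compose2) (auto intro!: continuous_intros)
  have Hcont: "continuous_on UNIV (\<lambda>z. H j z h)" for j h
    unfolding H_def by (intro continuous_intros contF contF' contK contK')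
  have Hint: "integral\<^sup>L lborel (\<lambda>z. H j z h) = 0" for j h
    by (rule integral_directional_derivative_eq_0[OF Hder Hcont, where r = r]) (use F'(4) in simp)
  have Hsupp: "H j z h = 0" if "norm z > r" for j z h
    using F'(4,5)[OF that] by (simp add: H_def)
  have integrable: "integrable lborel f" if "continuous_on UNIV f" "\<And>z. norm z > r \<Longrightarrow> f z = 0" for f :: "complex^'n \<Rightarrow> complex"
  proof -
    note support = bounded_of_compact_support[OF that]
    obtain B1 where "\<And>z. norm (f z) \<le> B1"
      using support by metis
    then show ?thesis
      using that by (intro integrable_bounded_support(1)[of f B1 r] borel_measurable_continuous_onI)
  qed
  have iH: "integrable lborel (\<lambda>z. H j z h)" for j h
    using Hcont Hsupp by (rule integrable)
  let ?A = "\<lambda>w. \<Sum>j\<in>UNIV. dbar F w $ j * bm_kernel \<epsilon> j (w - p)"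
  let ?P = "\<lambda>w. real CARD('n) * \<epsilon>\<^sup>2 * inverse ((norm (w - p))\<^sup>2 + \<epsilon>\<^sup>2) ^ Suc CARD('n)"
  have eq: "(\<Sum>j\<in>UNIV. H j w (axis j 1) + \<i> * H j w (axis j \<i>)) = 2 * ?A w + 2 * (F w * of_real (?P w))" for w
  proof -
    have "(\<Sum>j\<in>UNIV. H j w (axis j 1) + \<i> * H j w (axis j \<i>)) =
       (\<Sum>j\<in>UNIV. F w * (bm_kernel' \<epsilon> j (w - p) (axis j 1) + \<i> * bm_kernel' \<epsilon> j (w - p) (axis j \<i>)) + 2 * (dbar F w $ j * bm_kernel \<epsilon> j (w - p)))"
      unfolding F'(6) H_def by (intro sum.cong refl) (simp add: algebra_simps)
    also have "\<dots> = F w * (\<Sum>j\<in>UNIV. bm_kernel' \<epsilon> j (w - p) (axis j 1) + \<i> * bm_kernel' \<epsilon> j (w - p) (axis j \<i>)) + 2 * ?A w"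
    proof -
      have "(\<Sum>j\<in>UNIV. c * X j + 2 * Y j) = c * (\<Sum>j\<in>UNIV. X j) + 2 * (\<Sum>j\<in>UNIV. Y j)"
        for c :: complex and X Y :: "'n \<Rightarrow> complex"
        by (simp add: sum.distrib sum_distrib_left)
      then show ?thesis .
    qed
    also have "\<dots> = F w * of_real (2 * ?P w) + 2 * ?A w"
      by (simp only: bm_kernel'_sum[OF assms(2)])
    finally show ?thesis
      by simp
  qed
  have "integral\<^sup>L lborel (\<lambda>w. \<Sum>j\<in>UNIV. H j w (axis j 1) + \<i> * H j w (axis j \<i>)) = 0"
    using iH Hint by simp
  then have "integral\<^sup>L lborel (\<lambda>w. 2 * ?A w + 2 * (F w * of_real (?P w))) = 0"
    unfolding eq .
  moreover have "integrable lborel ?A"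
  proof (rule integrable)
    show "continuous_on UNIV ?A"
      using continuous_dbar[OF assms(1)] by (intro continuous_intros contK) auto
    show "?A z = 0" if "norm z > r" for z
      using F'(5)[OF that] by (simp add: F'(6))
  qed
  moreover have "integrable lborel (\<lambda>w. F w * of_real (?P w))"
  proof (rule integrable)
    show "continuous_on UNIV (\<lambda>w. F w * of_real (?P w))"
      using assms(2) by (intro continuous_intros contF) (auto simp: add_nonneg_eq_0_iff)
  qed (use F'(4) in simp)
  ultimately have "2 * integral\<^sup>L lborel ?A + 2 * integral\<^sup>L lborel (\<lambda>w. F w * of_real (?P w)) = 0"
    by simp
  then have "2 * (integral\<^sup>L lborel ?A + integral\<^sup>L lborel (\<lambda>w. F w * of_real (?P w))) = 0"
    by (simp only: distrib_left)
  then show ?thesis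
    by (simp only: mult_eq_0_iff) (simp add: eq_neg_iff_add_eq_0)
qed

text \<open>Total mass of the approximate identity. It is divided by later, so what has to be known
  about it is that it is positive.\<close>

definition bm_const :: "'n::finite itself \<Rightarrow> real" where
  "bm_const _ = integral\<^sup>L lborel (\<lambda>u::complex^'n. real CARD('n) * inverse ((norm u)\<^sup>2 + 1) ^ Suc CARD('n))"

lemma integrable_bm_profile_vec:
  "integrable lborel (\<lambda>u::complex^'n::finite. real CARD('n) * inverse ((norm u)\<^sup>2 + 1) ^ Suc CARD('n))"
  by (intro integrable_mult_right integrable_bm_profile) simp

lemma bm_const_pos: "bm_const TYPE('n::finite) > 0"
proof -
  let ?P = "\<lambda>u::complex^'n. real CARD('n) * inverse ((norm u)\<^sup>2 + 1) ^ Suc CARD('n)"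
  let ?c = "real CARD('n) * (1/2) ^ Suc CARD('n)"
  have "0 < ?c * measure lborel (cball (0::complex^'n) 1)"
    using content_cball_pos[of 1 "0::complex^'n"] by simp
  also have "\<dots> = integral\<^sup>L lborel (\<lambda>u. indicator (cball (0::complex^'n) 1) u *\<^sub>R ?c)"
    by simp
  also have "\<dots> \<le> integral\<^sup>L lborel ?P"
  proof (rule integral_mono)
    show "integrable lborel (\<lambda>u. indicator (cball (0::complex^'n) 1) u *\<^sub>R ?c)"
      by (intro integrable_scaleR_left integrable_real_indicator) (auto simp: emeasure_lborel_cball_finite[simplified])
    fix u :: "complex^'n"
    show "indicator (cball 0 1) u *\<^sub>R ?c \<le> ?P u"
    proof (cases "norm u \<le> 1")
      case True
      then have "(norm u)\<^sup>2 \<le> 1"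
        by (simp add: power_le_one)
      then have "1/2 \<le> inverse ((norm u)\<^sup>2 + 1)"
        by (simp add: field_simps add_pos_nonneg)
      then have "(1/2) ^ Suc CARD('n) \<le> inverse ((norm u)\<^sup>2 + 1) ^ Suc CARD('n)"
        by (intro power_mono) auto
      then show ?thesis
        using True by (simp del: power_Suc)
    qed (simp add: zero_le_mult_iff)
  qed (rule integrable_bm_profile_vec)
  finally show ?thesis
    by (simp add: bm_const_def)
qed

text \<open>The substitution \<open>w = p + \<epsilon> *\<^sub>R u\<close> makes the profile
  independent of \<open>\<epsilon>\<close>: the exponents \<open>2 * CARD('n)\<close>,
  \<open>2\<close> and \<open>- 2 * (CARD('n) + 1)\<close> of \<open>\<epsilon>\<close> add up to 0.
  Then continuity at \<open>p\<close> and domination give the limit.\<close>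

lemma bm_mollifier_limit:
  fixes F :: "complex^'n::finite \<Rightarrow> complex"
  assumes cont: "continuous_on UNIV F" and bd: "\<And>z. norm (F z) \<le> B"
  shows "(\<lambda>m. integral\<^sup>L lborel (\<lambda>w. F w * of_real (real CARD('n) * (1 / real (Suc m))\<^sup>2
     * inverse ((norm (w - p))\<^sup>2 + (1 / real (Suc m))\<^sup>2) ^ Suc CARD('n)))) \<longlonglongrightarrow> of_real (bm_const TYPE('n)) * F p"
proof -
  let ?n = "CARD('n)"
  let ?P = "\<lambda>u::complex^'n. real ?n * inverse ((norm u)\<^sup>2 + 1) ^ Suc ?n"
  have [measurable]: "F \<in> borel_measurable borel"
    using cont by (rule borel_measurable_continuous_onI)
  have scaled: "integral\<^sup>L lborel (\<lambda>w. F w * of_real (real ?n * \<epsilon>\<^sup>2 * inverse ((norm (w - p))\<^sup>2 + \<epsilon>\<^sup>2) ^ Suc ?n))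
     = integral\<^sup>L lborel (\<lambda>u. F (p + \<epsilon> *\<^sub>R u) * of_real (?P u))" if "\<epsilon> > 0" for \<epsilon> :: real
  proof -
    have "(\<bar>\<epsilon>\<bar> ^ DIM(complex^'n)) *\<^sub>R (F (p + \<epsilon> *\<^sub>R u) * of_real (real ?n * \<epsilon>\<^sup>2 * inverse ((norm (p + \<epsilon> *\<^sub>R u - p))\<^sup>2 + \<epsilon>\<^sup>2) ^ Suc ?n))
      = F (p + \<epsilon> *\<^sub>R u) * of_real (?P u)" for u
    proof -
      have "inverse ((norm (p + \<epsilon> *\<^sub>R u - p))\<^sup>2 + \<epsilon>\<^sup>2) = inverse (\<epsilon>\<^sup>2) * inverse ((norm u)\<^sup>2 + 1)"
        by (simp add: power_mult_distrib distrib_left[of "\<epsilon>\<^sup>2" "(norm u)\<^sup>2" 1, simplified, symmetric] flip: inverse_mult_distrib)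
      then have "\<bar>\<epsilon>\<bar> ^ DIM(complex^'n) * (real ?n * \<epsilon>\<^sup>2 * inverse ((norm (p + \<epsilon> *\<^sub>R u - p))\<^sup>2 + \<epsilon>\<^sup>2) ^ Suc ?n)
         = (\<epsilon> ^ (2 * ?n) * \<epsilon>\<^sup>2 * inverse (\<epsilon>\<^sup>2) ^ Suc ?n) * ?P u"
        using that by (simp only: power_mult_distrib) (simp add: mult_ac)
      also have "\<epsilon> ^ (2 * ?n) * \<epsilon>\<^sup>2 * inverse (\<epsilon>\<^sup>2) ^ Suc ?n = 1"
        using that power_mult[of \<epsilon> 2 ?n] by (simp add: power_inverse field_simps)
      finally have eq: "\<bar>\<epsilon>\<bar> ^ DIM(complex^'n) * (real ?n * \<epsilon>\<^sup>2 * inverse ((norm (p + \<epsilon> *\<^sub>R u - p))\<^sup>2 + \<epsilon>\<^sup>2) ^ Suc ?n) = 1 * ?P u" .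
      have "a *\<^sub>R (f * of_real x) = f * of_real y" if "a * x = 1 * y" for a x y and f :: complex
        using that by (simp add: scaleR_conv_of_real mult_ac flip: of_real_mult)
      from this[OF eq] show ?thesis .
    qed
    then show ?thesis
      using that by (subst lborel_integral_scale[where c = \<epsilon> and t = p]) (simp_all del: DIM_cart power_Suc)
  qed
  have "(\<lambda>m. integral\<^sup>L lborel (\<lambda>u. F (p + (1 / real (Suc m)) *\<^sub>R u) * of_real (?P u)))
     \<longlonglongrightarrow> integral\<^sup>L lborel (\<lambda>u. F p * of_real (?P u))"
  proof (rule integral_dominated_convergence)
    show "integrable lborel (\<lambda>u. B * ?P u)"
      by (intro integrable_mult_right integrable_bm_profile_vec)
    show "AE u in lborel. (\<lambda>m. F (p + (1 / real (Suc m)) *\<^sub>R u) * of_real (?P u)) \<longlonglongrightarrow> F p * of_real (?P u)"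
    proof (rule AE_I2)
      fix u :: "complex^'n"
      have "(\<lambda>m. p + (1 / real (Suc m)) *\<^sub>R u) \<longlonglongrightarrow> p + 0 *\<^sub>R u"
        using LIMSEQ_inverse_real_of_nat by (intro tendsto_intros) (simp add: inverse_eq_divide)
      then have "(\<lambda>m. F (p + (1 / real (Suc m)) *\<^sub>R u)) \<longlonglongrightarrow> F p"
        using cont by (intro isCont_tendsto_compose[where g = F and l = p]) (auto simp: continuous_on_eq_continuous_at)
      then show "(\<lambda>m. F (p + (1 / real (Suc m)) *\<^sub>R u) * of_real (?P u)) \<longlonglongrightarrow> F p * of_real (?P u)"
        by (intro tendsto_mult tendsto_const)
    qed
    show "AE u in lborel. norm (F (p + (1 / real (Suc m)) *\<^sub>R u) * of_real (?P u)) \<le> B * ?P u" for m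
    proof (rule AE_I2)
      fix u :: "complex^'n"
      have "?P u \<ge> 0"
        by (simp add: zero_le_mult_iff)
      then show "norm (F (p + (1 / real (Suc m)) *\<^sub>R u) * of_real (?P u)) \<le> B * ?P u"
        unfolding norm_mult norm_of_real abs_of_nonneg[OF \<open>?P u \<ge> 0\<close>] by (intro mult_right_mono bd)
    qed
  qed measurable
  also have "integral\<^sup>L lborel (\<lambda>u. F p * of_real (?P u)) = of_real (bm_const TYPE('n)) * F p"
    unfolding bm_const_def integral_mult_right_zero integral_complex_of_real by (rule mult.commute)
  finally show ?thesis
    using scaled[of "1 / real (Suc _)"] by (simp del: power_Suc of_nat_Suc)
qed

section \<open>Potentials of flat densities\<close>

text \<open>
  \<open>hpoly a B g\<close>: \<open>g\<close> is a real polynomial function, homogeneous of degree \<open>a\<close>, and \<open>B\<close> bounds the sum of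
  the absolute values of its coefficients. In \<open>kern k B g\<close> below, \<open>g\<close> is homogeneous of degree \<open>1 - 2n - k\<close>.
\<close>

inductive hpoly :: "nat \<Rightarrow> real \<Rightarrow> (complex^'n::finite \<Rightarrow> complex) \<Rightarrow> bool" where
  const: "norm c \<le> B \<Longrightarrow> hpoly 0 B (\<lambda>u. c)"
| mult: "hpoly a B g \<Longrightarrow> bounded_linear l \<Longrightarrow> (\<And>u. norm (l u) \<le> norm u) \<Longrightarrow> hpoly (Suc a) B (\<lambda>u. l u * g u)"
| add: "hpoly a B1 g1 \<Longrightarrow> hpoly a B2 g2 \<Longrightarrow> hpoly a (B1 + B2) (\<lambda>u. g1 u + g2 u)"

lemma hpoly_bound:
  assumes "hpoly a B g"
  shows "norm (g u) \<le> B * norm u ^ a"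
  using assms
proof induction
  case (mult a B g l)
  have "norm (l u * g u) \<le> norm u * (B * norm u ^ a)"
    unfolding norm_mult using mult by (intro mult_mono) auto
  then show ?case
    by (simp add: mult_ac)
next
  case (add a B1 g1 B2 g2)
  then show ?case
    using norm_triangle_ineq[of "g1 u" "g2 u"] by (simp add: distrib_right)
qed simp

lemma hpoly_nonneg: "hpoly a B g \<Longrightarrow> B \<ge> 0"
proof (induction rule: hpoly.induct)
  case (const c B)
  then show ?case
    using norm_ge_zero[of c] by linarith
qed auto

lemma hpoly_scale: "hpoly a B g \<Longrightarrow> hpoly a (norm c * B) (\<lambda>u. c * g u)"
proof (induction rule: hpoly.induct)
  case (const d B)
  then show ?case
    by (intro hpoly.const) (simp add: norm_mult mult_left_mono)
next
  case (mult a B g l)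
  from hpoly.mult[OF mult.IH mult.hyps(2,3)] show ?case
    by (simp add: mult.left_commute)
next
  case (add a B1 g1 B2 g2)
  from hpoly.add[OF add.IH] show ?case
    by (simp add: distrib_left)
qed

lemma hpoly_weaken: "hpoly a B g \<Longrightarrow> B \<le> B' \<Longrightarrow> hpoly a B' g"
proof (induction arbitrary: B' rule: hpoly.induct)
  case (const c B)
  then show ?case
    by (intro hpoly.const) simp
next
  case (mult a B g l)
  then show ?case
    by (intro hpoly.mult) auto
next
  case (add a B1 g1 B2 g2)
  have "hpoly a (B1 + (B' - B1)) (\<lambda>u. g1 u + g2 u)"
    using add by (intro hpoly.add) auto
  then show ?case
    by simp
qed

lemma hpoly_differentiable: "hpoly a B g \<Longrightarrow> g differentiable (at u)"
proof (induction rule: hpoly.induct)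
  case (mult a B g l)
  then show ?case
    by (intro differentiable_mult) (auto intro: bounded_linear_imp_differentiable)
qed auto

lemma frechet_derivative_plus:
  assumes "f differentiable (at x)" "g differentiable (at x)"
  shows "frechet_derivative (\<lambda>u. f u + g u) (at x) v = frechet_derivative f (at x) v + frechet_derivative g (at x) v"
  using fun_cong[OF frechet_derivative_at[OF has_derivative_add[OF assms[THEN frechet_derivative_works[THEN iffD1]]]], of v]
  by simp

text \<open>Each of the \<open>a\<close> linear factors is differentiated once, which gives the
  factor \<open>a\<close>. Degree 0 is separate since its derivative vanishes and has no degree
  \<open>a - 1\<close>.\<close>

lemma hpoly_deriv:
  assumes "hpoly a B g" "norm v \<le> 1"
  shows "\<exists>g'. (if a = 0 then g' = (\<lambda>u. 0) else hpoly (a - 1) (real a * B) g') \<and>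
    (\<forall>u. frechet_derivative g (at u) v = g' u)"
  using assms(1)
proof induction
  case (const c B)
  then show ?case
    by (simp add: frechet_derivative_const)
next
  case (mult a B g l)
  obtain g' where g': "if a = 0 then g' = (\<lambda>u. 0) else hpoly (a - 1) (real a * B) g'"
    "\<And>u. frechet_derivative g (at u) v = g' u"
    using mult.IH by blast
  have der: "frechet_derivative (\<lambda>u. l u * g u) (at u) v = l v * g u + l u * g' u" for u
  proof -
    have "(l has_derivative l) (at u)"
      using mult.hyps(2) by (rule bounded_linear_imp_has_derivative)
    moreover have "(g has_derivative frechet_derivative g (at u)) (at u)"
      using hpoly_differentiable[OF mult.hyps(1)] frechet_derivative_works by blast
    ultimately have "((\<lambda>u. l u * g u) has_derivative (\<lambda>h. l u * frechet_derivative g (at u) h + l h * g u)) (at u)"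
      by (rule has_derivative_mult)
    from fun_cong[OF frechet_derivative_at[OF this], of v] show ?thesis
      using g'(2)[of u] by (simp add: add.commute)
  qed
  have B: "B \<ge> 0"
    using mult.hyps(1) by (rule hpoly_nonneg)
  have lv: "norm (l v) \<le> 1"
    using mult.hyps(3)[of v] assms(2) by simp
  have 1: "hpoly a B (\<lambda>u. l v * g u)"
    using hpoly_weaken[OF hpoly_scale[OF mult.hyps(1)], of "l v" B] lv B by (simp add: mult_left_le_one_le)
  have "hpoly a (real (Suc a) * B) (\<lambda>u. l v * g u + l u * g' u)"
  proof (cases "a = 0")
    case True
    then show ?thesis
      using 1 g' by simp
  next
    case False
    then have "hpoly (Suc (a - 1)) (real a * B) (\<lambda>u. l u * g' u)"
      using g'(1) mult.hyps by (intro hpoly.mult) auto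
    from hpoly.add[OF 1, of "real a * B" "\<lambda>u. l u * g' u"] this False show ?thesis
      by (simp add: algebra_simps)
  qed
  then show ?case
    using der by (intro exI[of _ "\<lambda>u. l v * g u + l u * g' u"]) simp
next
  case (add a B1 g1 B2 g2)
  then obtain g1' g2' where g: "if a = 0 then g1' = (\<lambda>u. 0) else hpoly (a - 1) (real a * B1) g1'"
    "\<And>u. frechet_derivative g1 (at u) v = g1' u"
    "if a = 0 then g2' = (\<lambda>u. 0) else hpoly (a - 1) (real a * B2) g2'"
    "\<And>u. frechet_derivative g2 (at u) v = g2' u"
    by blast
  have "frechet_derivative (\<lambda>u. g1 u + g2 u) (at u) v = g1' u + g2' u" for u
    using frechet_derivative_plus[OF hpoly_differentiable[OF add.hyps(1)] hpoly_differentiable[OF add.hyps(2)]] g(2,4) by simp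
  then show ?case
    using g(1,3) by (intro exI[of _ "\<lambda>u. g1' u + g2' u"]) (auto simp: distrib_left intro: hpoly.add split: if_splits)
qed

inductive kern :: "nat \<Rightarrow> real \<Rightarrow> (complex^'n::finite \<Rightarrow> complex) \<Rightarrow> bool" where
  base: "hpoly a B p \<Longrightarrow> a \<le> Suc k \<Longrightarrow> 2 * m + 1 = 2 * CARD('n) + k + a \<Longrightarrow>
     kern k B (\<lambda>u::complex^'n. p u * of_real (inverse ((norm u)\<^sup>2) ^ m))"
| add: "kern k B1 g1 \<Longrightarrow> kern k B2 g2 \<Longrightarrow> kern k (B1 + B2) (\<lambda>u. g1 u + g2 u)"

lemma kern_bound:
  assumes "kern k B (g :: complex^'n::finite \<Rightarrow> complex)" "u \<noteq> 0"
  shows "norm (g u) * norm u ^ (2 * CARD('n) - 1 + k) \<le> B"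
  using assms(1)
proof induction
  case (base a B p k m)
  have e: "2 * m = 2 * CARD('n) - 1 + k + a"
    using base(3) zero_less_card_finite[where 'a = 'n] by linarith
  have "norm (p u * of_real (inverse ((norm u)\<^sup>2) ^ m)) * norm u ^ (2 * CARD('n) - 1 + k)
     = norm (p u) * inverse (norm u ^ (2 * m)) * norm u ^ (2 * CARD('n) - 1 + k)"
    by (simp add: norm_mult norm_power norm_inverse power_mult power_inverse)
  also have "\<dots> \<le> (B * norm u ^ a) * inverse (norm u ^ (2 * m)) * norm u ^ (2 * CARD('n) - 1 + k)"
    using hpoly_bound[OF base(1)] by (intro mult_right_mono) auto
  also have "\<dots> = B"
  proof -
    have "B * Q * inverse (P * Q) * P = B" if "P > 0" "Q > 0" for P Q :: real
      using that by (simp add: field_simps)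
    then show ?thesis
      using assms(2) unfolding e power_add[of _ "2 * CARD('n) - 1 + k" a] by simp
  qed
  finally show ?case .
next
  case (add k B1 g1 B2 g2)
  have "norm (g1 u + g2 u) * norm u ^ (2 * CARD('n) - 1 + k) \<le> (norm (g1 u) + norm (g2 u)) * norm u ^ (2 * CARD('n) - 1 + k)"
    by (intro mult_right_mono norm_triangle_ineq) auto
  with add show ?case
    by (simp add: distrib_right)
qed

lemma kern_differentiable: "kern k B g \<Longrightarrow> u \<noteq> 0 \<Longrightarrow> g differentiable (at u)"
proof (induction rule: kern.induct)
  case (base a B p k m)
  have "((\<lambda>u. inverse ((norm u)\<^sup>2 + 0) ^ m) has_derivative
     (\<lambda>h. - (2 * real m * (u \<bullet> h)) * inverse ((norm u)\<^sup>2 + 0) ^ Suc m)) (at u)"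
    using base by (intro norm_sq_inverse_power_derivative) simp
  from bounded_linear.has_derivative[OF bounded_linear_of_real[where 'a = complex] this]
  have "(\<lambda>u. complex_of_real (inverse ((norm u)\<^sup>2) ^ m)) differentiable (at u)"
    unfolding differentiable_def add_0_right by blast
  then show ?case
    using hpoly_differentiable[OF base(1)] by (intro differentiable_mult)
qed auto

lemma kern_measurable: "kern k B g \<Longrightarrow> g \<in> borel_measurable borel"
proof (induction rule: kern.induct)
  case (base a B p k m)
  have "continuous_on UNIV p"
    using hpoly_differentiable[OF base(1)]
    by (intro continuous_at_imp_continuous_on ballI differentiable_imp_continuous_within)
  then have [measurable]: "p \<in> borel_measurable borel"
    by (rule borel_measurable_continuous_onI)
  show ?case
    by measurable
qed measurable

lemma kern_weaken: "kern k B g \<Longrightarrow> B \<le> B' \<Longrightarrow> kern k B' g"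
proof (induction arbitrary: B' rule: kern.induct)
  case (base a B p k m)
  then show ?case
    by (intro kern.base[of a] hpoly_weaken[of a B p B'])
next
  case (add k B1 g1 B2 g2)
  have "kern k (B1 + (B' - B1)) (\<lambda>u. g1 u + g2 u)"
    using add by (intro kern.add) auto
  then show ?case
    by simp
qed

text \<open>A derivative lowers the degree \<open>a\<close> of the numerator, or raises it by one
  together with \<open>m\<close>. The invariants \<open>a \<le> Suc k\<close> and
  \<open>2 * m + 1 = 2 * CARD('n) + k + a\<close> persist and bound the factor
  \<open>a + 2 * m\<close> linearly in \<open>k\<close>; linear growth is what leads to
  \<open>fact k\<close> after \<open>k\<close> derivatives.\<close>

lemma kern_deriv:
  assumes "kern k B (g :: complex^'n::finite \<Rightarrow> complex)" "norm v \<le> 1"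
  shows "\<exists>g'. kern (Suc k) (real (3 * k + 2 * CARD('n) + 1) * B) g' \<and>
    (\<forall>u. u \<noteq> 0 \<longrightarrow> frechet_derivative g (at u) v = g' u)"
  using assms(1)
proof induction
  case (base a B p k m)
  obtain p' where p': "if a = 0 then p' = (\<lambda>u. 0) else hpoly (a - 1) (real a * B) p'"
    "\<And>u. frechet_derivative p (at u) v = p' u"
    using hpoly_deriv[OF base(1) assms(2)] by blast
  have B: "B \<ge> 0"
    using base(1) by (rule hpoly_nonneg)
  let ?q = "\<lambda>u::complex^'n. of_real (u \<bullet> v) * p u"
  have q: "hpoly (Suc a) B ?q"
  proof (rule hpoly.mult[OF base(1)])
    show "bounded_linear (\<lambda>u. complex_of_real (u \<bullet> v))"
      by (intro bounded_linear_compose[OF bounded_linear_of_real bounded_linear_inner_left])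
    show "norm (complex_of_real (u \<bullet> v)) \<le> norm u" for u :: "complex^'n"
      using Cauchy_Schwarz_ineq2[of u v] mult_left_mono[OF assms(2), of "norm u"] by simp
  qed
  have "kern (Suc k) (real (2 * m) * B) (\<lambda>u. ((- of_real (2 * real m)) * ?q u) * of_real (inverse ((norm u)\<^sup>2) ^ Suc m))"
  proof (rule kern.base)
    have "hpoly (Suc a) (norm (- of_real (2 * real m) :: complex) * B) (\<lambda>u. (- of_real (2 * real m)) * ?q u)"
      by (rule hpoly_scale[OF q])
    then show "hpoly (Suc a) (real (2 * m) * B) (\<lambda>u. (- of_real (2 * real m)) * ?q u)"
      by (simp add: norm_mult)
  qed (use base in auto)
  note k2 = this
  let ?g' = "\<lambda>u. p' u * of_real (inverse ((norm u)\<^sup>2) ^ m) + ((- of_real (2 * real m)) * ?q u) * of_real (inverse ((norm u)\<^sup>2) ^ Suc m)"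
  have "kern (Suc k) (real a * B + real (2 * m) * B) ?g'"
  proof (cases "a = 0")
    case True
    then show ?thesis
      using k2 p'(1) by simp
  next
    case False
    then have "kern (Suc k) (real a * B) (\<lambda>u. p' u * of_real (inverse ((norm u)\<^sup>2) ^ m))"
      using p'(1) base by (intro kern.base[of "a - 1"]) auto
    then show ?thesis
      by (rule kern.add[OF _ k2])
  qed
  moreover have "real a * B + real (2 * m) * B \<le> real (3 * k + 2 * CARD('n) + 1) * B"
  proof -
    have "a + 2 * m \<le> 3 * k + 2 * CARD('n) + 1"
      using base by simp
    then have "real (a + 2 * m) * B \<le> real (3 * k + 2 * CARD('n) + 1) * B"
      using B by (intro mult_right_mono) (auto simp only: of_nat_le_iff)
    then show ?thesis
      by (simp add: distrib_right)
  qed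
  ultimately have "kern (Suc k) (real (3 * k + 2 * CARD('n) + 1) * B) ?g'"
    by (rule kern_weaken)
  moreover have "frechet_derivative (\<lambda>u. p u * of_real (inverse ((norm u)\<^sup>2) ^ m)) (at u) v = ?g' u" if "u \<noteq> 0" for u
  proof -
    have "((\<lambda>u. inverse ((norm u)\<^sup>2 + 0) ^ m) has_derivative
       (\<lambda>h. - (2 * real m * (u \<bullet> h)) * inverse ((norm u)\<^sup>2 + 0) ^ Suc m)) (at u)"
      using that by (intro norm_sq_inverse_power_derivative) simp
    from bounded_linear.has_derivative[OF bounded_linear_of_real[where 'a = complex] this]
    have 1: "((\<lambda>u. complex_of_real (inverse ((norm u)\<^sup>2) ^ m)) has_derivative
       (\<lambda>h. of_real (- (2 * real m * (u \<bullet> h)) * inverse ((norm u)\<^sup>2) ^ Suc m))) (at u)"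
      unfolding add_0_right .
    have 2: "(p has_derivative frechet_derivative p (at u)) (at u)"
      using hpoly_differentiable[OF base(1)] frechet_derivative_works by blast
    from frechet_derivative_at[OF has_derivative_mult[OF 2 1]]
    have "frechet_derivative (\<lambda>u. p u * of_real (inverse ((norm u)\<^sup>2) ^ m)) (at u)
      = (\<lambda>h. p u * of_real (- (2 * real m * (u \<bullet> h)) * inverse ((norm u)\<^sup>2) ^ Suc m) + frechet_derivative p (at u) h * of_real (inverse ((norm u)\<^sup>2) ^ m))"
      by simp
    then show ?thesis
      by (simp add: p'(2) mult_ac)
  qed
  ultimately show ?case
    by blast
next
  case (add k B1 g1 B2 g2)
  then obtain g1' g2' where g: "kern (Suc k) (real (3 * k + 2 * CARD('n) + 1) * B1) g1'"
    "\<And>u. u \<noteq> 0 \<Longrightarrow> frechet_derivative g1 (at u) v = g1' u"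
    "kern (Suc k) (real (3 * k + 2 * CARD('n) + 1) * B2) g2'"
    "\<And>u. u \<noteq> 0 \<Longrightarrow> frechet_derivative g2 (at u) v = g2' u"
    by blast
  have "frechet_derivative (\<lambda>u. g1 u + g2 u) (at u) v = g1' u + g2' u" if "u \<noteq> 0" for u
    using frechet_derivative_plus[OF kern_differentiable[OF add.hyps(1) that] kern_differentiable[OF add.hyps(2) that]] g(2,4) that by simp
  moreover have "kern (Suc k) (real (3 * k + 2 * CARD('n) + 1) * (B1 + B2)) (\<lambda>u. g1' u + g2' u)"
    using kern.add[OF g(1,3)] by (simp only: distrib_left)
  ultimately show ?case
    by blast
qed

lemma kern_nonneg:
  assumes "kern k B (g :: complex^'n::finite \<Rightarrow> complex)"
  shows "B \<ge> 0"
  using assms by induction (auto intro: hpoly_nonneg)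

lemma kern_bm: "kern 0 1 (bm_kernel 0 (j :: 'n::finite))"
proof -
  have "hpoly (Suc 0) 1 (\<lambda>u::complex^'n. cnj (u $ j) * 1)"
    by (intro hpoly.mult hpoly.const bounded_linear_compose[OF bounded_linear_cnj bounded_linear_vec_nth])
       (auto simp: Finite_Cartesian_Product.norm_nth_le)
  then have "kern 0 1 (\<lambda>u::complex^'n. (cnj (u $ j) * 1) * of_real (inverse ((norm u)\<^sup>2) ^ CARD('n)))"
    by (rule kern.base) auto
  then show ?thesis
    by (simp add: bm_kernel_def[abs_def])
qed

section \<open>Differentiation of potentials under the integral sign\<close>

lemma has_derivative_embed_shift:
  assumes "g differentiable (at (w - embed_cn y))"
  shows "((\<lambda>y. g (w - embed_cn y)) has_derivative
    (\<lambda>h. - (\<Sum>i\<in>UNIV. (h $ i) *\<^sub>R frechet_derivative g (at (w - embed_cn y)) (axis i 1)))) (at y)"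
proof -
  let ?D = "frechet_derivative g (at (w - embed_cn y))"
  have D: "(g has_derivative ?D) (at (w - embed_cn y))"
    using assms frechet_derivative_works by blast
  have lin: "linear ?D"
    using D by (rule has_derivative_linear)
  have "((\<lambda>y. w - embed_cn y) has_derivative (\<lambda>h. - embed_cn h)) (at y)"
    by (auto intro!: derivative_eq_intros bounded_linear_imp_has_derivative embed_cn_linear)
  from has_derivative_compose[OF this D]
  have "((\<lambda>y. g (w - embed_cn y)) has_derivative (\<lambda>h. ?D (- embed_cn h))) (at y)" .
  moreover have "?D (- embed_cn h) = - (\<Sum>i\<in>UNIV. (h $ i) *\<^sub>R ?D (axis i 1))" for h
  proof -
    have "embed_cn h = (\<Sum>i\<in>UNIV. (h $ i) *\<^sub>R axis i 1)"
    proof -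
      have lin: "linear (embed_cn :: real^'a \<Rightarrow> complex^'a)"
        using embed_cn_linear by (rule bounded_linear.linear)
      have "embed_cn (axis i 1 :: real^'a) = axis i 1" for i
        by (simp add: vec_eq_iff axis_def)
      moreover have "embed_cn h = embed_cn (\<Sum>i\<in>UNIV. (h $ i) *\<^sub>R axis i 1)"
        by (rule arg_cong[OF vec_axis_sum])
      ultimately show ?thesis
        by (simp add: linear_sum[OF lin] linear_scale[OF lin])
    qed
    then show ?thesis
      by (simp add: linear_neg[OF lin] linear_sum[OF lin] linear_scale[OF lin])
  qed
  ultimately show ?thesis
    by simp
qed

text \<open>Flatness at the real points of \<open>U\<close>, to every order and uniformly in the
  point, makes the density integrable against kernels of any singularity, so that potentials can be
  differentiated without end.\<close>

locale flat_density =
  fixes D :: "complex^'n::finite \<Rightarrow> complex" and U :: "(real^'n) set" and r :: real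
  assumes D_cont: "continuous_on UNIV D" and D_supp: "\<And>w. norm w > r \<Longrightarrow> D w = 0"
    and D_flat: "\<And>N::nat. \<exists>C\<ge>0. \<forall>w. \<forall>x\<in>U. norm (D w) \<le> C * norm (w - embed_cn x) ^ N"
    and U_open: "open U"
begin

definition potential :: "(complex^'n \<Rightarrow> complex) \<Rightarrow> real^'n \<Rightarrow> complex" where
  "potential g x = integral\<^sup>L lborel (\<lambda>w. D w * g (w - embed_cn x))"

lemma D_measurable [measurable]: "D \<in> borel_measurable borel"
  using D_cont by (rule borel_measurable_continuous_onI)

lemma D_at_base:
  assumes "x \<in> U"
  shows "D (embed_cn x) = 0"
proof -
  obtain C where "\<forall>w. \<forall>x\<in>U. norm (D w) \<le> C * norm (w - embed_cn x) ^ 1"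
    using D_flat[of 1] by blast
  then have "norm (D (embed_cn x)) \<le> C * norm (embed_cn x - embed_cn x) ^ 1"
    using assms by blast
  then show ?thesis
    by simp
qed

text \<open>Flatness of this order cancels exactly the singularity of a kernel homogeneous of degree
  \<open>1 - 2 * CARD('n) - k\<close>.\<close>

lemma integrand_bound:
  assumes "kern k B g" "x \<in> U" "C \<ge> 0" "\<And>w x. x \<in> U \<Longrightarrow> norm (D w) \<le> C * norm (w - embed_cn x) ^ (2 * CARD('n) - 1 + k)"
  shows "norm (D w * g (w - embed_cn x)) \<le> C * B"
proof (cases "w = embed_cn x")
  case True
  then show ?thesis
    using D_at_base[OF assms(2)] kern_nonneg[OF assms(1)] assms(3) by simp
next
  case False
  let ?e = "2 * CARD('n) - 1 + k"
  have "norm (D w * g (w - embed_cn x)) \<le> (C * norm (w - embed_cn x) ^ ?e) * norm (g (w - embed_cn x))"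
    unfolding norm_mult using assms(4)[OF assms(2)] by (intro mult_right_mono) auto
  also have "\<dots> = C * (norm (g (w - embed_cn x)) * norm (w - embed_cn x) ^ ?e)"
    by (simp add: mult_ac)
  also have "\<dots> \<le> C * B"
    using kern_bound[OF assms(1), of "w - embed_cn x"] False assms(3) by (intro mult_left_mono) auto
  finally show ?thesis .
qed

lemma integrand_measurable:
  assumes "kern k B g"
  shows "(\<lambda>w. D w * g (w - embed_cn x)) \<in> borel_measurable borel"
  using kern_measurable[OF assms] by measurable

lemma potential_integrable:
  assumes "kern k B g" "x \<in> U"
  shows "integrable lborel (\<lambda>w. D w * g (w - embed_cn x))"
proof -
  obtain C where C: "C \<ge> 0" "\<And>w x. x \<in> U \<Longrightarrow> norm (D w) \<le> C * norm (w - embed_cn x) ^ (2 * CARD('n) - 1 + k)"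
    using D_flat by metis
  show ?thesis
    by (rule integrable_bounded_support(1)[where r = r, OF integrand_measurable[OF assms(1)] integrand_bound[OF assms C]])
       (use D_supp in auto)
qed

lemma potential_bound:
  assumes "kern k B g" "x \<in> U" "C \<ge> 0" "\<And>w x. x \<in> U \<Longrightarrow> norm (D w) \<le> C * norm (w - embed_cn x) ^ (2 * CARD('n) - 1 + k)"
  shows "norm (potential g x) \<le> C * B * measure lborel (cball (0 :: complex^'n) r)"
  unfolding potential_def
  by (rule integrable_bounded_support(2)[where r = r, OF integrand_measurable[OF assms(1)] integrand_bound[OF assms]])
     (use D_supp in auto)

text \<open>Two more orders of flatness bound the second derivatives of the integrand in the point.
  Its first order remainder is therefore at most \<open>M * (norm (y - x))\<^sup>2\<close> uniformly
  in \<open>w\<close>, and this bound is integrated over the compact support.\<close>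

lemma potential_has_derivative:
  assumes g: "kern k B g" and x: "x \<in> U"
    and gs: "\<And>i. kern (Suc k) B' (gs i)" "\<And>i u. u \<noteq> 0 \<Longrightarrow> frechet_derivative g (at u) (axis i 1) = gs i u"
  shows "(potential g has_derivative (\<lambda>h. - (\<Sum>i\<in>UNIV. (h $ i) *\<^sub>R potential (gs i) x))) (at x)"
proof -
  let ?e = "2 * CARD('n) - 1 + Suc (Suc k)"
  obtain C where C: "C \<ge> 0" "\<And>w x. x \<in> U \<Longrightarrow> norm (D w) \<le> C * norm (w - embed_cn x) ^ ?e"
    using D_flat by metis
  define B'' where "B'' = real (3 * Suc k + 2 * CARD('n) + 1) * B'"
  have "\<exists>g'. kern (Suc (Suc k)) B'' g' \<and> (\<forall>u. u \<noteq> 0 \<longrightarrow> frechet_derivative (gs i) (at u) (axis l 1) = g' u)" for i l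
    unfolding B''_def by (rule kern_deriv[OF gs(1)]) (simp add: norm_Basis axis_in_Basis_iff)
  then obtain gg where gg: "\<And>i l. kern (Suc (Suc k)) B'' (gg i l)"
    "\<And>i l u. u \<noteq> 0 \<Longrightarrow> frechet_derivative (gs i) (at u) (axis l 1) = gg i l u"
    by metis
  have B'': "B'' \<ge> 0"
    using kern_nonneg[OF gg(1)] .
  obtain \<delta> where \<delta>: "\<delta> > 0" "ball x \<delta> \<subseteq> U"
    using U_open x open_contains_ball by blast
  define n where "n = real CARD('n)"
  define M where "M = n * n * B'' * C"
  have M: "M \<ge> 0"
    using B'' C by (simp add: M_def n_def)
  let ?R = "\<lambda>y w. D w * g (w - embed_cn y) - D w * g (w - embed_cn x)
     + (\<Sum>i\<in>UNIV. ((y - x) $ i) *\<^sub>R (D w * gs i (w - embed_cn x)))"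
  have R: "norm (?R y w) \<le> M * (norm (y - x))\<^sup>2" if y: "y \<in> ball x \<delta>" for y w
  \<comment> \<open>If \<open>D w\<close> is nonzero, \<open>w\<close> is not a real point of
    \<open>U\<close>, so the kernel is differentiable along the whole ball.\<close>
  proof (cases "D w = 0")
    case False
    then have Dw: "norm (D w) > 0"
      by simp
    \<comment> \<open>This constant is large where \<open>D w\<close> is small, but the remainder is
      multiplied by \<open>norm (D w)\<close> in the end.\<close>
    let ?L = "B'' * C / norm (D w)"
    have ne: "w - embed_cn y' \<noteq> 0" if "y' \<in> ball x \<delta>" for y'
      using D_at_base[of y'] that \<delta>(2) False by auto
    have ggb: "norm (gg i l (w - embed_cn y')) \<le> ?L" if "y' \<in> ball x \<delta>" for i l y'
    proof -
      let ?d = "norm (w - embed_cn y')"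
      have d: "?d > 0"
        using ne[OF that] by simp
      have "norm (D w) \<le> C * ?d ^ ?e"
        using C(2) that \<delta>(2) by blast
      then have "norm (gg i l (w - embed_cn y')) * norm (D w) \<le> norm (gg i l (w - embed_cn y')) * (C * ?d ^ ?e)"
        by (intro mult_left_mono) auto
      also have "\<dots> = C * (norm (gg i l (w - embed_cn y')) * ?d ^ ?e)"
        by (simp add: mult_ac)
      also have "\<dots> \<le> C * B''"
        using kern_bound[OF gg(1) ne[OF that]] C(1) by (intro mult_left_mono)
      finally show ?thesis
        using Dw by (simp add: pos_le_divide_eq mult.commute)
    qed
    have L: "?L \<ge> 0"
      using B'' C(1) by simp
    have lip: "norm (gs i (w - embed_cn y') - gs i (w - embed_cn x)) \<le> n * ?L * norm (y' - x)" if "y' \<in> ball x \<delta>" for i y'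
    proof (rule differentiable_bound[where S = "ball x \<delta>" and f = "\<lambda>y. gs i (w - embed_cn y)"
          and f' = "\<lambda>y h. - (\<Sum>l\<in>UNIV. (h $ l) *\<^sub>R frechet_derivative (gs i) (at (w - embed_cn y)) (axis l 1))"])
      fix v assume v: "v \<in> ball x \<delta>"
      show "((\<lambda>y. gs i (w - embed_cn y)) has_derivative
        (\<lambda>h. - (\<Sum>l\<in>UNIV. (h $ l) *\<^sub>R frechet_derivative (gs i) (at (w - embed_cn v)) (axis l 1)))) (at v within ball x \<delta>)"
        by (rule has_derivative_at_withinI[OF has_derivative_embed_shift[OF kern_differentiable[OF gs(1) ne[OF v]]]])
      show "onorm (\<lambda>h. - (\<Sum>l\<in>UNIV. (h $ l) *\<^sub>R frechet_derivative (gs i) (at (w - embed_cn v)) (axis l 1))) \<le> n * ?L"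
      proof (rule onorm_le)
        fix h :: "real^'n"
        have "norm (\<Sum>l\<in>UNIV. (h $ l) *\<^sub>R frechet_derivative (gs i) (at (w - embed_cn v)) (axis l 1)) \<le> (\<Sum>l::'n\<in>UNIV. norm h * ?L)"
        proof (rule sum_norm_le)
          fix l :: 'n
          show "norm ((h $ l) *\<^sub>R frechet_derivative (gs i) (at (w - embed_cn v)) (axis l 1)) \<le> norm h * ?L"
            unfolding norm_scaleR gg(2)[OF ne[OF v]] using ggb[OF v]
            by (intro mult_mono) (auto simp: component_le_norm_cart)
        qed
        then show "norm (- (\<Sum>l\<in>UNIV. (h $ l) *\<^sub>R frechet_derivative (gs i) (at (w - embed_cn v)) (axis l 1))) \<le> n * ?L * norm h"
          by (simp add: n_def mult_ac)
      qed
    qed (use that \<delta> in auto)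
    \<comment> \<open>The sum is added because moving \<open>y\<close> moves the argument of
      \<open>g\<close> in the opposite direction; the derivative of \<open>\<psi>\<close> at
      \<open>x\<close> is 0.\<close>
    define \<psi> where "\<psi> y = g (w - embed_cn y) + (\<Sum>i\<in>UNIV. ((y - x) $ i) *\<^sub>R gs i (w - embed_cn x))" for y
    have "norm (\<psi> y - \<psi> x) \<le> (n * (n * ?L * norm (y - x))) * norm (y - x)"
    proof (rule differentiable_bound[where S = "cball x (norm (y - x))"
          and f' = "\<lambda>v h. - (\<Sum>i\<in>UNIV. (h $ i) *\<^sub>R (gs i (w - embed_cn v) - gs i (w - embed_cn x)))"])
      fix v assume v: "v \<in> cball x (norm (y - x))"
      then have vb: "v \<in> ball x \<delta>"
        using y by (auto simp: dist_norm norm_minus_commute)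
      have "((\<lambda>y. g (w - embed_cn y)) has_derivative (\<lambda>h. - (\<Sum>i\<in>UNIV. (h $ i) *\<^sub>R gs i (w - embed_cn v)))) (at v)"
        using has_derivative_embed_shift[OF kern_differentiable[OF g ne[OF vb]]] unfolding gs(2)[OF ne[OF vb]] .
      moreover have "((\<lambda>y. \<Sum>i\<in>UNIV. ((y - x) $ i) *\<^sub>R gs i (w - embed_cn x)) has_derivative
          (\<lambda>h. \<Sum>i\<in>UNIV. (h $ i) *\<^sub>R gs i (w - embed_cn x))) (at v)"
        by (auto intro!: derivative_eq_intros bounded_linear_imp_has_derivative bounded_linear_vec_nth)
      ultimately have "(\<psi> has_derivative (\<lambda>h. - (\<Sum>i\<in>UNIV. (h $ i) *\<^sub>R gs i (w - embed_cn v)) + (\<Sum>i\<in>UNIV. (h $ i) *\<^sub>R gs i (w - embed_cn x)))) (at v)"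
        unfolding \<psi>_def[abs_def] by (rule has_derivative_add)
      then show "(\<psi> has_derivative (\<lambda>h. - (\<Sum>i\<in>UNIV. (h $ i) *\<^sub>R (gs i (w - embed_cn v) - gs i (w - embed_cn x))))) (at v within cball x (norm (y - x)))"
        by (rule has_derivative_at_withinI[OF has_derivative_eq_rhs]) (simp add: fun_eq_iff scaleR_diff_right sum_subtractf)
      show "onorm (\<lambda>h. - (\<Sum>i\<in>UNIV. (h $ i) *\<^sub>R (gs i (w - embed_cn v) - gs i (w - embed_cn x)))) \<le> n * (n * ?L * norm (y - x))"
      proof (rule onorm_le)
        fix h :: "real^'n"
        have "norm (\<Sum>i\<in>UNIV. (h $ i) *\<^sub>R (gs i (w - embed_cn v) - gs i (w - embed_cn x))) \<le> (\<Sum>i::'n\<in>UNIV. norm h * (n * ?L * norm (y - x)))"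
        proof (rule sum_norm_le)
          fix i :: 'n
          have "norm (gs i (w - embed_cn v) - gs i (w - embed_cn x)) \<le> n * ?L * norm (v - x)"
            by (rule lip[OF vb])
          also have "\<dots> \<le> n * ?L * norm (y - x)"
          proof (rule mult_left_mono)
            show "norm (v - x) \<le> norm (y - x)"
              using v by (simp add: dist_norm norm_minus_commute)
            show "0 \<le> n * ?L"
              using L by (intro mult_nonneg_nonneg) (auto simp: n_def)
          qed
          finally show "norm ((h $ i) *\<^sub>R (gs i (w - embed_cn v) - gs i (w - embed_cn x))) \<le> norm h * (n * ?L * norm (y - x))"
            unfolding norm_scaleR by (intro mult_mono) (auto simp: component_le_norm_cart)
        qed
        then show "norm (- (\<Sum>i\<in>UNIV. (h $ i) *\<^sub>R (gs i (w - embed_cn v) - gs i (w - embed_cn x)))) \<le> n * (n * ?L * norm (y - x)) * norm h"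
          by (simp add: n_def mult_ac)
      qed
    qed (auto simp: dist_norm norm_minus_commute)
    then have "norm (D w) * norm (\<psi> y - \<psi> x) \<le> norm (D w) * ((n * (n * ?L * norm (y - x))) * norm (y - x))"
      by (intro mult_left_mono) auto
    also have "\<dots> = M * (norm (y - x))\<^sup>2"
      using Dw by (simp add: M_def power2_eq_square)
    also have "norm (D w) * norm (\<psi> y - \<psi> x) = norm (?R y w)"
      unfolding norm_mult[symmetric] by (simp add: \<psi>_def algebra_simps sum_distrib_left)
    finally show ?thesis .
  qed (use M in simp)
  define V where "V = measure lborel (cball (0 :: complex^'n) r)"
  have rem: "norm (potential g y - potential g x + (\<Sum>i\<in>UNIV. ((y - x) $ i) *\<^sub>R potential (gs i) x)) \<le> M * (norm (y - x))\<^sup>2 * V"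
    if y: "y \<in> ball x \<delta>" for y
  proof -
    have yU: "y \<in> U"
      using y \<delta> by blast
    note i1 = potential_integrable[OF g yU] potential_integrable[OF g x] potential_integrable[OF gs(1) x]
    have "potential g y - potential g x + (\<Sum>i\<in>UNIV. ((y - x) $ i) *\<^sub>R potential (gs i) x) = integral\<^sup>L lborel (?R y)"
      unfolding potential_def using i1 by (simp del: vector_minus_component)
    also have "norm \<dots> \<le> M * (norm (y - x))\<^sup>2 * V"
      unfolding V_def
    proof (rule integrable_bounded_support(2)[OF _ R[OF y]])
      show "?R y \<in> borel_measurable borel"
        using kern_measurable[OF g] kern_measurable[OF gs(1)] by measurable
    qed (simp add: D_supp)
    finally show ?thesis .
  qed
  show ?thesis
    unfolding has_derivative_at_alt
  proof (intro conjI allI impI)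
    show "bounded_linear (\<lambda>h. - (\<Sum>i\<in>UNIV. (h $ i) *\<^sub>R potential (gs i) x))"
      by (intro bounded_linear_minus bounded_linear_sum bounded_linear_compose[OF bounded_linear_scaleR_left bounded_linear_vec_nth])
    fix e :: real assume e: "e > 0"
    have V: "V \<ge> 0"
      by (simp add: V_def)
    define d where "d = min \<delta> (e / (M * V + 1))"
    have MV: "M * V \<ge> 0"
      using M V by simp
    have d: "d > 0"
      using \<delta> e MV by (simp add: d_def)
    show "\<exists>d>0. \<forall>y. norm (y - x) < d \<longrightarrow>
        norm (potential g y - potential g x - - (\<Sum>i\<in>UNIV. ((y - x) $ i) *\<^sub>R potential (gs i) x)) \<le> e * norm (y - x)"
    proof (intro exI[of _ d] conjI d allI impI)
      fix y assume y: "norm (y - x) < d"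
      then have "y \<in> ball x \<delta>"
        by (simp add: d_def dist_norm norm_minus_commute)
      from rem[OF this]
      have "norm (potential g y - potential g x - - (\<Sum>i\<in>UNIV. ((y - x) $ i) *\<^sub>R potential (gs i) x)) \<le> M * (norm (y - x))\<^sup>2 * V"
        by simp
      also have "\<dots> = ((M * V) * norm (y - x)) * norm (y - x)"
        by (simp add: power2_eq_square mult_ac)
      also have "\<dots> \<le> e * norm (y - x)"
      proof (rule mult_right_mono)
        have "(M * V) * norm (y - x) \<le> (M * V + 1) * (e / (M * V + 1))"
          using y MV by (intro mult_mono) (auto simp: d_def)
        also have "\<dots> = e"
          using MV by simp
        finally show "(M * V) * norm (y - x) \<le> e" .
      qed simp
      finally show "norm (potential g y - potential g x - - (\<Sum>i\<in>UNIV. ((y - x) $ i) *\<^sub>R potential (gs i) x)) \<le> e * norm (y - x)" .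
    qed
  qed
qed

end

section \<open>Extensions and weighted classes\<close>

lemma norm_axis: "norm (axis i c :: 'a::real_normed_vector^'n::finite) = norm c"
proof -
  have "(\<Sum>j\<in>UNIV. (norm ((axis i c :: 'a^'n) $ j))\<^sup>2) = (\<Sum>j\<in>UNIV. if j = i then (norm c)\<^sup>2 else 0)"
    by (intro sum.cong) (auto simp: axis_def)
  then show ?thesis
    by (simp add: norm_vec_def L2_set_def)
qed

text \<open>In absolute value the regularised kernels are dominated by the one with parameter 0,
  which is integrable against \<open>D\<close> by flatness. At the singularity itself
  \<open>D\<close> vanishes.\<close>

lemma (in flat_density) regularised_potential_limit:
  assumes D: "x \<in> U"
  shows "integrable lborel (\<lambda>w. D w * bm_kernel (1 / real (Suc m)) j (w - embed_cn x))"
    and "(\<lambda>m. integral\<^sup>L lborel (\<lambda>w. D w * bm_kernel (1 / real (Suc m)) j (w - embed_cn x))) \<longlonglongrightarrow> potential (bm_kernel 0 j) x"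
proof -
  let ?s = "\<lambda>m w. D w * bm_kernel (1 / real (Suc m)) j (w - embed_cn x)"
  let ?f = "\<lambda>w. D w * bm_kernel 0 j (w - embed_cn x)"
  have f: "?f \<in> borel_measurable lborel"
    using integrand_measurable[OF kern_bm] by simp
  have s: "?s m \<in> borel_measurable lborel" for m
  proof -
    have [measurable]: "bm_kernel (1 / real (Suc m)) j \<in> borel_measurable borel"
      by (intro borel_measurable_continuous_onI continuous_bm_kernel) simp
    show ?thesis
      by measurable
  qed
  have w: "integrable lborel (\<lambda>w. norm (?f w))"
    by (intro integrable_norm potential_integrable[OF kern_bm D])
  have lim: "AE w in lborel. (\<lambda>m. ?s m w) \<longlonglongrightarrow> ?f w"
  proof (rule AE_I2)
    fix w
    show "(\<lambda>m. ?s m w) \<longlonglongrightarrow> ?f w"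
    proof (cases "w = embed_cn x")
      case True
      then show ?thesis
        using D_at_base[OF D] by simp
    next
      case False
      have "(\<lambda>m. 1 / real (Suc m)) \<longlonglongrightarrow> 0"
        using LIMSEQ_inverse_real_of_nat by (simp add: inverse_eq_divide)
      then show ?thesis
        unfolding bm_kernel_def using False by (intro tendsto_intros) auto
    qed
  qed
  have bound: "AE w in lborel. norm (?s m w) \<le> norm (?f w)" for m
  proof (rule AE_I2)
    fix w
    show "norm (?s m w) \<le> norm (?f w)"
    proof (cases "w = embed_cn x")
      case True
      then show ?thesis
        using D_at_base[OF D] by simp
    next
      case False
      let ?u = "w - embed_cn x"
      have "inverse ((norm ?u)\<^sup>2 + (1 / real (Suc m))\<^sup>2) \<le> inverse ((norm ?u)\<^sup>2)"
        using False by (intro le_imp_inverse_le) auto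
      then have "inverse ((norm ?u)\<^sup>2 + (1 / real (Suc m))\<^sup>2) ^ CARD('n) \<le> inverse ((norm ?u)\<^sup>2 + 0\<^sup>2) ^ CARD('n)"
        by (intro power_mono) auto
      then have "norm (bm_kernel (1 / real (Suc m)) j ?u) \<le> norm (bm_kernel 0 j ?u)"
        unfolding bm_kernel_def norm_mult norm_of_real by (intro mult_left_mono) auto
      then show ?thesis
        unfolding norm_mult by (intro mult_left_mono) auto
    qed
  qed
  show "integrable lborel (?s m)"
    by (rule integrable_dominated_convergence2[OF f s w lim bound])
  show "(\<lambda>m. integral\<^sup>L lborel (?s m)) \<longlonglongrightarrow> potential (bm_kernel 0 j) x"
    unfolding potential_def by (rule integral_dominated_convergence[OF f s w lim bound])
qed

text \<open>Compares the two limits of the regularised formula: potentials on one side, the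
  approximate identity on the other.\<close>

lemma bochner_martinelli:
  fixes F :: "complex^'n::finite \<Rightarrow> complex"
  assumes F: "C1c F" and x: "x \<in> U" and flat: "\<And>j. flat_density (\<lambda>w. dbar F w $ j) U r"
  shows "F (embed_cn x) = of_real (- 1 / bm_const TYPE('n)) *
    (\<Sum>j\<in>UNIV. flat_density.potential (\<lambda>w. dbar F w $ j) (bm_kernel 0 j) x)"
proof -
  let ?S = "\<Sum>j\<in>UNIV. flat_density.potential (\<lambda>w. dbar F w $ j) (bm_kernel 0 j) x"
  let ?e = "\<lambda>m. 1 / real (Suc m)"
  note lim = flat_density.regularised_potential_limit[OF flat x]
  have "(\<lambda>m. \<Sum>j\<in>UNIV. integral\<^sup>L lborel (\<lambda>w. dbar F w $ j * bm_kernel (?e m) j (w - embed_cn x))) \<longlonglongrightarrow> ?S"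
    by (intro tendsto_sum lim(2))
  moreover have "(\<Sum>j\<in>UNIV. integral\<^sup>L lborel (\<lambda>w. dbar F w $ j * bm_kernel (?e m) j (w - embed_cn x)))
     = - integral\<^sup>L lborel (\<lambda>w. F w * of_real (real CARD('n) * (?e m)\<^sup>2 * inverse ((norm (w - embed_cn x))\<^sup>2 + (?e m)\<^sup>2) ^ Suc CARD('n)))" for m
  proof -
    have "(\<Sum>j\<in>UNIV. integral\<^sup>L lborel (\<lambda>w. dbar F w $ j * bm_kernel (?e m) j (w - embed_cn x)))
      = integral\<^sup>L lborel (\<lambda>w. \<Sum>j\<in>UNIV. dbar F w $ j * bm_kernel (?e m) j (w - embed_cn x))"
      by (rule Bochner_Integration.integral_sum[symmetric]) (rule lim(1))
    also have "\<dots> = - integral\<^sup>L lborel (\<lambda>w. F w * of_real (real CARD('n) * (?e m)\<^sup>2 * inverse ((norm (w - embed_cn x))\<^sup>2 + (?e m)\<^sup>2) ^ Suc CARD('n)))"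
      by (rule bochner_martinelli_regularised[OF F]) simp
    finally show ?thesis .
  qed
  moreover have "(\<lambda>m. - integral\<^sup>L lborel (\<lambda>w. F w * of_real (real CARD('n) * (?e m)\<^sup>2 * inverse ((norm (w - embed_cn x))\<^sup>2 + (?e m)\<^sup>2) ^ Suc CARD('n))))
     \<longlonglongrightarrow> - (of_real (bm_const TYPE('n)) * F (embed_cn x))"
  proof -
    obtain F' r0 where F': "\<And>z. (F has_derivative blinfun_apply (F' z)) (at z)" "\<And>z. norm z > r0 \<Longrightarrow> F z = 0"
      using C1cE[OF F] by metis
    have cont: "continuous_on UNIV F"
      using F'(1) by (rule has_derivative_imp_continuous_on)
    obtain B where "\<And>z. norm (F z) \<le> B"
      using bounded_of_compact_support[OF cont F'(2)] by metis
    then show ?thesis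
      by (intro tendsto_minus bm_mollifier_limit[OF cont])
  qed
  ultimately have "?S = - (of_real (bm_const TYPE('n)) * F (embed_cn x))"
    using LIMSEQ_unique by simp
  then show ?thesis
    using bm_const_pos[where 'n = 'n] by simp
qed

text \<open>Product of the factors from \<open>kern_deriv\<close>, hence the coefficient bound after
  \<open>k\<close> derivatives of the kernel.\<close>

definition kern_const :: "nat \<Rightarrow> nat \<Rightarrow> real" where
  "kern_const n k = (\<Prod>i<k. real (3 * i + 2 * n + 1))"

lemma kern_const_le: "kern_const n k \<le> (2 * real n + 4) ^ k * fact k"
proof (induction k)
  case (Suc k)
  have "real (3 * k + 2 * n + 1) \<le> (2 * real n + 4) * real (Suc k)"
    by (simp add: algebra_simps)
  then have "kern_const n k * real (3 * k + 2 * n + 1) \<le> ((2 * real n + 4) ^ k * fact k) * ((2 * real n + 4) * real (Suc k))"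
    using Suc by (intro mult_mono) (auto simp: kern_const_def intro!: prod_nonneg)
  then show ?case
    by (simp add: kern_const_def mult_ac)
qed (simp add: kern_const_def)

text \<open>Formula and differentiability go together: \<open>der\<close> turns the formula for one
  list into the formula for the next, and applied to that one it yields differentiability. The sign
  \<open>(- 1) ^ length ks\<close> arises because the kernels are evaluated at
  \<open>w - x\<close>.\<close>

lemma pderiv_list_potential:
  fixes F :: "complex^'n::finite \<Rightarrow> complex" and f :: "real^'n \<Rightarrow> complex"
  assumes F: "C1c F" and flat: "\<And>j. flat_density (\<lambda>w. dbar F w $ j) U r"
    and f: "\<And>x. x \<in> U \<Longrightarrow> F (embed_cn x) = f x"
  shows "\<exists>gs. (\<forall>j. kern (length ks) (kern_const CARD('n) (length ks)) (gs j)) \<and>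
    (\<forall>x\<in>U. pderiv_list ks f differentiable (at x) \<and>
      pderiv_list ks f x = of_real (- 1 / bm_const TYPE('n)) * (- 1) ^ length ks *
        (\<Sum>j\<in>UNIV. flat_density.potential (\<lambda>w. dbar F w $ j) (gs j) x))"
proof -
  let ?c = "\<lambda>l::nat. complex_of_real (- 1 / bm_const TYPE('n)) * (- 1) ^ l"
  let ?pot = "\<lambda>j. flat_density.potential (\<lambda>w. dbar F w $ j)"
  have "open U"
    using flat[of undefined] by (simp add: flat_density_def)
  have der: "\<exists>gs'. (\<forall>j i. kern (Suc l) (kern_const CARD('n) (Suc l)) (gs' j i)) \<and>
      (\<forall>x\<in>U. (h has_derivative (\<lambda>v. ?c (Suc l) * (\<Sum>j\<in>UNIV. \<Sum>i\<in>UNIV. (v $ i) *\<^sub>R ?pot j (gs' j i) x))) (at x))"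
    if gs: "\<And>j. kern l (kern_const CARD('n) l) (gs j)"
      and h: "\<And>x. x \<in> U \<Longrightarrow> h x = ?c l * (\<Sum>j\<in>UNIV. ?pot j (gs j) x)" for l gs h
  proof -
    have "\<exists>g'. kern (Suc l) (kern_const CARD('n) (Suc l)) g' \<and> (\<forall>u. u \<noteq> 0 \<longrightarrow> frechet_derivative (gs j) (at u) (axis i 1) = g' u)" for j i
      using kern_deriv[OF gs[of j], of "axis i 1"] by (simp add: norm_Basis axis_in_Basis_iff kern_const_def mult.commute)
    then obtain gs' where gs': "\<And>j i. kern (Suc l) (kern_const CARD('n) (Suc l)) (gs' j i)"
      "\<And>j i u. u \<noteq> 0 \<Longrightarrow> frechet_derivative (gs j) (at u) (axis i 1) = gs' j i u"
      by metis
    have "(h has_derivative (\<lambda>v. ?c (Suc l) * (\<Sum>j\<in>UNIV. \<Sum>i\<in>UNIV. (v $ i) *\<^sub>R ?pot j (gs' j i) x))) (at x)"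
      if x: "x \<in> U" for x
    proof -
      have "((\<lambda>x. ?c l * (\<Sum>j\<in>UNIV. ?pot j (gs j) x)) has_derivative
         (\<lambda>v. ?c l * (\<Sum>j\<in>UNIV. - (\<Sum>i\<in>UNIV. (v $ i) *\<^sub>R ?pot j (gs' j i) x)))) (at x)"
        by (intro has_derivative_mult_right has_derivative_sum flat_density.potential_has_derivative[OF flat gs x gs'])
      then have "((\<lambda>x. ?c l * (\<Sum>j\<in>UNIV. ?pot j (gs j) x)) has_derivative
         (\<lambda>v. ?c (Suc l) * (\<Sum>j\<in>UNIV. \<Sum>i\<in>UNIV. (v $ i) *\<^sub>R ?pot j (gs' j i) x))) (at x)"
        by (rule has_derivative_eq_rhs) (simp add: fun_eq_iff sum_negf)
      then show ?thesis
        by (rule has_derivative_transform_within_open[OF _ \<open>open U\<close> x]) (simp add: h)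
    qed
    with gs'(1) show ?thesis
      by blast
  qed
  show ?thesis
  proof (induction ks)
    case Nil
    have k: "kern 0 (kern_const CARD('n) 0) (bm_kernel 0 j)" for j :: 'n
      using kern_bm by (simp add: kern_const_def)
    have r: "f x = ?c 0 * (\<Sum>j\<in>UNIV. ?pot j (bm_kernel 0 j) x)" if "x \<in> U" for x
      using bochner_martinelli[OF F that flat] f[OF that] by simp
    have "f differentiable (at x)" if "x \<in> U" for x
      using der[OF k r] that unfolding differentiable_def by blast
    with k r show ?case
      by (intro exI[of _ "bm_kernel 0"]) simp
  next
    case (Cons k ks)
    then obtain gs where gs: "\<And>j. kern (length ks) (kern_const CARD('n) (length ks)) (gs j)"
      "\<And>x. x \<in> U \<Longrightarrow> pderiv_list ks f x = ?c (length ks) * (\<Sum>j\<in>UNIV. ?pot j (gs j) x)"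
      by blast
    obtain gs' where gs': "\<And>j i. kern (Suc (length ks)) (kern_const CARD('n) (Suc (length ks))) (gs' j i)"
      "\<And>x. x \<in> U \<Longrightarrow> (pderiv_list ks f has_derivative (\<lambda>v. ?c (Suc (length ks)) * (\<Sum>j\<in>UNIV. \<Sum>i\<in>UNIV. (v $ i) *\<^sub>R ?pot j (gs' j i) x))) (at x)"
      using der[OF gs] by blast
    have val: "pderiv_list (k # ks) f x = ?c (Suc (length ks)) * (\<Sum>j\<in>UNIV. ?pot j (gs' j k) x)" if "x \<in> U" for x
    proof -
      have "(\<Sum>i\<in>UNIV. (axis k 1 :: real^'n) $ i *\<^sub>R w i) = w k" for w :: "'n \<Rightarrow> complex"
      proof -
        have "(\<Sum>i\<in>UNIV. (axis k 1 :: real^'n) $ i *\<^sub>R w i) = (\<Sum>i\<in>UNIV. if i = k then w i else 0)"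
          by (intro sum.cong) (auto simp: axis_def)
        then show ?thesis
          by simp
      qed
      then show ?thesis
        unfolding pderiv_list_Cons using pderiv_i_has_derivative[OF gs'(2)[OF that], of k] by simp
    qed
    have "pderiv_list (k # ks) f differentiable (at x)" if "x \<in> U" for x
      using der[OF gs'(1) val] that unfolding differentiable_def by blast
    with gs'(1) val show ?case
      by (intro exI[of _ "\<lambda>j. gs' j k"]) simp
  qed
qed

section \<open>From the estimate on the conjugate derivative back to the class\<close>

context concave_weight
begin

text \<open>The supremum in \<open>wstar\<close> is replaced by a free \<open>s\<close>, to be
  chosen later according to the order of the derivative.\<close>

lemma dbar_estimateD:
  assumes "dbar_estimate \<omega> U \<rho> F" "\<rho> > 0" "U \<noteq> {}" "bounded U"
  obtains C where "C \<ge> 0" "\<And>z s. z \<notin> embed_cn ` closure U \<Longrightarrow> s \<ge> 0 \<Longrightarrow>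
    norm (dbar F z) \<le> C * exp (- (\<rho> * \<omega> s) + s * infdist z (embed_cn ` closure U))"
proof -
  let ?K = "embed_cn ` closure U"
  note dpos = infdist_embed_closure_pos[OF assms(4,3)]
  obtain C where C: "\<And>z. z \<notin> ?K \<Longrightarrow> norm (dbar F z) * exp (\<rho> * wstar \<omega> (infdist z ?K / \<rho>)) \<le> C"
    using assms(1) unfolding dbar_estimate_def by blast
  show thesis
  proof (rule that[of "max C 0"])
    fix z s assume z: "z \<notin> ?K" and s: "(s::real) \<ge> 0"
    let ?d = "infdist z ?K"
    have t: "?d / \<rho> > 0"
      using dpos[OF z] assms(2) by simp
    \<comment> \<open>Needed for \<open>SUP\<close> on the reals to be an upper bound.\<close>
    have "bdd_above ((\<lambda>s. \<omega> s - s * (?d / \<rho>)) ` {0..})"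
    proof (rule bdd_aboveI2)
      fix s' :: real assume "s' \<in> {0..}"
      then show "\<omega> s' - s' * (?d / \<rho>) \<le> young 1 (?d / \<rho>)"
        using young_ge[OF t, of 1 s'] omega_mono[of s' "max s' 1"] young_nonneg[OF t, of 1] omega_0
        by (cases "s' = 0") auto
    qed
    then have "\<omega> s - s * (?d / \<rho>) \<le> wstar \<omega> (?d / \<rho>)"
      unfolding wstar_def using s by (intro cSUP_upper) auto
    then have "\<rho> * (\<omega> s - s * (?d / \<rho>)) \<le> \<rho> * wstar \<omega> (?d / \<rho>)"
      using assms(2) by (intro mult_left_mono) auto
    then have "exp (\<rho> * \<omega> s - s * ?d) \<le> exp (\<rho> * wstar \<omega> (?d / \<rho>))"
      using assms(2) by (simp add: right_diff_distrib)
    then have "norm (dbar F z) * exp (\<rho> * \<omega> s - s * ?d) \<le> norm (dbar F z) * exp (\<rho> * wstar \<omega> (?d / \<rho>))"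
      by (intro mult_left_mono) auto
    also have "\<dots> \<le> max C 0"
      using C[OF z] by simp
    finally have "norm (dbar F z) * exp (\<rho> * \<omega> s - s * ?d) * exp (- (\<rho> * \<omega> s) + s * ?d) \<le> max C 0 * exp (- (\<rho> * \<omega> s) + s * ?d)"
      by (intro mult_right_mono) auto
    then show "norm (dbar F z) \<le> max C 0 * exp (- (\<rho> * \<omega> s) + s * ?d)"
      by (simp add: mult.assoc flip: exp_add)
  qed simp
qed

lemma power_exp_omega_bounded:
  assumes "c > 0"
  obtains C where "C \<ge> 1" "\<And>s. s \<ge> 1 \<Longrightarrow> s ^ N * exp (- c * \<omega> s) \<le> C"
proof -
  obtain X where X: "X \<ge> 1" "\<And>s. s \<ge> X \<Longrightarrow> ln s \<le> (c / (real N + 1)) * \<omega> s"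
    using ln_le_omega[of "c / (real N + 1)"] assms by auto
  show thesis
  proof (rule that[of "X ^ N"])
    show "X ^ N \<ge> 1"
      using X(1) by (rule one_le_power)
    fix s :: real assume s: "s \<ge> 1"
    show "s ^ N * exp (- c * \<omega> s) \<le> X ^ N"
    proof (cases "s \<ge> X")
      case True
      have "real N * ln s \<le> (real N + 1) * ln s"
        using s by (intro mult_right_mono) auto
      also have "\<dots> \<le> (real N + 1) * ((c / (real N + 1)) * \<omega> s)"
        using X(2)[OF True] by (intro mult_left_mono) auto
      also have "\<dots> = c * \<omega> s"
        by (simp add: add_nonneg_eq_0_iff)
      finally have "exp (real N * ln s + - c * \<omega> s) \<le> 1"
        by simp
      then have "s ^ N * exp (- c * \<omega> s) \<le> 1"
        using s unfolding exp_add by (simp add: exp_of_nat_mult)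
      also have "1 \<le> X ^ N"
        using X(1) by (rule one_le_power)
      finally show ?thesis .
    next
      case False
      have "s ^ N * exp (- c * \<omega> s) \<le> X ^ N * 1"
        using False s assms omega_nonneg[of s] by (intro mult_mono power_mono) auto
      then show ?thesis
        by simp
    qed
  qed
qed

text \<open>The estimate concerns only points off the closure. These approach \<open>w\<close> in an
  imaginary direction; with \<open>s\<close> the inverse of the displacement the bound is
  \<open>C * exp 1 * exp (- (\<rho> * \<omega> s))\<close>, which tends to 0, and
  \<open>dbar F\<close> is continuous.\<close>

lemma dbar_zero_on_closure:
  fixes F :: "complex^'n::finite \<Rightarrow> complex"
  assumes "dbar_estimate \<omega> U \<rho> F" "\<rho> > 0" "U \<noteq> {}" "bounded U" "C1c F" "w \<in> embed_cn ` closure U"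
  shows "dbar F w = 0"
proof -
  let ?K = "embed_cn ` closure U"
  obtain C where C: "C \<ge> 0" "\<And>z s. z \<notin> ?K \<Longrightarrow> s \<ge> 0 \<Longrightarrow>
    norm (dbar F z) \<le> C * exp (- (\<rho> * \<omega> s) + s * infdist z ?K)"
    using dbar_estimateD[OF assms(1-4)] by blast
  define z :: "nat \<Rightarrow> complex^'n" where "z m = w + axis undefined (\<i> / of_nat (Suc m))" for m
  have "z m \<notin> ?K" for m
  proof
    assume "z m \<in> ?K"
    then have "Im (z m $ undefined) = 0"
      by auto
    moreover have "Im (w $ undefined) = 0"
      using assms(6) by auto
    ultimately show False
      by (simp add: z_def axis_def Im_divide_of_nat del: of_nat_Suc)
  qed
  note zK = this
  have dist: "infdist (z m) ?K \<le> 1 / real (Suc m)" for m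
  proof -
    have "infdist (z m) ?K \<le> dist (z m) w"
      using assms(6) by (rule infdist_le)
    also have "\<dots> = 1 / real (Suc m)"
      by (simp add: z_def dist_norm norm_axis norm_divide del: of_nat_Suc)
    finally show ?thesis .
  qed
  have "norm (dbar F (z m)) \<le> C * exp 1 * exp (- (\<rho> * \<omega> (real (Suc m))))" for m
  proof -
    have "norm (dbar F (z m)) \<le> C * exp (- (\<rho> * \<omega> (real (Suc m))) + real (Suc m) * infdist (z m) ?K)"
      by (rule C(2)[OF zK]) simp
    also have "\<dots> \<le> C * exp (- (\<rho> * \<omega> (real (Suc m))) + 1)"
    proof -
      have "real (Suc m) * infdist (z m) ?K \<le> real (Suc m) * (1 / real (Suc m))"
        using dist by (intro mult_left_mono) auto
      then show ?thesis
        using C(1) by (intro mult_left_mono) auto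
    qed
    finally show ?thesis
      unfolding exp_add by (simp only: mult_ac)
  qed
  moreover have "(\<lambda>m. C * exp 1 * exp (- (\<rho> * \<omega> (real (Suc m))))) \<longlonglongrightarrow> C * exp 1 * 0"
  proof (intro tendsto_mult tendsto_const)
    have "filterlim (\<lambda>m. \<omega> (real (Suc m))) at_top sequentially"
      by (intro filterlim_compose[OF omega_at_top] filterlim_compose[OF filterlim_real_sequentially] filterlim_Suc)
    then have "filterlim (\<lambda>m. \<rho> * \<omega> (real (Suc m))) at_top sequentially"
      using assms(2) by (intro filterlim_tendsto_pos_mult_at_top[OF tendsto_const])
    then have "filterlim (\<lambda>m. - (\<rho> * \<omega> (real (Suc m)))) at_bot sequentially"
      by (simp add: filterlim_uminus_at_top)
    then show "(\<lambda>m. exp (- (\<rho> * \<omega> (real (Suc m))))) \<longlonglongrightarrow> 0"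
      by (rule filterlim_compose[OF exp_at_bot])
  qed
  ultimately have "(\<lambda>m. dbar F (z m)) \<longlonglongrightarrow> 0"
    by (intro Lim_null_comparison[of "\<lambda>m. dbar F (z m)" "\<lambda>m. C * exp 1 * exp (- (\<rho> * \<omega> (real (Suc m))))"] always_eventually) auto
  moreover have "(\<lambda>m. dbar F (z m)) \<longlonglongrightarrow> dbar F w"
  proof -
    have "z \<longlonglongrightarrow> w"
    proof (rule LIM_zero_cancel, rule tendsto_norm_zero_cancel)
      have "norm (z m - w) = inverse (real (Suc m))" for m
        by (simp add: z_def norm_axis norm_divide inverse_eq_divide del: of_nat_Suc)
      then show "(\<lambda>m. norm (z m - w)) \<longlonglongrightarrow> 0"
        using LIMSEQ_inverse_real_of_nat by simp
    qed
    then show ?thesis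
      using continuous_dbar[OF assms(5)] by (intro isCont_tendsto_compose[where g = "dbar F" and l = w]) (auto simp: continuous_on_eq_continuous_at)
  qed
  ultimately show ?thesis
    by (rule LIMSEQ_unique[symmetric])
qed

text \<open>Choose \<open>s\<close> so that \<open>s * norm (w - embed_cn x)\<close> equals the
  exponent \<open>2 * CARD('n) - 1 + k\<close>. Then \<open>exp (s * d)\<close> is only geometric in
  \<open>k\<close>, the factorial is at most a power of the same number, and concavity moves all
  geometric factors into the parameter.\<close>

lemma dbar_flat_weighted:
  fixes F :: "complex^'n::finite \<Rightarrow> complex"
  assumes "dbar_estimate \<omega> U \<rho> F" "\<rho> > 0" "U \<noteq> {}" "bounded U" "C1c F"
  defines "\<rho>' \<equiv> 2 * (exp 1 * (2 * real CARD('n) + 4)) / \<rho>"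
  obtains C where "C \<ge> 0" "\<And>k w x. x \<in> U \<Longrightarrow>
    norm (dbar F w) * ((2 * real CARD('n) + 4) ^ k * fact k) \<le> C * exp ((1 / \<rho>') * wphi_conj \<omega> (\<rho>' * real k)) * norm (w - embed_cn x) ^ (2 * CARD('n) - 1 + k)"
proof -
  let ?K = "embed_cn ` closure U" and ?n = "CARD('n)"
  \<comment> \<open>\<open>exp 1\<close> stems from \<open>exp (s * d)\<close>, the other factor
    from the growth of the kernel constants.\<close>
  define Q where "Q = exp 1 * (2 * real ?n + 4)"
  have Q1: "Q \<ge> 1"
  proof -
    have "1 * 1 \<le> exp 1 * (2 * real ?n + 4)"
      by (intro mult_mono) auto
    then show ?thesis
      by (simp add: Q_def)
  qed
  have \<rho>': "\<rho>' = 2 * Q / \<rho>" "\<rho>' > 0"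
    using assms(2) Q1 by (simp_all add: \<rho>'_def Q_def add_pos_pos)
  let ?M = "\<lambda>k. exp ((1 / \<rho>') * wphi_conj \<omega> (\<rho>' * real k))"
  obtain C where C: "C \<ge> 0" "\<And>z s. z \<notin> ?K \<Longrightarrow> s \<ge> 0 \<Longrightarrow>
    norm (dbar F z) \<le> C * exp (- (\<rho> * \<omega> s) + s * infdist z ?K)"
    using dbar_estimateD[OF assms(1-4)] by blast
  obtain C2 where C2: "C2 \<ge> 1" "\<And>s. s \<ge> 1 \<Longrightarrow> s ^ (2 * ?n - 1) * exp (- (\<rho> / (2 * Q)) * \<omega> s) \<le> C2"
    using power_exp_omega_bounded[of "\<rho> / (2 * Q)" "2 * ?n - 1"] assms(2) Q1 by auto
  define C3 where "C3 = C2 + exp (\<omega> 1 / \<rho>')"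
  have n1: "?n \<ge> 1"
    by (simp add: Suc_leI)
  show thesis
  proof (rule that[of "C * C3"])
    show "C * C3 \<ge> 0"
      using C(1) C2(1) by (simp add: C3_def add_nonneg_nonneg)
    fix k w and x :: "real^'n" assume x: "x \<in> U"
    let ?e = "2 * ?n - 1 + k" and ?l = "norm (w - embed_cn x)"
    show "norm (dbar F w) * ((2 * real ?n + 4) ^ k * fact k) \<le> C * C3 * ?M k * ?l ^ ?e"
    proof (cases "w \<in> ?K")
      case True
      then show ?thesis
        using dbar_zero_on_closure[OF assms(1-5) True] C(1) C2(1) by (simp add: C3_def add_nonneg_nonneg)
    next
      case False
      have d: "infdist w ?K \<le> ?l"
        using infdist_le[of "embed_cn x" ?K w] x closure_subset by (force simp: dist_norm)
      have l: "?l > 0"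
        using False x closure_subset by force
      have e: "?e > 0"
        using n1 by linarith
      have ke: "k \<le> ?e"
        using n1 by linarith
      define s where "s = real ?e / ?l"
      have s: "s > 0"
        using l e unfolding s_def by (intro divide_pos_pos) auto
      have sl: "s * ?l = real ?e"
        using l by (simp add: s_def)
      have "norm (dbar F w) \<le> C * exp (- (\<rho> * \<omega> s) + s * infdist w ?K)"
        using s by (intro C(2)[OF False]) simp
      also have "\<dots> \<le> C * exp (- (\<rho> * \<omega> s) + real ?e)"
      proof -
        have "s * infdist w ?K \<le> s * ?l"
          using d s by (intro mult_left_mono) auto
        then show ?thesis
          using C(1) sl by (intro mult_left_mono) auto
      qed
      also have "\<dots> = C * (exp (- (\<rho> * \<omega> s)) * exp 1 ^ ?e)"
        unfolding exp_add using exp_of_nat_mult[of ?e "1::real"] by simp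
      finally have 1: "norm (dbar F w) \<le> C * (exp (- (\<rho> * \<omega> s)) * exp 1 ^ ?e)" .
      have 2: "(2 * real ?n + 4) ^ k * fact k \<le> (2 * real ?n + 4) ^ ?e * (s * ?l) ^ ?e"
      proof (intro mult_mono)
        show "(2 * real ?n + 4) ^ k \<le> (2 * real ?n + 4) ^ ?e"
          by (rule power_increasing[OF ke]) simp
        have "(fact k :: real) \<le> fact ?e"
          by (rule fact_mono[OF ke])
        also have "\<dots> \<le> real (?e ^ ?e)"
          by (rule fact_le_power)
        finally show "fact k \<le> (s * ?l) ^ ?e"
          unfolding sl by simp
      qed auto
      have "norm (dbar F w) * ((2 * real ?n + 4) ^ k * fact k)
        \<le> (C * (exp (- (\<rho> * \<omega> s)) * exp 1 ^ ?e)) * ((2 * real ?n + 4) ^ ?e * (s * ?l) ^ ?e)"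
        by (rule mult_mono[OF 1 2]) (use C(1) in auto)
      also have "\<dots> = C * ((Q * s) ^ ?e * exp (- (\<rho> * \<omega> s))) * ?l ^ ?e"
        by (simp only: Q_def power_mult_distrib mult_ac)
      also have "\<dots> \<le> C * (C3 * ?M k) * ?l ^ ?e"
      proof (intro mult_right_mono mult_left_mono)
        define S where "S = Q * s"
        have S: "S > 0"
          using s Q1 by (simp add: S_def)
        have "s * \<omega> S \<le> S * \<omega> s"
          using s Q1 by (intro omega_ratio) (auto simp: S_def)
        then have "\<omega> S \<le> Q * \<omega> s"
          using s by (simp add: S_def)
        then have "(\<rho> / Q) * \<omega> S \<le> (\<rho> / Q) * (Q * \<omega> s)"
          using assms(2) Q1 by (intro mult_left_mono) auto
        then have "exp (- (\<rho> * \<omega> s)) \<le> exp (- (\<rho> / Q) * \<omega> S)"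
          using Q1 by simp
        then have "(Q * s) ^ ?e * exp (- (\<rho> * \<omega> s)) \<le> S ^ ?e * exp (- (\<rho> / Q) * \<omega> S)"
          using S unfolding S_def by (intro mult_left_mono) auto
        also have "\<dots> \<le> C3 * ?M k"
        proof (cases "S \<ge> 1")
          case True
          \<comment> \<open>One half of the exponent pays for the \<open>2 * CARD('n) - 1\<close>
            additional powers, the other half gives the weight sequence with parameter
            \<open>\<rho>'\<close>.\<close>
          have "exp (- (\<rho> / Q) * \<omega> S) = exp (- (\<rho> / (2 * Q)) * \<omega> S) * exp (- \<omega> S / \<rho>')"
            unfolding \<rho>' using assms(2) Q1 by (simp add: field_simps flip: exp_add)
          then have "S ^ ?e * exp (- (\<rho> / Q) * \<omega> S) = (S ^ (2 * ?n - 1) * exp (- (\<rho> / (2 * Q)) * \<omega> S)) * (S ^ k * exp (- \<omega> S / \<rho>'))"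
            by (simp only: power_add mult_ac)
          also have "\<dots> \<le> C2 * ?M k"
            using C2(2)[OF True] power_exp_le_conj[OF \<rho>'(2) True] C2(1) S by (intro mult_mono) auto
          also have "\<dots> \<le> C3 * ?M k"
            by (intro mult_right_mono) (auto simp: C3_def)
          finally show ?thesis .
        next
          case False
          \<comment> \<open>For \<open>S < 1\<close> the left side is at most 1; comparison with the
            supremum at the point 1 costs \<open>exp (\<omega> 1 / \<rho>')\<close>.\<close>
          have "S ^ ?e * exp (- (\<rho> / Q) * \<omega> S) \<le> 1 * 1"
            using False S assms(2) Q1 omega_nonneg[of S] by (intro mult_mono power_le_one) (auto intro!: divide_nonneg_nonneg mult_nonneg_nonneg)
          also have "\<dots> = exp (\<omega> 1 / \<rho>') * (1 ^ k * exp (- \<omega> 1 / \<rho>'))"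
            by (simp flip: exp_add)
          also have "\<dots> \<le> exp (\<omega> 1 / \<rho>') * ?M k"
            by (intro mult_left_mono power_exp_le_conj[OF \<rho>'(2)]) auto
          also have "\<dots> \<le> C3 * ?M k"
            using C2(1) by (intro mult_right_mono) (auto simp: C3_def)
          finally show ?thesis .
        qed
        finally show "(Q * s) ^ ?e * exp (- (\<rho> * \<omega> s)) \<le> C3 * ?M k" .
      qed (use C(1) in auto)
      finally show ?thesis
        by (simp only: mult_ac)
    qed
  qed
qed

text \<open>Derivatives of order \<open>k\<close> are potentials of kernels with constants at most
  \<open>P k\<close>, and the weighted flatness divides out exactly this growth, leaving the weight
  sequence.\<close>

lemma class_of_dbar_estimate:
  fixes F :: "complex^'n::finite \<Rightarrow> complex" and f :: "real^'n \<Rightarrow> complex"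
  assumes U: "quasiconvex_domain U" and F: "C1c F" and f: "\<And>x. x \<in> U \<Longrightarrow> F (embed_cn x) = f x"
    and est: "dbar_estimate \<omega> U \<rho> F" "\<rho> > 0"
  shows "smooth_on U f" "bounded_with \<omega> U (2 * (exp 1 * (2 * real CARD('n) + 4)) / \<rho>) f"
proof -
  let ?n = "CARD('n)"
  define \<rho>' where "\<rho>' = 2 * (exp 1 * (2 * real ?n + 4)) / \<rho>"
  let ?M = "\<lambda>k. exp ((1 / \<rho>') * wphi_conj \<omega> (\<rho>' * real k))"
  have U': "U \<noteq> {}" "bounded U" "open U"
    using U by (auto simp: quasiconvex_domain_def)
  obtain C where C: "C \<ge> 0" "\<And>k w x. x \<in> U \<Longrightarrow>
    norm (dbar F w) * ((2 * real ?n + 4) ^ k * fact k) \<le> C * ?M k * norm (w - embed_cn x) ^ (2 * ?n - 1 + k)"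
    using dbar_flat_weighted[OF est U'(1,2) F] unfolding \<rho>'_def by blast
  obtain r where r: "r > 0" "\<And>z. norm z > r \<Longrightarrow> dbar F z = 0"
    using dbar_support[OF F] by blast
  obtain B where B: "B > 0" "\<And>z. norm (dbar F z) \<le> B"
    using dbar_bounded[OF F] by blast
  define P where "P k = (2 * real ?n + 4) ^ k * fact k" for k
  have P: "P k > 0" for k
    by (simp add: P_def add_pos_pos)
  have Ck: "norm (dbar F w $ j) \<le> (C * ?M k / P k) * norm (w - embed_cn x) ^ (2 * ?n - 1 + k)" if "x \<in> U" for j k w x
  proof -
    have "norm (dbar F w $ j) * P k \<le> norm (dbar F w) * P k"
      using P[of k] by (intro mult_right_mono Finite_Cartesian_Product.norm_nth_le) auto
    also have "\<dots> \<le> C * ?M k * norm (w - embed_cn x) ^ (2 * ?n - 1 + k)"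
      unfolding P_def by (rule C(2)[OF that])
    finally show ?thesis
      using P[of k] by (simp add: field_simps)
  qed
  have flat: "flat_density (\<lambda>w. dbar F w $ j) U r" for j
  proof
    show "continuous_on UNIV (\<lambda>w. dbar F w $ j)"
      using continuous_dbar[OF F] by (intro continuous_intros)
    show "dbar F w $ j = 0" if "norm w > r" for w
      using r(2)[OF that] by simp
    show "open U"
      by fact
    show "\<exists>C\<ge>0. \<forall>w. \<forall>x\<in>U. norm (dbar F w $ j) \<le> C * norm (w - embed_cn x) ^ N" for N
    proof -
      let ?e = "2 * ?n - 1 + N"
      let ?C = "C * ?M N / P N"
      have C0: "?C \<ge> 0"
        using C(1) P[of N] by simp
      have "norm (dbar F w $ j) \<le> (?C + B) * norm (w - embed_cn x) ^ N" if x: "x \<in> U" for w x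
      \<comment> \<open>The order at hand is at least \<open>N\<close>; lowering it is free within
        distance 1, and beyond that boundedness suffices.\<close>
      proof (cases "norm (w - embed_cn x) \<le> 1")
        case True
        have "norm (dbar F w $ j) \<le> ?C * norm (w - embed_cn x) ^ ?e"
          by (rule Ck[OF x])
        also have "\<dots> \<le> (?C + B) * norm (w - embed_cn x) ^ N"
        proof (intro mult_mono power_decreasing)
          show "N \<le> ?e"
            using zero_less_card_finite[where 'a = 'n] by linarith
        qed (use True C0 B(1) in auto)
        finally show ?thesis .
      next
        case False
        have "norm (dbar F w $ j) \<le> B"
          using B(2)[of w] Finite_Cartesian_Product.norm_nth_le[of "dbar F w" j] by linarith
        also have "\<dots> \<le> (?C + B) * norm (w - embed_cn x) ^ N"
          using False C0 B(1) mult_mono[of B "?C + B" 1 "norm (w - embed_cn x) ^ N"] by (simp add: one_le_power)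
        finally show ?thesis .
      qed
      moreover have "?C + B \<ge> 0"
        using C0 B(1) by simp
      ultimately show ?thesis
        by blast
    qed
  qed
  note pot = pderiv_list_potential[OF F flat f]
  show smooth: "smooth_on U f"
    unfolding smooth_on_def using pot by blast
  define V where "V = measure lborel (cball (0 :: complex^'n) r)"
  define c where "c = \<bar>- 1 / bm_const TYPE('n)\<bar>"
  have "norm (pderiv_multi \<alpha> f x) * exp (- (1 / \<rho>') * wphi_conj \<omega> (\<rho>' * real (mi_abs \<alpha>))) \<le> c * (real ?n * (C * V))"
    if x: "x \<in> U" for x and \<alpha> :: "'n \<Rightarrow> nat"
  proof -
    obtain ks where ks: "\<alpha> = count (mset ks)" "mi_abs \<alpha> = length ks"
      using multi_index_mset by blast
    let ?k = "length ks"
    obtain gs where gs: "\<And>j. kern ?k (kern_const ?n ?k) (gs j)"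
      "pderiv_list ks f x = of_real (- 1 / bm_const TYPE('n)) * (- 1) ^ ?k *
        (\<Sum>j\<in>UNIV. flat_density.potential (\<lambda>w. dbar F w $ j) (gs j) x)"
      using pot[of ks] x by blast
    have V: "V \<ge> 0"
      by (simp add: V_def)
    have "norm (flat_density.potential (\<lambda>w. dbar F w $ j) (gs j) x) \<le> C * ?M ?k * V" for j
    proof -
      have "norm (flat_density.potential (\<lambda>w. dbar F w $ j) (gs j) x) \<le> (C * ?M ?k / P ?k) * kern_const ?n ?k * V"
        unfolding V_def using C(1) P[of ?k] by (intro flat_density.potential_bound[OF flat gs(1) x _ Ck]) auto
      also have "\<dots> \<le> (C * ?M ?k / P ?k) * P ?k * V"
        using C(1) P[of ?k] V kern_const_le[of ?n ?k] by (intro mult_right_mono mult_left_mono) (auto simp: P_def)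
      also have "\<dots> = C * ?M ?k * V"
        using P[of ?k] by simp
      finally show ?thesis .
    qed
    then have "norm (\<Sum>j\<in>UNIV. flat_density.potential (\<lambda>w. dbar F w $ j) (gs j) x) \<le> (\<Sum>j::'n\<in>UNIV. C * ?M ?k * V)"
      by (rule sum_norm_le)
    then have "norm (pderiv_list ks f x) \<le> c * (real ?n * (C * ?M ?k * V))"
      unfolding gs(2) norm_mult norm_of_real c_def by (intro mult_mono) (auto simp: norm_power norm_mult)
    also have "pderiv_list ks f x = pderiv_multi \<alpha> f x"
      using pderiv_multi_mset[OF smooth U'(3) x, of ks] ks(1) by simp
    finally have "norm (pderiv_multi \<alpha> f x) * exp (- (1 / \<rho>') * wphi_conj \<omega> (\<rho>' * real ?k))
      \<le> c * (real ?n * (C * ?M ?k * V)) * exp (- (1 / \<rho>') * wphi_conj \<omega> (\<rho>' * real ?k))"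
      by (intro mult_right_mono) auto
    also have "\<dots> = c * (real ?n * (C * V)) * (?M ?k * exp (- (1 / \<rho>') * wphi_conj \<omega> (\<rho>' * real ?k)))"
      by (simp only: mult_ac)
    also have "?M ?k * exp (- (1 / \<rho>') * wphi_conj \<omega> (\<rho>' * real ?k)) = 1"
      by (simp flip: exp_add)
    finally show ?thesis
      by (simp add: ks(2))
  qed
  then show "bounded_with \<omega> U (2 * (exp 1 * (2 * real ?n + 4)) / \<rho>) f"
    unfolding bounded_with_def \<rho>'_def[symmetric] by blast
qed

text \<open>The class parameter is the inverse of the factor \<open>2 * \<tau>\<close> of
  \<open>\<omega>\<close>, and the weight sequence is at most any upper bound \<open>B\<close> of
  the supremum that describes it.\<close>

lemma jets_of_class:
  fixes U :: "(real^'n::finite) set"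
  assumes "quasiconvex_domain U" "\<tau> > 0" "bounded_with \<omega> U (1 / (2 * \<tau>)) f"
  shows "\<exists>C\<ge>0. \<forall>u\<in>U. \<forall>m B. (\<forall>s\<ge>1. s ^ size m * exp (- (2 * \<tau>) * \<omega> s) \<le> B) \<longrightarrow> norm (pderiv_multi (count m) f u) \<le> C * B"
proof -
  let ?\<rho> = "1 / (2 * \<tau>)"
  obtain C where C: "\<And>u \<alpha>. u \<in> U \<Longrightarrow> norm (pderiv_multi \<alpha> f u) * exp (- (1 / ?\<rho>) * wphi_conj \<omega> (?\<rho> * real (mi_abs \<alpha>))) \<le> C"
    using assms(3) unfolding bounded_with_def by blast
  have "norm (pderiv_multi (count m) f u) \<le> max C 0 * B"
    if u: "u \<in> U" and B: "\<forall>s\<ge>1. s ^ size m * exp (- (2 * \<tau>) * \<omega> s) \<le> B" for u B and m :: "'n multiset"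
  proof -
    let ?M = "exp ((1 / ?\<rho>) * wphi_conj \<omega> (?\<rho> * real (size m)))"
    have M: "?M \<le> B"
      using B assms(2) by (intro exp_conj_le) (auto simp: mult.commute)
    have "norm (pderiv_multi (count m) f u) * exp (- (1 / ?\<rho>) * wphi_conj \<omega> (?\<rho> * real (size m))) * ?M \<le> max C 0 * ?M"
      using C[OF u, of "count m"] by (intro mult_right_mono) (auto simp: mi_abs_count)
    moreover have "exp (- (1 / ?\<rho>) * wphi_conj \<omega> (?\<rho> * real (size m))) * ?M = 1"
      by (simp flip: exp_add)
    ultimately have "norm (pderiv_multi (count m) f u) \<le> max C 0 * ?M"
      by (simp only: mult.assoc mult_1_right)
    also have "\<dots> \<le> max C 0 * B"
      using M by (intro mult_left_mono) auto
    finally show ?thesis .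
  qed
  then show ?thesis
    by (intro exI[of _ "max C 0"]) auto
qed

lemma jet_of_smooth:
  assumes "quasiconvex_domain U" "smooth_on U f"
  shows "jet (\<lambda>m. pderiv_multi (count m) f) U"
  using assms by unfold_locales (auto simp: quasiconvex_domain_def intro!: pderiv_multi_has_derivative)

lemma pderiv_multi_empty:
  assumes "smooth_on U f" "open U" "x \<in> U"
  shows "pderiv_multi (count {#}) f x = f x"
  using pderiv_multi_mset[OF assms, of "[]"] by simp

end

theorem theorem4p9:
  fixes \<omega> :: "real \<Rightarrow> real" and U :: "(real^'n::finite) set"
  assumes "weight_function \<omega>"
    and "concave_on {0..} \<omega>"
    and "\<omega> \<in> o[at_top](\<lambda>t. t)"
    and "quasiconvex_domain U"
  shows "(\<forall>f. f \<in> roumieu_class \<omega> U \<longleftrightarrow>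
            (\<exists>F \<rho>. C1c F \<and> \<rho> > 0 \<and> (\<forall>x\<in>U. F (embed_cn x) = f x) \<and> dbar_estimate \<omega> U \<rho> F))
       \<and> (\<forall>f. f \<in> beurling_class \<omega> U \<longleftrightarrow>
            (\<forall>\<rho>>0. \<exists>F. C1c F \<and> (\<forall>x\<in>U. F (embed_cn x) = f x) \<and> dbar_estimate \<omega> U \<rho> F))
       \<and> (strong_weight \<omega> \<longrightarrow>
            (\<forall>f\<in>beurling_class \<omega> U.
               \<exists>F. C1c F \<and> (\<forall>x\<in>U. F (embed_cn x) = f x) \<and> (\<forall>\<rho>>0. dbar_estimate \<omega> U \<rho> F)))"
proof -
  interpret concave_weight \<omega>
    using assms(1-3) by unfold_locales
  note U = assms(4)
  have "open U"
    using U by (simp add: quasiconvex_domain_def)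
  let ?Q = "2 * (exp 1 * (2 * real CARD('n) + 4))"
  have Q: "?Q > 0"
    by (simp add: add_pos_pos)
  obtain c where c: "c > 0" and ext:
    "\<And>a \<tau>. jet a U \<Longrightarrow> (\<And>i::nat. \<tau> i > 0) \<Longrightarrow> mono \<tau> \<Longrightarrow>
      (\<And>i. \<exists>C\<ge>0. \<forall>u\<in>U. \<forall>m B. (\<forall>s\<ge>1. s ^ size m * exp (- (2 * \<tau> i) * \<omega> s) \<le> B) \<longrightarrow> norm (a m u) \<le> C * B) \<Longrightarrow>
      \<exists>F. C1c F \<and> (\<forall>x\<in>U. F (embed_cn x) = a {#} x) \<and> (\<forall>i \<rho>. 0 < \<rho> \<longrightarrow> \<rho> \<le> \<tau> i / c \<longrightarrow> dbar_estimate \<omega> U \<rho> F)"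
    using almost_analytic_extension[OF U] by blast
  have forward: "\<exists>F. C1c F \<and> (\<forall>x\<in>U. F (embed_cn x) = f x) \<and> (\<forall>i \<rho>. 0 < \<rho> \<longrightarrow> \<rho> \<le> \<tau> i / c \<longrightarrow> dbar_estimate \<omega> U \<rho> F)"
    if f: "smooth_on U f" and \<tau>: "\<And>i::nat. \<tau> i > 0" "mono \<tau>" and bd: "\<And>i. bounded_with \<omega> U (1 / (2 * \<tau> i)) f" for f \<tau>
    using ext[OF jet_of_smooth[OF U f] \<tau> jets_of_class[OF U \<tau>(1) bd]] pderiv_multi_empty[OF f \<open>open U\<close>] by simp
  have beurling: "\<exists>F. C1c F \<and> (\<forall>x\<in>U. F (embed_cn x) = f x) \<and> (\<forall>\<rho>>0. dbar_estimate \<omega> U \<rho> F)"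
    if f: "f \<in> beurling_class \<omega> U" for f
  proof -
    \<comment> \<open>The unbounded sequence \<open>\<tau> i = real (Suc i)\<close> reaches all
      parameters with a single \<open>F\<close>.\<close>
    have "\<exists>F. C1c F \<and> (\<forall>x\<in>U. F (embed_cn x) = f x) \<and> (\<forall>i \<rho>. 0 < \<rho> \<longrightarrow> \<rho> \<le> real (Suc i) / c \<longrightarrow> dbar_estimate \<omega> U \<rho> F)"
      using f by (intro forward) (auto simp: beurling_class_def mono_def)
    then obtain F where F: "C1c F" "\<forall>x\<in>U. F (embed_cn x) = f x"
      "\<And>i \<rho>. 0 < \<rho> \<Longrightarrow> \<rho> \<le> real (Suc i) / c \<Longrightarrow> dbar_estimate \<omega> U \<rho> F"
      by blast
    have "dbar_estimate \<omega> U \<rho> F" if "\<rho> > 0" for \<rho>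
    proof -
      obtain i :: nat where "\<rho> * c \<le> real i"
        using real_arch_simple by blast
      then have "\<rho> \<le> real (Suc i) / c"
        using c by (simp add: pos_le_divide_eq)
      then show ?thesis
        using F(3) that by blast
    qed
    with F show ?thesis
      by blast
  qed
  have r: "f \<in> roumieu_class \<omega> U \<longleftrightarrow>
      (\<exists>F \<rho>. C1c F \<and> \<rho> > 0 \<and> (\<forall>x\<in>U. F (embed_cn x) = f x) \<and> dbar_estimate \<omega> U \<rho> F)" for f
  proof
    assume "f \<in> roumieu_class \<omega> U"
    then obtain \<rho> where f: "smooth_on U f" "\<rho> > 0" "bounded_with \<omega> U \<rho> f"
      by (auto simp: roumieu_class_def)
    \<comment> \<open>Makes the class parameter \<open>1 / (2 * \<tau>)\<close> equal to
      \<open>\<rho>\<close>; the sequence is constant because only this parameter is at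
      hand.\<close>
    define \<tau> where "\<tau> = 1 / (2 * \<rho>)"
    have \<tau>: "\<tau> > 0" "1 / (2 * \<tau>) = \<rho>"
      using f(2) by (simp_all add: \<tau>_def)
    obtain F where F: "C1c F" "\<forall>x\<in>U. F (embed_cn x) = f x" "\<And>\<rho>. 0 < \<rho> \<Longrightarrow> \<rho> \<le> \<tau> / c \<Longrightarrow> dbar_estimate \<omega> U \<rho> F"
      using forward[OF f(1), of "\<lambda>i. \<tau>"] \<tau> f(3) by (auto simp: mono_def)
    have "\<tau> / c > 0"
      using \<tau>(1) c by simp
    with F show "\<exists>F \<rho>. C1c F \<and> \<rho> > 0 \<and> (\<forall>x\<in>U. F (embed_cn x) = f x) \<and> dbar_estimate \<omega> U \<rho> F"
      by (intro exI[of _ F] exI[of _ "\<tau> / c"]) simp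
  next
    assume "\<exists>F \<rho>. C1c F \<and> \<rho> > 0 \<and> (\<forall>x\<in>U. F (embed_cn x) = f x) \<and> dbar_estimate \<omega> U \<rho> F"
    then obtain F \<rho> where F: "C1c F" "\<rho> > 0" "\<And>x. x \<in> U \<Longrightarrow> F (embed_cn x) = f x" "dbar_estimate \<omega> U \<rho> F"
      by blast
    show "f \<in> roumieu_class \<omega> U"
      using class_of_dbar_estimate[OF U F(1,3,4,2)] divide_pos_pos[OF Q F(2)] unfolding roumieu_class_def by blast
  qed
  have b: "f \<in> beurling_class \<omega> U \<longleftrightarrow>
      (\<forall>\<rho>>0. \<exists>F. C1c F \<and> (\<forall>x\<in>U. F (embed_cn x) = f x) \<and> dbar_estimate \<omega> U \<rho> F)" for f
  proof
    assume "f \<in> beurling_class \<omega> U"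
    from beurling[OF this] show "\<forall>\<rho>>0. \<exists>F. C1c F \<and> (\<forall>x\<in>U. F (embed_cn x) = f x) \<and> dbar_estimate \<omega> U \<rho> F"
      by blast
  next
    assume F: "\<forall>\<rho>>0. \<exists>F. C1c F \<and> (\<forall>x\<in>U. F (embed_cn x) = f x) \<and> dbar_estimate \<omega> U \<rho> F"
    have "smooth_on U f \<and> bounded_with \<omega> U \<rho> f" if "\<rho> > 0" for \<rho>
    proof -
      \<comment> \<open>Division of \<open>?Q\<close> by the parameter is an involution, so the
        estimate for \<open>?Q / \<rho>\<close> yields exactly the class bound for
        \<open>\<rho>\<close>.\<close>
      have pos: "?Q / \<rho> > 0"
        using Q that by simp
      then obtain F where F': "C1c F" "\<And>x. x \<in> U \<Longrightarrow> F (embed_cn x) = f x" "dbar_estimate \<omega> U (?Q / \<rho>) F"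
        using F by blast
      have "?Q / (?Q / \<rho>) = \<rho>"
        using Q that by simp
      then show ?thesis
        using class_of_dbar_estimate[OF U F' pos] by simp
    qed
    \<comment> \<open>Smoothness was obtained together with a parameter, so one positive value has
      to be supplied.\<close>
    then show "f \<in> beurling_class \<omega> U"
      unfolding beurling_class_def using zero_less_one by blast
  qed
  show ?thesis
    using r b beurling by blast
qed

end
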